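(* Let $\mathbf{k}$ be an algebraically closed field of characteristic $0$, $\Gamma$ a finite group, $g\in\Gamma$, and $\rho$ an irreducible representation of the centralizer $\Gamma_g=\{x\in\Gamma\mid xg=gx\}$ over $\mathbf{k}$. Since $g$ is central in $\Gamma_g$, $\rho(g)$ is a scalar $q\in\mathbf{k}^\times$; let $N=N(q)$. Let $V=M(g,\rho)$ and suppose that $V$ is of finite Nichols rank, i.e. $\dim\mathfrak{B}(V)<\infty$. Then: \begin{enumerate} \item if $\deg\rho\ge3$ then $N=2$ (i.e. $q=-1$); \item if $\deg\rho=2$ then $2\le N\le3$ (i.e. $q=-1$ or $q$ is a primitive third root of unity). \end{enumerate}
   Context: For $q\in\mathbf{k}^\times$, $N(q)$ is the order of $q$ if $q\neq1$ is a root of unity, and $N(q)=\infty$ if $q=1$ or $q$ is not a root of unity. $M(g,\rho)$ is the (left-left) Yetter--Drinfeld module over $\mathbf{k}\Gamma$ given by $M(g,\rho)=\mathbf{k}\Gamma\otimes_{\mathbf{k}\Gamma_g}W$, where $W$ is the space of $\rho$, with action $h\cdot(t\otimes x)=ht\otimes x$ and coaction $\delta(t\otimes x)=tgt^{-1}\otimes(t\otimes x)$, for $h,t\in\Gamma$, $x\in W$. Its braiding is $c\big((t\otimes x)\otimes v\big)=(tgt^{-1}\cdot v)\otimes(t\otimes x)$. Nichols algebra. The braid group $\mathbb{B}_n$ (generators $\sigma_1,\dots,\sigma_{n-1}$) acts on $V^{\otimes n}$, $\sigma_i$ acting by $c$ in positions $i,i+1$. Let $s:\mathbb{S}_n\to\mathbb{B}_n$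 be the set-theoretic section sending a reduced expression $\tau_{i_1}\cdots\tau_{i_l}$ ($\tau_i=(i\ i{+}1)$) to $\sigma_{i_1}\cdots\sigma_{i_l}$, and $\mathbf{S}^n=\sum_{x\in\mathbb{S}_n}s(x)$. The Nichols algebra $\mathfrak{B}(V)$ is the image of the graded map $\bigoplus_n\mathbf{S}^n$ from the tensor algebra of $V$ to the tensor coalgebra of $V$; as an algebra it is the quotient of the tensor algebra by $\bigoplus_n\ker\mathbf{S}^n$. The Nichols rank of $V$ is $\dim\mathfrak{B}(V)$. *)

theory Defs
  imports
    "HOL-Algebra.Module"
    "HOL-Library.Poly_Mapping"
    "HOL-Library.Set_Algebras"
    "HOL-Library.Extended_Nat"
    "HOL-Combinatorics.Permutations"
    "HOL-Computational_Algebra.Polynomial"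
begin

text \<open>
  Vector spaces over a field type \<open>'k\<close> come in two forms. The space of a representation is a whole
  type with a scalar multiplication (library locale \<open>vector_space\<close>). Spaces which are quotients
  are \<open>module\<close> records of HOL-Algebra whose elements are cosets; the ring multiplication fields of
  these records carry no meaning and are left undefined.
\<close>

section \<open>Quotient spaces\<close>

definition pm_scale :: "('k \<Rightarrow> 'b \<Rightarrow> 'b) \<Rightarrow> 'k \<Rightarrow> ('a \<Rightarrow>\<^sub>0 'b::zero) \<Rightarrow> 'a \<Rightarrow>\<^sub>0 'b" where
  "pm_scale scale a = Poly_Mapping.map (scale a)"

definition pm_span :: "('k::field \<Rightarrow> 'b \<Rightarrow> 'b) \<Rightarrow> ('a \<Rightarrow>\<^sub>0 'b::ab_group_add) set \<Rightarrow> ('a \<Rightarrow>\<^sub>0 'b) set" where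
  "pm_span scale = Modules.module.span (pm_scale scale)"

text \<open>
  The map induced on cosets of \<open>R\<close> by a linear map \<open>\<phi>\<close> with \<open>\<phi> ` R \<subseteq> R\<close>; then
  \<open>quot_map R \<phi> (f +o R) = \<phi> f +o R\<close>, see lemma \<open>quot_map_coset\<close>.
\<close>

definition quot_map :: "'a::ab_group_add set \<Rightarrow> ('a \<Rightarrow> 'a) \<Rightarrow> 'a set \<Rightarrow> 'a set" where
  "quot_map R \<phi> C = (\<Union>f\<in>C. \<phi> f +o R)"

definition quot_space :: "('k \<Rightarrow> 'a \<Rightarrow> 'a) \<Rightarrow> 'a::ab_group_add set \<Rightarrow> 'a set \<Rightarrow> ('k, 'a set) module" where
  "quot_space scale F R =
     \<lparr>carrier = (\<lambda>f. f +o R) ` F, monoid.mult = undefined, one = undefined,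
      zero = R, add = (\<lambda>C D. C + D), module.smult = (\<lambda>a. quot_map R (scale a))\<rparr>"

definition finite_dimensional :: "('k, 'v, 'z) module_scheme \<Rightarrow> bool" where
  "finite_dimensional M \<longleftrightarrow>
     (\<exists>B. finite B \<and> B \<subseteq> carrier M \<and>
        (\<forall>v\<in>carrier M. \<exists>a. v = (\<Oplus>\<^bsub>M\<^esub>b\<in>B. a b \<odot>\<^bsub>M\<^esub> b)))"


section \<open>Tensor algebra and Nichols algebra of a braided vector space\<close>

text \<open>
  \<open>T(V)\<close> is the space of formal linear combinations of words \<open>[v\<^sub>1,\<dots>,v\<^sub>n]\<close> in elements of \<open>V\<close>,
  modulo multilinearity; the class of \<open>[v\<^sub>1,\<dots>,v\<^sub>n]\<close> is \<open>v\<^sub>1 \<otimes> \<dots> \<otimes> v\<^sub>n\<close>. All relations are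
  homogeneous, so \<open>T(V)\<close> is the direct sum of the tensor powers of \<open>V\<close>.
\<close>

definition words :: "('k, 'v, 'z) module_scheme \<Rightarrow> ('v list \<Rightarrow>\<^sub>0 'k::field) set" where
  "words V = {f. Poly_Mapping.keys f \<subseteq> lists (carrier V)}"

definition multilinear_rels :: "('k, 'v, 'z) module_scheme \<Rightarrow> ('v list \<Rightarrow>\<^sub>0 'k::field) set" where
  "multilinear_rels V = pm_span (*)
     ({Poly_Mapping.single (xs @ [u \<oplus>\<^bsub>V\<^esub> v] @ ys) 1 - Poly_Mapping.single (xs @ [u] @ ys) 1
         - Poly_Mapping.single (xs @ [v] @ ys) 1 | xs ys u v.
         xs \<in> lists (carrier V) \<and> ys \<in> lists (carrier V) \<and> u \<in> carrier V \<and> v \<in> carrier V} \<union>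
      {Poly_Mapping.single (xs @ [a \<odot>\<^bsub>V\<^esub> u] @ ys) 1 - Poly_Mapping.single (xs @ [u] @ ys) a | xs ys a u.
         xs \<in> lists (carrier V) \<and> ys \<in> lists (carrier V) \<and> u \<in> carrier V})"

definition tensor_algebra :: "('k::field, 'v, 'z) module_scheme \<Rightarrow> ('k, ('v list \<Rightarrow>\<^sub>0 'k) set) module" where
  "tensor_algebra V = quot_space (pm_scale (*)) (words V) (multilinear_rels V)"

definition lin_ext :: "('x \<Rightarrow> 'y \<Rightarrow>\<^sub>0 'k) \<Rightarrow> ('x \<Rightarrow>\<^sub>0 'k) \<Rightarrow> 'y \<Rightarrow>\<^sub>0 'k::field" where
  "lin_ext \<phi> f = (\<Sum>x\<in>Poly_Mapping.keys f. pm_scale (*) (Poly_Mapping.lookup f x) (\<phi> x))"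

text \<open>
  A braiding is given by a function \<open>c\<close> where the formal combination of pairs \<open>c u v\<close> represents
  the image of \<open>u \<otimes> v\<close> in \<open>V \<otimes> V\<close>. Positions in a word are counted from \<open>0\<close>, so \<open>sigma c i\<close> acts
  in positions \<open>i\<close>, \<open>i + 1\<close> and the symmetric group permutes \<open>{..<n}\<close>.
\<close>

type_synonym ('k, 'v) braiding = "'v \<Rightarrow> 'v \<Rightarrow> 'v \<times> 'v \<Rightarrow>\<^sub>0 'k"

definition sigma :: "('k, 'v) braiding \<Rightarrow> nat \<Rightarrow> ('v list \<Rightarrow>\<^sub>0 'k) \<Rightarrow> 'v list \<Rightarrow>\<^sub>0 'k::field" where
  "sigma c i = lin_ext (\<lambda>l. lin_ext
     (\<lambda>(u, v). Poly_Mapping.single (take i l @ [u, v] @ drop (i + 2) l) 1) (c (l ! i) (l ! Suc i)))"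

definition word_perm :: "nat list \<Rightarrow> nat \<Rightarrow> nat" where
  "word_perm is = foldr (\<lambda>i p. transpose i (Suc i) \<circ> p) is id"

definition reduced_expression :: "nat \<Rightarrow> (nat \<Rightarrow> nat) \<Rightarrow> nat list \<Rightarrow> bool" where
  "reduced_expression n x is \<longleftrightarrow>
     (\<forall>i\<in>set is. Suc i < n) \<and> word_perm is = x \<and>
     (\<forall>js. (\<forall>j\<in>set js. Suc j < n) \<and> word_perm js = x \<longrightarrow> length is \<le> length js)"

text \<open>
  The action of the braid \<open>s(x)\<close>. On the tensor powers of a braided vector space it does not depend
  on the choice of the reduced expression (Matsumoto).
\<close>

definition braid_section :: "('k, 'v) braiding \<Rightarrow> nat \<Rightarrow> (nat \<Rightarrow> nat) \<Rightarrow> ('v list \<Rightarrow>\<^sub>0 'k) \<Rightarrow> 'v list \<Rightarrow>\<^sub>0 'k::field" where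
  "braid_section c n x =
     foldr (\<lambda>i \<phi>. sigma c i \<circ> \<phi>) (SOME is. reduced_expression n x is) id"

definition quantum_sym :: "('k, 'v) braiding \<Rightarrow> nat \<Rightarrow> ('v list \<Rightarrow>\<^sub>0 'k) \<Rightarrow> 'v list \<Rightarrow>\<^sub>0 'k::field" where
  "quantum_sym c n f = (\<Sum>x | x permutes {..<n}. braid_section c n x f)"

definition total_quantum_sym :: "('k, 'v) braiding \<Rightarrow> ('v list \<Rightarrow>\<^sub>0 'k) \<Rightarrow> 'v list \<Rightarrow>\<^sub>0 'k::field" where
  "total_quantum_sym c = lin_ext (\<lambda>l. quantum_sym c (length l) (Poly_Mapping.single l 1))"

text \<open>The Nichols algebra, as a vector space: the image in \<open>T(V)\<close> of the sum of all \<open>S\<^sup>n\<close>.\<close>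

definition nichols_algebra ::
  "('k::field, 'v, 'z) module_scheme \<Rightarrow> ('k, 'v) braiding \<Rightarrow> ('k, ('v list \<Rightarrow>\<^sub>0 'k) set) module" where
  "nichols_algebra V c = (tensor_algebra V)
     \<lparr>carrier := quot_map (multilinear_rels V) (total_quantum_sym c) ` carrier (tensor_algebra V)\<rparr>"


section \<open>Yetter--Drinfeld modules over a group algebra\<close>

text \<open>
  The coaction \<open>V \<rightarrow> k\<Gamma> \<otimes> V\<close> is recorded by its components:
  \<open>\<delta>(v) = (\<Sum>h\<in>\<Gamma>. h \<otimes> coact v h)\<close>.
\<close>

record ('k, 'v, 'g) yd_module = "('k, 'v) module" +
  act :: "'g \<Rightarrow> 'v \<Rightarrow> 'v"
  coact :: "'v \<Rightarrow> 'g \<Rightarrow> 'v"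

text \<open>\<open>c(u \<otimes> v) = u\<^sub>(\<^sub>-\<^sub>1\<^sub>) \<cdot> v \<otimes> u\<^sub>(\<^sub>0\<^sub>)\<close>\<close>

definition yd_braiding ::
  "('g, 'a) monoid_scheme \<Rightarrow> ('k::field, 'v, 'g, 'z) yd_module_scheme \<Rightarrow> ('k, 'v) braiding" where
  "yd_braiding \<Gamma> V u v = (\<Sum>h\<in>carrier \<Gamma>. Poly_Mapping.single (act V h v, coact V u h) 1)"

definition finite_nichols_rank ::
  "('g, 'a) monoid_scheme \<Rightarrow> ('k::field, 'v, 'g, 'z) yd_module_scheme \<Rightarrow> bool" where
  "finite_nichols_rank \<Gamma> V \<longleftrightarrow> finite_dimensional (nichols_algebra V (yd_braiding \<Gamma> V))"


section \<open>The module \<open>M(g, \<rho>)\<close>\<close>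

definition centralizer :: "('g, 'a) monoid_scheme \<Rightarrow> 'g \<Rightarrow> 'g set" where
  "centralizer \<Gamma> g = {x \<in> carrier \<Gamma>. x \<otimes>\<^bsub>\<Gamma>\<^esub> g = g \<otimes>\<^bsub>\<Gamma>\<^esub> x}"

definition representation ::
  "('g, 'a) monoid_scheme \<Rightarrow> 'g set \<Rightarrow> ('k::field \<Rightarrow> 'w \<Rightarrow> 'w::ab_group_add) \<Rightarrow> ('g \<Rightarrow> 'w \<Rightarrow> 'w) \<Rightarrow> bool" where
  "representation \<Gamma> H scale \<rho> \<longleftrightarrow>
     vector_space scale \<and>
     (\<forall>h\<in>H. Vector_Spaces.linear scale scale (\<rho> h)) \<and>
     \<rho> \<one>\<^bsub>\<Gamma>\<^esub> = id \<and> (\<forall>h\<in>H. \<forall>h'\<in>H. \<rho> (h \<otimes>\<^bsub>\<Gamma>\<^esub> h') = \<rho> h \<circ> \<rho> h')"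

definition irreducible_rep ::
  "('g, 'a) monoid_scheme \<Rightarrow> 'g set \<Rightarrow> ('k::field \<Rightarrow> 'w \<Rightarrow> 'w::ab_group_add) \<Rightarrow> ('g \<Rightarrow> 'w \<Rightarrow> 'w) \<Rightarrow> bool" where
  "irreducible_rep \<Gamma> H scale \<rho> \<longleftrightarrow>
     representation \<Gamma> H scale \<rho> \<and> (UNIV :: 'w set) \<noteq> {0} \<and>
     (\<forall>U. Modules.module.subspace scale U \<and> (\<forall>h\<in>H. \<rho> h ` U \<subseteq> U) \<longrightarrow> U = {0} \<or> U = UNIV)"

definition rep_degree :: "('k::field \<Rightarrow> 'w \<Rightarrow> 'w::ab_group_add) \<Rightarrow> nat" where
  "rep_degree scale = vector_space.dim scale UNIV"

text \<open>
  \<open>k\<Gamma> \<otimes> W\<close> is the space of finitely supported functions \<open>\<Gamma> \<rightarrow> W\<close>, with \<open>t \<otimes> x\<close> the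
  function \<open>single t x\<close>. Tensoring over the subalgebra of \<open>\<Gamma>\<^sub>g\<close> imposes the relations
  \<open>th \<otimes> x = t \<otimes> \<rho>(h)x\<close>.
\<close>

definition group_alg_tensor :: "('g, 'a) monoid_scheme \<Rightarrow> ('g \<Rightarrow>\<^sub>0 'w::ab_group_add) set" where
  "group_alg_tensor \<Gamma> = {f. Poly_Mapping.keys f \<subseteq> carrier \<Gamma>}"

definition balancing_rels ::
  "('g, 'a) monoid_scheme \<Rightarrow> ('k::field \<Rightarrow> 'w \<Rightarrow> 'w::ab_group_add) \<Rightarrow> 'g \<Rightarrow> ('g \<Rightarrow> 'w \<Rightarrow> 'w) \<Rightarrow> ('g \<Rightarrow>\<^sub>0 'w) set" where
  "balancing_rels \<Gamma> scale g \<rho> = pm_span scale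
     {Poly_Mapping.single (t \<otimes>\<^bsub>\<Gamma>\<^esub> h) x - Poly_Mapping.single t (\<rho> h x) | t h x.
        t \<in> carrier \<Gamma> \<and> h \<in> centralizer \<Gamma> g}"

definition left_translate :: "('g, 'a) monoid_scheme \<Rightarrow> 'g \<Rightarrow> ('g \<Rightarrow>\<^sub>0 'w::ab_group_add) \<Rightarrow> 'g \<Rightarrow>\<^sub>0 'w" where
  "left_translate \<Gamma> h f =
     (\<Sum>t\<in>Poly_Mapping.keys f. Poly_Mapping.single (h \<otimes>\<^bsub>\<Gamma>\<^esub> t) (Poly_Mapping.lookup f t))"

definition conj_component ::
  "('g, 'a) monoid_scheme \<Rightarrow> 'g \<Rightarrow> 'g \<Rightarrow> ('g \<Rightarrow>\<^sub>0 'w::ab_group_add) \<Rightarrow> 'g \<Rightarrow>\<^sub>0 'w" where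
  "conj_component \<Gamma> g h f =
     (\<Sum>t\<in>Poly_Mapping.keys f.
        if t \<otimes>\<^bsub>\<Gamma>\<^esub> g \<otimes>\<^bsub>\<Gamma>\<^esub> inv\<^bsub>\<Gamma>\<^esub> t = h then Poly_Mapping.single t (Poly_Mapping.lookup f t) else 0)"

definition yd_M ::
  "('g, 'a) monoid_scheme \<Rightarrow> ('k::field \<Rightarrow> 'w \<Rightarrow> 'w::ab_group_add) \<Rightarrow> 'g \<Rightarrow> ('g \<Rightarrow> 'w \<Rightarrow> 'w)
     \<Rightarrow> ('k, ('g \<Rightarrow>\<^sub>0 'w) set, 'g) yd_module" where
  "yd_M \<Gamma> scale g \<rho> = (let R = balancing_rels \<Gamma> scale g \<rho> in
     module.extend (quot_space (pm_scale scale) (group_alg_tensor \<Gamma>) R)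
       \<lparr>act = (\<lambda>h. quot_map R (left_translate \<Gamma> h)),
        coact = (\<lambda>v h. quot_map R (conj_component \<Gamma> g h) v)\<rparr>)"


section \<open>The number \<open>N(q)\<close>\<close>

definition N_order :: "'k::field \<Rightarrow> enat" where
  "N_order q = (if q \<noteq> 1 \<and> (\<exists>n>0. q ^ n = 1) then enat (LEAST n. n > 0 \<and> q ^ n = 1) else \<infinity>)"


section \<open>The structure maps of \<open>M(g, \<rho>)\<close> on pure tensors\<close>

lemma lookup_pm_scale:
  assumes "scale a 0 = 0"
  shows "Poly_Mapping.lookup (pm_scale scale a f) x = scale a (Poly_Mapping.lookup f x)"
  using assms unfolding pm_scale_def by (simp add: map.rep_eq when_def)

lemma vector_space_pm_scale:
  assumes "vector_space scale"
  shows "vector_space (pm_scale scale)"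
proof -
  interpret vector_space scale by fact
  show ?thesis
    by unfold_locales (auto intro!: poly_mapping_eqI simp: lookup_pm_scale lookup_add algebra_simps)
qed

lemma quot_map_coset:
  assumes R: "0 \<in> R" "\<And>x y. x \<in> R \<Longrightarrow> y \<in> R \<Longrightarrow> x + y \<in> R"
    and \<phi>: "\<And>r. r \<in> R \<Longrightarrow> \<phi> r \<in> R" "\<And>x y. \<phi> (x + y) = \<phi> x + \<phi> y"
  shows "quot_map R \<phi> (f +o R) = \<phi> f +o R"
proof -
  have "\<exists>s\<in>R. \<phi> f + \<phi> r + r' = \<phi> f + s" if "r \<in> R" "r' \<in> R" for r r'
    using that R \<phi> by (metis add.assoc)
  moreover have "\<phi> (f + 0) + r = \<phi> f + r" for r
    using \<phi>(2)[of 0 0] by simp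
  ultimately show ?thesis
    using R(1) unfolding quot_map_def elt_set_plus_def by (auto simp: \<phi>(2))
qed

lemma pm_span_map_closed:
  assumes "vector_space scale" "r \<in> pm_span scale S"
    and "\<And>s. s \<in> S \<Longrightarrow> \<phi> s \<in> pm_span scale S"
    and "\<And>x y. \<phi> (x + y) = \<phi> x + \<phi> y"
    and "\<And>a x. \<phi> (pm_scale scale a x) = pm_scale scale a (\<phi> x)"
  shows "\<phi> r \<in> pm_span scale S"
proof -
  interpret vs: vector_space "pm_scale scale"
    using vector_space_pm_scale[OF assms(1)] .
  have "\<phi> 0 = 0" using assms(4)[of 0 0] by simp
  show ?thesis using assms(2) unfolding pm_span_def
  proof (induction rule: vs.span_induct_alt)
    case base then show ?case using \<open>\<phi> 0 = 0\<close> by (simp add: vs.span_zero)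
  next
    case (step a x y)
    then show ?case
      using assms(3)[OF step(1)] by (simp add: assms(4,5) pm_span_def vs.span_add vs.span_scale)
  qed
qed

lemma left_translate_single:
  "left_translate \<Gamma> h (Poly_Mapping.single t x) = Poly_Mapping.single (h \<otimes>\<^bsub>\<Gamma>\<^esub> t) x"
  by (cases "x = 0") (simp_all add: left_translate_def)

lemma conj_component_single:
  "conj_component \<Gamma> g h (Poly_Mapping.single t x) =
     (if t \<otimes>\<^bsub>\<Gamma>\<^esub> g \<otimes>\<^bsub>\<Gamma>\<^esub> inv\<^bsub>\<Gamma>\<^esub> t = h then Poly_Mapping.single t x else 0)"
  by (cases "x = 0") (simp_all add: conj_component_def)

lemma left_translate_add: "left_translate \<Gamma> h (x + y) = left_translate \<Gamma> h x + left_translate \<Gamma> h y"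
  unfolding left_translate_def by (rule setsum_keys_plus_distrib) (simp_all add: single_add)

lemma conj_component_add: "conj_component \<Gamma> g h (x + y) = conj_component \<Gamma> g h x + conj_component \<Gamma> g h y"
  unfolding conj_component_def by (rule setsum_keys_plus_distrib) (simp_all add: single_add)

lemma pm_scale_single:
  "scale a 0 = 0 \<Longrightarrow> pm_scale scale a (Poly_Mapping.single t x) = Poly_Mapping.single t (scale a x)"
  by (simp add: pm_scale_def)

lemma poly_mapping_hom_eqI:
  fixes f :: "'a \<Rightarrow>\<^sub>0 'c::ab_group_add"
  assumes "\<And>x y. \<phi> (x + y) = \<phi> x + \<phi> y" "\<And>x y. \<psi> (x + y) = \<psi> x + \<psi> y"
    and "\<And>t x. \<phi> (Poly_Mapping.single t x) = \<psi> (Poly_Mapping.single t x)"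
  shows "\<phi> f = (\<psi> f :: 'b::ab_group_add)"
proof -
  interpret p: additive \<phi> by unfold_locales (rule assms)
  interpret q: additive \<psi> by unfold_locales (rule assms)
  have f: "f = (\<Sum>t\<in>Poly_Mapping.keys f. Poly_Mapping.single t (Poly_Mapping.lookup f t))"
    by (rule poly_mapping_eqI) (simp add: lookup_sum lookup_single when_def in_keys_iff)
  show ?thesis by (subst (1 2) f) (simp add: p.sum q.sum assms(3))
qed

context
  fixes \<Gamma> :: "('g, 'a) monoid_scheme" and scale :: "'k::field \<Rightarrow> 'w::ab_group_add \<Rightarrow> 'w"
    and g :: 'g and \<rho> :: "'g \<Rightarrow> 'w \<Rightarrow> 'w" and R :: "('g \<Rightarrow>\<^sub>0 'w) set"
  assumes R: "R = balancing_rels \<Gamma> scale g \<rho>" and group: "group \<Gamma>" and g: "g \<in> carrier \<Gamma>" and vs: "vector_space scale"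
begin

interpretation group \<Gamma> by (rule group)
interpretation W: vector_space scale by (rule vs)
interpretation F: vector_space "pm_scale scale :: 'k \<Rightarrow> ('g \<Rightarrow>\<^sub>0 'w) \<Rightarrow> _" by (rule vector_space_pm_scale[OF vs])

lemma left_translate_rels:
  assumes "h \<in> carrier \<Gamma>" "r \<in> R"
  shows "left_translate \<Gamma> h r \<in> R"
  unfolding R balancing_rels_def
proof (rule pm_span_map_closed[OF vs assms(2)[unfolded R balancing_rels_def]])
  interpret L: additive "left_translate \<Gamma> h :: ('g \<Rightarrow>\<^sub>0 'w) \<Rightarrow> _"
    by unfold_locales (rule left_translate_add)
  fix s :: "'g \<Rightarrow>\<^sub>0 'w" assume "s \<in> {Poly_Mapping.single (t \<otimes>\<^bsub>\<Gamma>\<^esub> h) x - Poly_Mapping.single t (\<rho> h x) | t h x.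
        t \<in> carrier \<Gamma> \<and> h \<in> centralizer \<Gamma> g}"
  then obtain t k x where tk: "t \<in> carrier \<Gamma>" "k \<in> centralizer \<Gamma> g"
    and s: "s = Poly_Mapping.single (t \<otimes>\<^bsub>\<Gamma>\<^esub> k) x - Poly_Mapping.single t (\<rho> k x)" by blast
  have "left_translate \<Gamma> h s =
      Poly_Mapping.single (h \<otimes>\<^bsub>\<Gamma>\<^esub> t \<otimes>\<^bsub>\<Gamma>\<^esub> k) x - Poly_Mapping.single (h \<otimes>\<^bsub>\<Gamma>\<^esub> t) (\<rho> k x)"
    using tk assms(1) unfolding s by (simp add: L.diff left_translate_single m_assoc centralizer_def)
  then show "left_translate \<Gamma> h s \<in> pm_span scale {Poly_Mapping.single (t \<otimes>\<^bsub>\<Gamma>\<^esub> h) x - Poly_Mapping.single t (\<rho> h x) | t h x.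
        t \<in> carrier \<Gamma> \<and> h \<in> centralizer \<Gamma> g}"
    using tk assms(1) unfolding pm_span_def by (auto intro!: F.span_base)
next
  show "left_translate \<Gamma> h (pm_scale scale a x) = pm_scale scale a (left_translate \<Gamma> h x)" for a x
    by (rule poly_mapping_hom_eqI[where f = x])
      (simp_all add: F.scale_right_distrib left_translate_add left_translate_single pm_scale_single)
qed (rule left_translate_add)

lemma conj_component_rels:
  assumes "r \<in> R"
  shows "conj_component \<Gamma> g h r \<in> R"
  unfolding R balancing_rels_def
proof (rule pm_span_map_closed[OF vs assms(1)[unfolded R balancing_rels_def]])
  interpret L: additive "conj_component \<Gamma> g h :: ('g \<Rightarrow>\<^sub>0 'w) \<Rightarrow> _"
    by unfold_locales (rule conj_component_add)
  fix s :: "'g \<Rightarrow>\<^sub>0 'w" assume a: "s \<in> {Poly_Mapping.single (t \<otimes>\<^bsub>\<Gamma>\<^esub> h) x - Poly_Mapping.single t (\<rho> h x) | t h x.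
        t \<in> carrier \<Gamma> \<and> h \<in> centralizer \<Gamma> g}"
  then obtain t k x where tk: "t \<in> carrier \<Gamma>" "k \<in> carrier \<Gamma>" "k \<otimes>\<^bsub>\<Gamma>\<^esub> g = g \<otimes>\<^bsub>\<Gamma>\<^esub> k"
    and s: "s = Poly_Mapping.single (t \<otimes>\<^bsub>\<Gamma>\<^esub> k) x - Poly_Mapping.single t (\<rho> k x)"
    by (auto simp: centralizer_def)
  have "t \<otimes>\<^bsub>\<Gamma>\<^esub> k \<otimes>\<^bsub>\<Gamma>\<^esub> g \<otimes>\<^bsub>\<Gamma>\<^esub> inv\<^bsub>\<Gamma>\<^esub> (t \<otimes>\<^bsub>\<Gamma>\<^esub> k) = t \<otimes>\<^bsub>\<Gamma>\<^esub> (k \<otimes>\<^bsub>\<Gamma>\<^esub> g) \<otimes>\<^bsub>\<Gamma>\<^esub> inv\<^bsub>\<Gamma>\<^esub> k \<otimes>\<^bsub>\<Gamma>\<^esub> inv\<^bsub>\<Gamma>\<^esub> t"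
    using tk(1,2) g by (simp add: m_assoc inv_mult_group)
  also have "\<dots> = t \<otimes>\<^bsub>\<Gamma>\<^esub> g \<otimes>\<^bsub>\<Gamma>\<^esub> inv\<^bsub>\<Gamma>\<^esub> t"
    unfolding tk(3) using tk(1,2) g m_assoc[of k "inv\<^bsub>\<Gamma>\<^esub> k" "inv\<^bsub>\<Gamma>\<^esub> t", symmetric] by (simp add: m_assoc)
  finally have "conj_component \<Gamma> g h s = (if t \<otimes>\<^bsub>\<Gamma>\<^esub> g \<otimes>\<^bsub>\<Gamma>\<^esub> inv\<^bsub>\<Gamma>\<^esub> t = h then s else 0)"
    unfolding s by (simp add: L.diff conj_component_single)
  then show "conj_component \<Gamma> g h s \<in> pm_span scale {Poly_Mapping.single (t \<otimes>\<^bsub>\<Gamma>\<^esub> h) x - Poly_Mapping.single t (\<rho> h x) | t h x.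
        t \<in> carrier \<Gamma> \<and> h \<in> centralizer \<Gamma> g}"
    using F.span_base[OF a] F.span_zero unfolding pm_span_def by simp
next
  show "conj_component \<Gamma> g h (pm_scale scale a x) = pm_scale scale a (conj_component \<Gamma> g h x)" for a x
    by (rule poly_mapping_hom_eqI[where f = x])
      (simp_all add: F.scale_right_distrib conj_component_add conj_component_single pm_scale_single)
qed (rule conj_component_add)

text \<open>Here \<open>single t x +o R\<close> is the pure tensor \<open>t \<otimes> x\<close> of \<open>M(g, \<rho>)\<close>.\<close>

lemma act_pure_tensor:
  assumes "h \<in> carrier \<Gamma>"
  shows "act (yd_M \<Gamma> scale g \<rho>) h (Poly_Mapping.single t x +o R) = Poly_Mapping.single (h \<otimes>\<^bsub>\<Gamma>\<^esub> t) x +o R"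
proof -
  have "quot_map R (left_translate \<Gamma> h) (Poly_Mapping.single t x +o R) = left_translate \<Gamma> h (Poly_Mapping.single t x) +o R"
    using left_translate_rels[OF assms] unfolding R
    by (intro quot_map_coset left_translate_add) (auto simp: balancing_rels_def pm_span_def F.span_zero F.span_add)
  then show ?thesis by (simp add: R[symmetric] yd_M_def Let_def module.extend_def left_translate_single)
qed

lemma coact_pure_tensor:
  "coact (yd_M \<Gamma> scale g \<rho>) (Poly_Mapping.single t x +o R) h =
     (if t \<otimes>\<^bsub>\<Gamma>\<^esub> g \<otimes>\<^bsub>\<Gamma>\<^esub> inv\<^bsub>\<Gamma>\<^esub> t = h then Poly_Mapping.single t x +o R else \<zero>\<^bsub>yd_M \<Gamma> scale g \<rho>\<^esub>)"
proof -
  have "quot_map R (conj_component \<Gamma> g h) (Poly_Mapping.single t x +o R) = conj_component \<Gamma> g h (Poly_Mapping.single t x) +o R"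
    using conj_component_rels[unfolded R] unfolding R
    by (intro quot_map_coset conj_component_add) (auto simp: balancing_rels_def pm_span_def F.span_zero F.span_add)
  then show ?thesis
    by (auto simp: R[symmetric] yd_M_def Let_def module.extend_def conj_component_single quot_space_def elt_set_plus_def)
qed

end

end

theory Submission
  imports Defs "HOL-Combinatorics.Multiset_Permutations"
begin

text \<open>
  The pure tensors \<open>1 \<otimes> x\<close> form a copy of \<open>W\<close> inside \<open>M(g, \<rho>)\<close>. Since \<open>\<rho>(g)\<close> is the scalar \<open>q\<close>, the
  braiding restricts to it as \<open>c(u \<otimes> v) = q v \<otimes> u\<close>. On words in a basis of \<open>W\<close>, the quantum
  symmetrizer is therefore \<open>\<Sum>\<^sub>x q\<^bsup>inv(x)\<^esup> x\<close>, and its image is the algebra generated by the letters under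
  the quantum shuffle product, in which every crossing of two letters costs a factor \<open>q\<close>. It
  remains to show that this algebra has nonzero elements of arbitrarily large degree if
  there are at least two letters and \<open>q = 1\<close> or \<open>q\<close> has order at least \<open>4\<close>, and also if there are at
  least three letters and \<open>q\<close> has order \<open>3\<close>. The argument looks at
  lexicographically greatest words.

  Let \<open>f\<close> be homogeneous of degree \<open>m\<close> with \<open>q\<^bsup>m\<^sup>2\<^esup> = 1\<close>, and let \<open>u\<close> be the greatest word of \<open>f\<close>. Suppose that \<open>u\<close>
  begins with a run of the least letter \<open>0\<close> which is longer than every later run of \<open>0\<close>, and ends
  with another letter. Then \<open>u\<^sup>k\<close> is the greatest word of the \<open>k\<close>-th power of \<open>f\<close>, and it arises only by
  interleaving whole blocks \<open>u\<close>. Moving one block past another costs \<open>q\<^bsup>m\<^sup>2\<^esup> = 1\<close>, so its coefficient is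
  \<open>k!\<close> times the \<open>k\<close>-th power of a nonzero number: no power of \<open>f\<close> vanishes
  (\<open>letter_algebra_unbounded_if_top_coeff\<close>).

  Such an \<open>f\<close> exists in each case. Let \<open>N\<close> be the order of \<open>q\<close>. For \<open>k + 1 < N\<close> the word \<open>0\<^sup>k1\<close> itself lies in the algebra
  (\<open>letter_algebra_zeros_one\<close>). If \<open>N = 2m\<close> with \<open>m\<close> even, the word \<open>0\<^bsup>m-1\<^esup>1\<close> of length \<open>m\<close> works. If
  \<open>N = 2m\<close> with \<open>m \<ge> 3\<close> odd, the square of \<open>0\<^bsup>m-1\<^esup>1\<close> works; if \<open>N = 2m + 1 \<ge> 5\<close>, a braided commutator of
  \<open>0\<^sup>m1\<close> and \<open>0\<^bsup>m-1\<^esup>1\<close>; and if \<open>N = 3\<close>, a braided commutator of \<open>01\<close> and \<open>2\<close>. For \<open>q = 1\<close> the powers of one letter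
  suffice.

  The passage to the Nichols algebra uses linear functionals: coordinates of \<open>W\<close> extend to \<open>M(g, \<rho>)\<close>,
  their products are functionals on \<open>T(V)\<close>, and these read off from the quantum symmetrizer exactly the
  coefficients of quantum shuffles (\<open>letter_algebra_realized\<close>). A finite-dimensional Nichols algebra would
  bound the length of the words on which the functionals do not vanish.
\<close>

section \<open>The quantum shuffle product\<close>

text \<open>
  Elements of the shuffle algebra are functions giving the coefficient of each word. All arguments
  compare words letter by letter from the left, which is why everything is phrased with the functions
  \<open>left_quotient c f\<close>.
\<close>

definition homog :: "nat \<Rightarrow> (nat list \<Rightarrow> 'k::zero) \<Rightarrow> bool" where
  "homog n f \<longleftrightarrow> (\<forall>w. length w \<noteq> n \<longrightarrow> f w = 0)"

definition left_quotient :: "nat \<Rightarrow> (nat list \<Rightarrow> 'k) \<Rightarrow> nat list \<Rightarrow> 'k" where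
  "left_quotient c f = (\<lambda>w. f (c # w))"

definition word_fun :: "nat list \<Rightarrow> nat list \<Rightarrow> 'k::zero_neq_one" where
  "word_fun u = (\<lambda>w. if w = u then 1 else 0)"

text \<open>
  Read from the left, a word of the product begins with a letter of a word of \<open>f\<close>, or with a letter of a
  word of \<open>g\<close> that has crossed all \<open>m\<close> letters still to come from \<open>f\<close>. The number \<open>m\<close> is meant to be the degree of
  the homogeneous function \<open>f\<close>; in degree \<open>0\<close> its left quotients vanish, so the truncated \<open>m - 1\<close> is harmless.
\<close>

fun qshuffle :: "'k::field \<Rightarrow> nat \<Rightarrow> (nat list \<Rightarrow> 'k) \<Rightarrow> (nat list \<Rightarrow> 'k) \<Rightarrow> nat list \<Rightarrow> 'k" where
  "qshuffle q m f g [] = f [] * g []"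
| "qshuffle q m f g (c # w) = qshuffle q (m - 1) (left_quotient c f) g w + q ^ m * qshuffle q m f (left_quotient c g) w"

lemma homog_left_quotient: "homog (Suc n) f \<Longrightarrow> homog n (left_quotient c f)"
  by (auto simp: homog_def left_quotient_def)

lemma homog_0_left_quotient: "homog 0 f \<Longrightarrow> left_quotient c f = (\<lambda>_. 0)"
  by (auto simp: homog_def left_quotient_def)

lemma homog_zero [simp]: "homog n (\<lambda>_. 0)"
  by (simp add: homog_def)

lemma homog_word_fun: "homog (length u) (word_fun u)"
  by (auto simp: homog_def word_fun_def)

lemma homog_add: "homog n f \<Longrightarrow> homog n g \<Longrightarrow> homog n (\<lambda>w. f w + g w :: 'k::field)"
  by (auto simp: homog_def)

lemma homog_scale: "homog n f \<Longrightarrow> homog n (\<lambda>w. a * f w :: 'k::field)"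
  by (auto simp: homog_def)

lemma left_quotient_zero [simp]: "left_quotient c (\<lambda>_. 0) = (\<lambda>_. 0)"
  by (simp add: left_quotient_def)

lemma left_quotient_add: "left_quotient c (\<lambda>w. f w + g w) = (\<lambda>w. left_quotient c f w + left_quotient c g w)"
  by (simp add: left_quotient_def)

lemma left_quotient_scale: "left_quotient c (\<lambda>w. a * f w) = (\<lambda>w. a * left_quotient c f w)"
  by (simp add: left_quotient_def)

lemma left_quotient_word_fun:
  "left_quotient c (word_fun []) = (\<lambda>_. 0)"
  "left_quotient c (word_fun (d # u)) = (if c = d then word_fun u else (\<lambda>_. 0))"
  by (auto simp: left_quotient_def word_fun_def)

lemma left_quotient_qshuffle:
  "left_quotient c (qshuffle q m f g) = (\<lambda>w. qshuffle q (m - 1) (left_quotient c f) g w + q ^ m * qshuffle q m f (left_quotient c g) w)"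
  by (simp add: left_quotient_def[of c "qshuffle q m f g"])

lemma qshuffle_zero_left [simp]: "qshuffle q m (\<lambda>_. 0) g = (\<lambda>_. 0)"
proof
  show "qshuffle q m (\<lambda>_. 0) g w = 0" for w by (induction w arbitrary: m g) auto
qed

lemma qshuffle_zero_right [simp]: "qshuffle q m f (\<lambda>_. 0) = (\<lambda>_. 0)"
proof
  show "qshuffle q m f (\<lambda>_. 0) w = 0" for w by (induction w arbitrary: m f) auto
qed

lemma qshuffle_add_left: "qshuffle q m (\<lambda>w. f w + f' w) g = (\<lambda>w. qshuffle q m f g w + qshuffle q m f' g w)"
proof
  show "qshuffle q m (\<lambda>w. f w + f' w) g w = qshuffle q m f g w + qshuffle q m f' g w" for w
    by (induction w arbitrary: m f f' g) (simp_all add: left_quotient_add algebra_simps)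
qed

lemma qshuffle_add_right: "qshuffle q m f (\<lambda>w. g w + g' w) = (\<lambda>w. qshuffle q m f g w + qshuffle q m f g' w)"
proof
  show "qshuffle q m f (\<lambda>w. g w + g' w) w = qshuffle q m f g w + qshuffle q m f g' w" for w
    by (induction w arbitrary: m f g g') (simp_all add: left_quotient_add algebra_simps)
qed

lemma qshuffle_scale_left: "qshuffle q m (\<lambda>w. a * f w) g = (\<lambda>w. a * qshuffle q m f g w)"
proof
  show "qshuffle q m (\<lambda>w. a * f w) g w = a * qshuffle q m f g w" for w
    by (induction w arbitrary: m f g) (simp_all add: left_quotient_scale algebra_simps)
qed

lemma qshuffle_scale_right: "qshuffle q m f (\<lambda>w. a * g w) = (\<lambda>w. a * qshuffle q m f g w)"
proof
  show "qshuffle q m f (\<lambda>w. a * g w) w = a * qshuffle q m f g w" for w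
    by (induction w arbitrary: m f g) (simp_all add: left_quotient_scale algebra_simps)
qed

lemma homog_qshuffle:
  assumes "homog m f" "homog n g"
  shows "homog (m + n) (qshuffle q m f g)"
  unfolding homog_def
proof (intro allI impI)
  show "qshuffle q m f g w = 0" if "length w \<noteq> m + n" for w
    using assms that
  proof (induction w arbitrary: m n f g)
    case Nil
    then show ?case by (auto simp: homog_def)
  next
    case (Cons c w)
    have "qshuffle q (m - 1) (left_quotient c f) g w = 0"
      using Cons.IH[OF homog_left_quotient Cons.prems(2)] Cons.prems homog_0_left_quotient[of f c]
      by (cases m) auto
    moreover have "qshuffle q m f (left_quotient c g) w = 0"
      using Cons.IH[OF Cons.prems(1) homog_left_quotient] Cons.prems homog_0_left_quotient[of g c]
      by (cases n) auto
    ultimately show ?case by simp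
  qed
qed

lemma qshuffle_assoc:
  assumes "homog m f" "homog n g"
  shows "qshuffle q (m + n) (qshuffle q m f g) h = qshuffle q m f (qshuffle q n g h)"
proof
  show "qshuffle q (m + n) (qshuffle q m f g) h w = qshuffle q m f (qshuffle q n g h) w" for w
    using assms
  proof (induction w arbitrary: m n f g h)
    case (Cons c w)
    have 1: "qshuffle q (m + n - 1) (qshuffle q (m - 1) (left_quotient c f) g) h w
        = qshuffle q (m - 1) (left_quotient c f) (qshuffle q n g h) w"
      using Cons.IH[OF homog_left_quotient Cons.prems(2)] Cons.prems homog_0_left_quotient[of f c]
      by (cases m) auto
    have 2: "qshuffle q (m + n - 1) (qshuffle q m f (left_quotient c g)) h w
        = qshuffle q m f (qshuffle q (n - 1) (left_quotient c g) h) w"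
      using Cons.IH[OF Cons.prems(1) homog_left_quotient] Cons.prems homog_0_left_quotient[of g c]
      by (cases n) auto
    have 3: "qshuffle q (m + n) (qshuffle q m f g) (left_quotient c h) w = qshuffle q m f (qshuffle q n g (left_quotient c h)) w"
      using Cons by blast
    show ?case
      using 1 2 3
      by (simp add: left_quotient_qshuffle qshuffle_add_left qshuffle_add_right qshuffle_scale_left qshuffle_scale_right power_add
          algebra_simps)
  qed simp
qed

text \<open>
  Two letters cross in one interleaving exactly if they do not cross in the interleaving with the factors
  exchanged. With this, each statement about taking letters from the left factor also yields
  the one about the right factor.
\<close>

lemma qshuffle_swap:
  assumes "homog m f" "homog n g" "q \<noteq> 0"
  shows "qshuffle q m f g = (\<lambda>w. q ^ (m * n) * qshuffle (1 / q) n g f w)"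
proof
  show "qshuffle q m f g w = q ^ (m * n) * qshuffle (1 / q) n g f w" for w
    using assms(1,2)
  proof (induction w arbitrary: m n f g)
    case (Cons c w)
    have "qshuffle q (m - 1) (left_quotient c f) g w = q ^ (m * n) * ((1 / q) ^ n * qshuffle (1 / q) n g (left_quotient c f) w)"
      using Cons.IH[OF homog_left_quotient Cons.prems(2)] Cons.prems homog_0_left_quotient[of f c] assms(3)
      by (cases m) (auto simp: power_add power_one_over)
    moreover have "q ^ m * qshuffle q m f (left_quotient c g) w = q ^ (m * n) * qshuffle (1 / q) (n - 1) (left_quotient c g) f w"
      using Cons.IH[OF Cons.prems(1) homog_left_quotient] Cons.prems homog_0_left_quotient[of g c]
      by (cases n) (auto simp: power_add)
    ultimately show ?case by (simp add: algebra_simps)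
  next
    case Nil
    then have "(m = 0 \<or> f [] = 0) \<and> (n = 0 \<or> g [] = 0)" by (auto simp: homog_def)
    then show ?case by auto
  qed
qed

lemma qshuffle_unit_left: "qshuffle q 0 (\<lambda>w. if w = [] then \<alpha> else 0) g = (\<lambda>w. \<alpha> * g w)"
proof
  have "left_quotient c (\<lambda>w. if w = [] then \<alpha> else 0) = (\<lambda>_. 0)" for c
    by (simp add: left_quotient_def)
  then show "qshuffle q 0 (\<lambda>w. if w = [] then \<alpha> else 0) g w = \<alpha> * g w" for w
    by (induction w arbitrary: g) (simp_all add: left_quotient_def[of _ "_::nat list \<Rightarrow> 'a"])
qed

lemma qshuffle_unit_right: "qshuffle q m f (\<lambda>w. if w = [] then \<beta> else 0) = (\<lambda>w. \<beta> * f w)"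
proof
  have "left_quotient c (\<lambda>w. if w = [] then \<beta> else 0) = (\<lambda>_. 0)" for c
    by (simp add: left_quotient_def)
  then show "qshuffle q m f (\<lambda>w. if w = [] then \<beta> else 0) w = \<beta> * f w" for w
    by (induction w arbitrary: m f) (simp_all add: left_quotient_def[of _ "_::nat list \<Rightarrow> 'a"])
qed

section \<open>Greatest words\<close>

text \<open>
  No word above \<open>s\<close> (of the same length, lexicographically) occurs in \<open>f\<close>, and \<open>s\<close> has coefficient \<open>\<alpha>\<close>. Allowing
  \<open>\<alpha> = 0\<close> makes the relation additive. The recursion follows the letters of \<open>s\<close>, as
  the recursion of \<open>qshuffle\<close> does.
\<close>

fun top_coeff :: "(nat list \<Rightarrow> 'k::field) \<Rightarrow> nat list \<Rightarrow> 'k \<Rightarrow> bool" where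
  "top_coeff f [] \<alpha> \<longleftrightarrow> f = (\<lambda>w. if w = [] then \<alpha> else 0)"
| "top_coeff f (c # s) \<alpha> \<longleftrightarrow>
     homog (Suc (length s)) f \<and> (\<forall>d>c. left_quotient d f = (\<lambda>_. 0)) \<and> top_coeff (left_quotient c f) s \<alpha>"

lemma top_coeff_homog: "top_coeff f s \<alpha> \<Longrightarrow> homog (length s) f"
  by (cases s) (auto simp: homog_def)

lemma top_coeff_value: "top_coeff f s \<alpha> \<Longrightarrow> f s = \<alpha>"
  by (induction s arbitrary: f) (auto simp: left_quotient_def)

lemma top_coeff_zero: "top_coeff (\<lambda>_. 0) s 0"
  by (induction s) auto

lemma top_coeff_add:
  "top_coeff f s \<alpha> \<Longrightarrow> top_coeff g s \<beta> \<Longrightarrow> top_coeff (\<lambda>w. f w + g w) s (\<alpha> + \<beta>)"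
  by (induction s arbitrary: f g) (auto simp: homog_add left_quotient_add)

lemma top_coeff_scale: "top_coeff f s \<alpha> \<Longrightarrow> top_coeff (\<lambda>w. a * f w) s (a * \<alpha>)"
  by (induction s arbitrary: f) (auto simp: homog_scale left_quotient_scale)

lemma top_coeff_word_fun: "top_coeff (word_fun s) s 1"
proof (induction s)
  case Nil show ?case by (simp add: word_fun_def)
next
  case (Cons c s)
  then show ?case using homog_word_fun[of "c # s"] by (auto simp: left_quotient_word_fun)
qed

lemma top_coeff_qshuffle_Cons:
  assumes "top_coeff f (a # s) \<alpha>" "top_coeff g (b # t) \<beta>" "a \<le> c" "b \<le> c"
    and "length z = length s + Suc (length t)"
    and "top_coeff (\<lambda>w. qshuffle q (length s) (left_quotient c f) g w
           + q ^ Suc (length s) * qshuffle q (Suc (length s)) f (left_quotient c g) w) z \<gamma>"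
  shows "top_coeff (qshuffle q (Suc (length s)) f g) (c # z) \<gamma>"
  using assms homog_qshuffle[OF top_coeff_homog[OF assms(1)] top_coeff_homog[OF assms(2)], of q]
  by (auto simp: left_quotient_qshuffle)

text \<open>
  While both factors still begin with more zeros than the target word, every letter available is \<open>0\<close>, which
  is smaller than the letter \<open>c\<close> which the target asks for after its \<open>r\<close> zeros.
\<close>

lemma top_coeff_qshuffle_two_runs:
  assumes "top_coeff f (replicate i 0 @ s) \<alpha>" "top_coeff g (replicate j 0 @ t) \<beta>"
    and "r < i" "r < j" "0 < c" "r + Suc (length z) = i + length s + (j + length t)"
  shows "top_coeff (qshuffle q (i + length s) f g) (replicate r 0 @ c # z) 0"
  using assms
proof (induction r arbitrary: i j f g)
  case 0
  obtain i' j' where ij: "i = Suc i'" "j = Suc j'" using 0 by (cases i; cases j) auto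
  have "left_quotient c f = (\<lambda>_. 0)" "left_quotient c g = (\<lambda>_. 0)" using 0 ij by auto
  then have "top_coeff (qshuffle q (Suc (length (replicate i' 0 @ s))) f g) (c # z) 0"
    using 0 ij
    by (intro top_coeff_qshuffle_Cons[where a = 0 and b = 0 and t = "replicate j' 0 @ t" and \<alpha> = \<alpha> and \<beta> = \<beta>])
      (simp_all add: top_coeff_zero)
  then show ?case using ij by simp
next
  case (Suc r)
  obtain i' j' where ij: "i = Suc i'" "j = Suc j'" using Suc by (cases i; cases j) auto
  have 1: "top_coeff (qshuffle q (i' + length s) (left_quotient 0 f) g) (replicate r 0 @ c # z) 0"
    using Suc.prems ij by (intro Suc.IH[where j = j]) auto
  have 2: "top_coeff (qshuffle q (i + length s) f (left_quotient 0 g)) (replicate r 0 @ c # z) 0"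
    using Suc.prems ij by (intro Suc.IH[where j = j']) auto
  have "top_coeff (qshuffle q (Suc (length (replicate i' 0 @ s))) f g) (0 # replicate r 0 @ c # z) 0"
    using Suc.prems ij top_coeff_add[OF 1 top_coeff_scale[OF 2, of "q ^ i * q ^ length s"]]
    by (intro top_coeff_qshuffle_Cons[where a = 0 and b = 0 and t = "replicate j' 0 @ t" and \<alpha> = \<alpha> and \<beta> = \<beta>])
      (simp_all add: power_add mult.assoc)
  then show ?case using ij by simp
qed

text \<open>
  If \<open>g\<close> begins with more zeros than the target, no letter of \<open>g\<close> may be taken before the run of
  zeros of \<open>f\<close> and its next letter are used up: after taking one, both factors begin with too many zeros.
\<close>

lemma top_coeff_qshuffle_run:
  assumes "top_coeff f (replicate r 0 @ c # s) \<alpha>" "top_coeff g (replicate p 0 @ t) \<beta>"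
    and "r < p" "0 < c" "length z = length s + (p + length t)"
    and "\<And>f'. top_coeff f' s \<alpha> \<Longrightarrow> top_coeff (qshuffle q (length s) f' g) z \<gamma>"
  shows "top_coeff (qshuffle q (r + Suc (length s)) f g) (replicate r 0 @ c # z) \<gamma>"
  using assms(1,3)
proof (induction r arbitrary: f)
  case 0
  obtain p' where p: "p = Suc p'" using 0 by (cases p) auto
  have g: "left_quotient c g = (\<lambda>_. 0)" using assms(2,4) p by auto
  have "top_coeff (qshuffle q (length s) (left_quotient c f) g) z \<gamma>" using 0 by (intro assms(6)) simp
  then have "top_coeff (qshuffle q (Suc (length s)) f g) (c # z) \<gamma>"
    using 0 assms(2,4,5) p g
    by (intro top_coeff_qshuffle_Cons[where a = c and b = 0 and t = "replicate p' 0 @ t" and \<alpha> = \<alpha> and \<beta> = \<beta>])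
      simp_all
  then show ?case by simp
next
  case (Suc r)
  obtain p' where p: "p = Suc p'" using Suc by (cases p) auto
  have 1: "top_coeff (qshuffle q (r + Suc (length s)) (left_quotient 0 f) g) (replicate r 0 @ c # z) \<gamma>"
    using Suc.prems by (intro Suc.IH) auto
  have 2: "top_coeff (qshuffle q (Suc r + length (c # s)) f (left_quotient 0 g)) (replicate r 0 @ c # z) 0"
    using Suc.prems assms(2,4,5) p by (intro top_coeff_qshuffle_two_runs[where j = p']) auto
  have "top_coeff (qshuffle q (Suc (length (replicate r 0 @ c # s))) f g) (0 # replicate r 0 @ c # z) \<gamma>"
    using Suc.prems assms(2,5) p 
      top_coeff_add[OF 1 top_coeff_scale[OF 2, of "q ^ Suc (r + Suc (length s))"]]
    by (intro top_coeff_qshuffle_Cons[where a = 0 and b = 0 and t = "replicate p' 0 @ t" and \<alpha> = \<alpha> and \<beta> = \<beta>])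
      (simp_all add: mult.assoc)
  then show ?case by simp
qed

text \<open>
  The words which end with a nonzero letter (or are empty) and have all runs of zeros shorter than \<open>p\<close>.
\<close>

inductive runs_below :: "nat \<Rightarrow> nat list \<Rightarrow> bool" for p where
  Nil: "runs_below p []"
| run: "runs_below p y \<Longrightarrow> r < p \<Longrightarrow> 0 < c \<Longrightarrow> runs_below p (replicate r 0 @ c # y)"

text \<open>
  Once \<open>f\<close> has begun a block \<open>y\<close> while \<open>g\<close> waits at a run of \<open>p\<close> zeros, the block must be completed
  before \<open>g\<close> may contribute.
\<close>

lemma top_coeff_qshuffle_block:
  assumes "runs_below p y"
    and "top_coeff f (y @ s) \<alpha>" "top_coeff g (replicate p 0 @ t) \<beta>"
    and "length z = length s + (p + length t)"
    and "\<And>f'. top_coeff f' s \<alpha> \<Longrightarrow> top_coeff (qshuffle q (length s) f' g) z \<gamma>"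
  shows "top_coeff (qshuffle q (length (y @ s)) f g) (y @ z) \<gamma>"
  using assms(1,2)
proof (induction y arbitrary: f)
  case Nil
  then show ?case using assms(5) by simp
next
  case (run y r c)
  have "top_coeff (qshuffle q (r + Suc (length (y @ s))) f g) (replicate r 0 @ c # (y @ z)) \<gamma>"
    using run assms(3,4) by (intro top_coeff_qshuffle_run[where p = p and t = t and \<alpha> = \<alpha> and \<beta> = \<beta>]) simp_all
  then show ?case by simp
qed

text \<open>
  The target \<open>u\<^bsup>k+1\<^esup>\<close> begins with \<open>0\<close>, taken either from \<open>f\<close> or from \<open>g\<close>; in both cases a whole block \<open>u\<close>
  of the same factor has to follow. If it comes from \<open>f\<close>, the rest is \<open>g\<close>. If it comes from \<open>g\<close>, it crosses
  all of \<open>f\<close> at the cost \<open>q\<^bsup>|u|\<^sup>2\<^esup> = 1\<close> and the induction hypothesis applies to what is left of \<open>g\<close>.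
\<close>

theorem top_coeff_qshuffle_power:
  assumes u: "u = replicate (Suc p) 0 @ c # y" "0 < c" "runs_below (Suc p) y"
    and f: "top_coeff f u \<alpha>" and g: "top_coeff g (concat (replicate k u)) \<beta>"
    and q: "q ^ (length u * length u) = 1"
  shows "top_coeff (qshuffle q (length u) f g) (concat (replicate (Suc k) u)) (of_nat (Suc k) * \<alpha> * \<beta>)"
  using g
proof (induction k arbitrary: g \<beta>)
  case 0
  then have "g = (\<lambda>w. if w = [] then \<beta> else 0)" by simp
  then show ?case
    using top_coeff_scale[OF f, of \<beta>] by (simp add: qshuffle_unit_right mult.commute)
next
  case (Suc k)
  let ?l' = "replicate p 0 @ c # y" and ?m = "length u"
  let ?l = "\<lambda>k. concat (replicate k u)"
  have l_Cons: "u = 0 # ?l'" using u by simp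
  have q0: "q \<noteq> 0" using q l_Cons by (auto simp: power_0_left)
  have q1: "q ^ (j * ?m * ?m) = 1" for j
  proof -
    have "q ^ (j * (?m * ?m)) = (q ^ (?m * ?m)) ^ j" by (simp only: power_mult[symmetric] mult.commute)
    then show ?thesis unfolding q by (simp only: mult.assoc power_one)
  qed
  have rb: "runs_below (Suc p) ?l'" using u by (intro runs_below.run) auto
  have len: "length (?l j) = j * ?m" for j by (induction j) auto
  have l: "?l (Suc j) = replicate (Suc p) 0 @ c # y @ ?l j" for j using u by simp
  have f0: "top_coeff (left_quotient 0 f) (?l' @ []) \<alpha>" and g0: "top_coeff (left_quotient 0 g) (?l' @ ?l k) \<beta>"
    using f Suc.prems l_Cons by auto
  have f1: "top_coeff f (replicate (Suc p) 0 @ c # y) \<alpha>" using f u by simp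
  have g1: "top_coeff g (replicate (Suc p) 0 @ c # y @ ?l k) \<beta>" using Suc.prems l[of k] by simp
  \<comment> \<open>The first letter comes from \<open>f\<close>, so \<open>f\<close> is used up before \<open>g\<close> starts.\<close>
  have 1: "top_coeff (qshuffle q (length (?l' @ [])) (left_quotient 0 f) g) (?l' @ ?l (Suc k)) (\<alpha> * \<beta>)"
  proof (rule top_coeff_qshuffle_block[OF rb f0 g1])
    fix h :: "nat list \<Rightarrow> 'a" assume "top_coeff h [] \<alpha>"
    then show "top_coeff (qshuffle q (length ([] :: nat list)) h g) (?l (Suc k)) (\<alpha> * \<beta>)"
      using top_coeff_scale[OF Suc.prems, of \<alpha>] by (simp add: qshuffle_unit_left)
  qed (use u in simp)
  \<comment> \<open>The first letter comes from \<open>g\<close>: exchange the factors, so that \<open>g\<close> is the one that is being used up.\<close>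
  have 2: "top_coeff (qshuffle (1 / q) (length (?l' @ ?l k)) (left_quotient 0 g) f) (?l' @ ?l (Suc k))
      (q ^ (k * ?m * ?m) * (of_nat (Suc k) * \<alpha> * \<beta>))"
  proof (rule top_coeff_qshuffle_block[OF rb g0 f1])
    fix h :: "nat list \<Rightarrow> 'a" assume h: "top_coeff h (?l k) \<beta>"
    have "qshuffle (1 / q) (length (?l k)) h f = (\<lambda>w. (1 / q) ^ (length (?l k) * ?m) * qshuffle (1 / (1 / q)) ?m f h w)"
      using q0 by (intro qshuffle_swap top_coeff_homog[OF h] top_coeff_homog[OF f]) simp
    also have "(1 / q) ^ (length (?l k) * ?m) = 1" by (simp only: len power_one_over q1) simp
    finally show "top_coeff (qshuffle (1 / q) (length (?l k)) h f) (?l (Suc k)) (q ^ (k * ?m * ?m) * (of_nat (Suc k) * \<alpha> * \<beta>))"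
      using Suc.IH[OF h] by (simp only: q1 mult_1 div_by_1 divide_divide_eq_right)
  qed (use u in simp)
  have "qshuffle q ?m f (left_quotient 0 g) = (\<lambda>w. q ^ (?m * length (?l' @ ?l k)) * qshuffle (1 / q) (length (?l' @ ?l k)) (left_quotient 0 g) f w)"
    by (rule qshuffle_swap[OF top_coeff_homog[OF f] top_coeff_homog[OF g0] q0])
  moreover have "q ^ ?m * q ^ (?m * length (?l' @ ?l k)) * q ^ (k * ?m * ?m) = 1"
  proof -
    have "?m + ?m * length (?l' @ ?l k) = ?m * (Suc (length ?l') + k * ?m)"
      by (simp only: length_append len) (simp only: add_mult_distrib2 mult_Suc_right add.assoc)
    also have "Suc (length ?l') = ?m" using l_Cons by simp
    also have "?m * (?m + k * ?m) = Suc k * (?m * ?m)" by (simp only: mult_Suc add_mult_distrib2 ac_simps)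
    finally have "?m + ?m * length (?l' @ ?l k) = ?m * ?m * Suc k" by (simp only: ac_simps)
    then have "?m + ?m * length (?l' @ ?l k) = Suc k * ?m * ?m" by (simp only: ac_simps)
    then have "q ^ ?m * q ^ (?m * length (?l' @ ?l k)) = 1" by (simp only: power_add[symmetric] q1)
    then show ?thesis by (simp only: q1 mult_1)
  qed
  ultimately have 3: "top_coeff (\<lambda>w. q ^ ?m * qshuffle q ?m f (left_quotient 0 g) w) (?l' @ ?l (Suc k)) (of_nat (Suc k) * \<alpha> * \<beta>)"
    using top_coeff_scale[OF 2, of "q ^ ?m * q ^ (?m * length (?l' @ ?l k))"]
    by (simp add: mult.assoc[symmetric])
  have "top_coeff (qshuffle q (Suc (length ?l')) f g) (0 # ?l' @ ?l (Suc k)) (\<alpha> * \<beta> + of_nat (Suc k) * \<alpha> * \<beta>)"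
    using f Suc.prems l_Cons top_coeff_add[OF 1 3]
    by (intro top_coeff_qshuffle_Cons[where a = 0 and b = 0 and t = "?l' @ ?l k" and \<alpha> = \<alpha> and \<beta> = \<beta>]) auto
  then show ?case using l_Cons by (simp add: algebra_simps)
qed

section \<open>The algebra generated by the letters\<close>

fun letter_product :: "'k::field \<Rightarrow> nat list \<Rightarrow> nat list \<Rightarrow> 'k" where
  "letter_product q [] = word_fun []"
| "letter_product q (a # u) = qshuffle q 1 (word_fun [a]) (letter_product q u)"

lemma homog_letter_product: "homog (length u) (letter_product q u)"
proof (induction u)
  case Nil show ?case using homog_word_fun[of "[]"] by simp
next
  case (Cons a u) 
  then show ?case using homog_qshuffle[OF homog_word_fun[of "[a]"] Cons, of q] by simp
qed

lemma letter_product_append: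
  "letter_product q (u @ v) = qshuffle q (length u) (letter_product q u) (letter_product q v)"
proof (induction u)
  case Nil
  show ?case using qshuffle_unit_left[of q 1] by (simp add: word_fun_def)
next
  case (Cons a u)
  then show ?case
    using qshuffle_assoc[OF homog_word_fun[of "[a]"] homog_letter_product[of u q], of q "letter_product q v"]
    by simp
qed

text \<open>
  The degree \<open>n\<close> part of the subalgebra generated by the letters \<open>0, \<dots>, d - 1\<close>. For the braiding \<open>q\<close> times the flip
  this is the degree \<open>n\<close> part of the Nichols algebra of a space of dimension \<open>d\<close>.
\<close>

inductive letter_algebra :: "'k::field \<Rightarrow> nat \<Rightarrow> nat \<Rightarrow> (nat list \<Rightarrow> 'k) \<Rightarrow> bool" for q d where
  word: "set u \<subseteq> {..<d} \<Longrightarrow> letter_algebra q d (length u) (letter_product q u)"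
| add: "letter_algebra q d n f \<Longrightarrow> letter_algebra q d n g \<Longrightarrow> letter_algebra q d n (\<lambda>w. f w + g w)"
| scale: "letter_algebra q d n f \<Longrightarrow> letter_algebra q d n (\<lambda>w. a * f w)"

lemma letter_algebra_qshuffle:
  assumes "letter_algebra q d m f" "letter_algebra q d n g"
  shows "letter_algebra q d (m + n) (qshuffle q m f g)"
  using assms
proof (induction arbitrary: n g)
  case (word u)
  from word(2) show ?case
  proof induction
    case (word v)
    then show ?case using \<open>set u \<subseteq> _\<close> letter_algebra.word[of "u @ v" d q] by (simp add: letter_product_append)
  qed (auto simp: qshuffle_add_right qshuffle_scale_right intro: letter_algebra.add letter_algebra.scale)
qed (auto simp: qshuffle_add_left qshuffle_scale_left intro: letter_algebra.add letter_algebra.scale)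

lemma letter_algebra_diff: "letter_algebra q d n f \<Longrightarrow> letter_algebra q d n g \<Longrightarrow> letter_algebra q d n (\<lambda>w. f w - a * g w)"
  using letter_algebra.add[OF _ letter_algebra.scale[of q d n g "- a"]] by simp

lemma letter_algebra_letter: "a < d \<Longrightarrow> letter_algebra q d 1 (word_fun [a])"
  using letter_algebra.word[of "[a]" d q] qshuffle_unit_right[of q 1 "word_fun [a]" 1]
  by (simp add: word_fun_def[of "[]"])

definition letter_algebra_unbounded :: "'k::field \<Rightarrow> nat \<Rightarrow> bool" where
  "letter_algebra_unbounded q d \<longleftrightarrow> (\<forall>K. \<exists>n\<ge>K. \<exists>f w. letter_algebra q d n f \<and> length w = n \<and> f w \<noteq> 0)"

text \<open>
  The powers of \<open>f\<close> have the greatest words \<open>u\<^sup>k\<close> with the coefficients \<open>k! \<alpha>\<^sup>k\<close>, which do not vanish in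
  characteristic \<open>0\<close>.
\<close>

theorem letter_algebra_unbounded_if_top_coeff:
  fixes q :: "'k::field_char_0"
  assumes u: "u = replicate (Suc p) 0 @ c # y" "0 < c" "runs_below (Suc p) y"
    and f: "letter_algebra q d (length u) f" "top_coeff f u \<alpha>" "\<alpha> \<noteq> 0"
    and q: "q ^ (length u * length u) = 1"
  shows "letter_algebra_unbounded q d"
  unfolding letter_algebra_unbounded_def
proof
  fix K
  have "\<exists>g. letter_algebra q d (k * length u) g \<and> top_coeff g (concat (replicate k u)) (fact k * \<alpha> ^ k)" for k
  proof (induction k)
    case 0
    show ?case using letter_algebra.word[of "[]" d q] by (auto simp: word_fun_def)
  next
    case (Suc k)
    then obtain g where g: "letter_algebra q d (k * length u) g" "top_coeff g (concat (replicate k u)) (fact k * \<alpha> ^ k)"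
      by blast
    have "of_nat (Suc k) * \<alpha> * (fact k * \<alpha> ^ k) = fact (Suc k) * \<alpha> ^ Suc k" by simp
    then show ?case
      using letter_algebra_qshuffle[OF f(1) g(1)] top_coeff_qshuffle_power[OF u f(2) g(2) q] by (metis mult_Suc)
  qed
  then obtain g where g: "letter_algebra q d (K * length u) g" "top_coeff g (concat (replicate K u)) (fact K * \<alpha> ^ K)"
    by blast
  have "length (concat (replicate K u)) = K * length u" for K by (induction K) auto
  moreover have "K \<le> K * length u" using u(1) by simp
  ultimately show "\<exists>n\<ge>K. \<exists>f w. letter_algebra q d n f \<and> length w = n \<and> f w \<noteq> 0"
    using g(1) top_coeff_value[OF g(2)] f(3) by (metis fact_nonzero mult_eq_0_iff power_not_zero)
qed

text \<open>
  For \<open>q = 1\<close> the shuffle product is the usual one, for which the \<open>n\<close>-th power of a letter is \<open>n!\<close> times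
  a word.
\<close>

lemma letter_product_1: "letter_product 1 (replicate n 0) (replicate n 0) = (fact n :: 'k::field_char_0)"
proof -
  have "letter_product 1 (replicate n 0) = (\<lambda>w. (fact n :: 'k) * word_fun (replicate n 0) w)" for n
  proof (induction n)
    case (Suc n)
    have step: "qshuffle (1::'k) 1 (word_fun [0]) (word_fun (replicate n 0)) = (\<lambda>w. of_nat (Suc n) * word_fun (replicate (Suc n) 0) w)" for n
    proof
      show "qshuffle (1::'k) 1 (word_fun [0]) (word_fun (replicate n 0)) w = of_nat (Suc n) * word_fun (replicate (Suc n) 0) w" for w
      proof (induction w arbitrary: n)
        case (Cons c w)
        have "qshuffle (1::'k) 0 (left_quotient c (word_fun [0])) (word_fun (replicate n 0)) w = (if c = 0 then word_fun (replicate n 0) w else 0)"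
          using qshuffle_unit_left[of "1::'k" 1] by (simp add: left_quotient_word_fun word_fun_def[of "[]"])
        moreover have "left_quotient c (word_fun (replicate n 0)) = (if c = 0 \<and> n > 0 then word_fun (replicate (n - 1) 0) else (\<lambda>_. 0 :: 'k))"
          by (cases n) (auto simp: left_quotient_word_fun)
        moreover have "word_fun (replicate (Suc n) 0) (c # w) = (if c = 0 then word_fun (replicate n 0) w else 0 :: 'k)"
          by (auto simp: word_fun_def)
        ultimately show ?case using Cons[of "n - 1"] by (cases n) (auto simp: algebra_simps)
      qed (simp add: word_fun_def)
    qed
    have "letter_product 1 (replicate (Suc n) 0) = qshuffle (1::'k) 1 (word_fun [0]) (\<lambda>w. fact n * word_fun (replicate n 0) w)"
      using Suc by simp
    also have "\<dots> = (\<lambda>w. fact n * (of_nat (Suc n) * word_fun (replicate (Suc n) 0) w))"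
      by (simp only: qshuffle_scale_right step)
    finally show ?case by (simp only: fact_Suc ac_simps)
  qed (simp add: word_fun_def)
  then show ?thesis by (simp add: word_fun_def)
qed

lemma letter_algebra_unbounded_one:
  assumes "0 < d"
  shows "letter_algebra_unbounded (1 :: 'k::field_char_0) d"
  unfolding letter_algebra_unbounded_def
proof
  fix K
  have "letter_algebra (1::'k) d K (letter_product 1 (replicate K 0))"
    using letter_algebra.word[of "replicate K 0" d "1::'k"] assms by (auto simp: set_replicate_conv_if)
  then show "\<exists>n\<ge>K. \<exists>f w. letter_algebra (1::'k) d n f \<and> length w = n \<and> f w \<noteq> 0"
    by (intro exI[of _ K] conjI order_refl exI[of _ "letter_product 1 (replicate K 0)"] exI[of _ "replicate K 0"])
      (simp_all add: letter_product_1)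
qed

section \<open>Words with one or two ones\<close>

definition zeros_one :: "nat \<Rightarrow> nat list \<Rightarrow> 'k::zero_neq_one" where
  "zeros_one k = word_fun (replicate k 0 @ [1])"

lemma homog_zeros_one: "homog (Suc k) (zeros_one k)"
  using homog_word_fun[of "replicate k 0 @ [1]"] by (simp add: zeros_one_def)

lemma left_quotient_0_zeros_one: "left_quotient 0 (zeros_one k) = (if k = 0 then \<lambda>_. 0 else zeros_one (k - 1))"
  by (cases k) (auto simp: zeros_one_def left_quotient_word_fun)

lemma left_quotient_pos_zeros_one: "0 < c \<Longrightarrow> left_quotient c (zeros_one k) = (if k = 0 \<and> c = 1 then word_fun [] else (\<lambda>_. 0))"
  by (cases k) (auto simp: zeros_one_def left_quotient_word_fun)

lemma qshuffle_unit_word_left [simp]: "qshuffle q 0 (word_fun []) g = g"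
  using qshuffle_unit_left[of q 1 g] by (simp add: word_fun_def)

lemma qshuffle_unit_word_right [simp]: "qshuffle q m f (word_fun []) = f"
  using qshuffle_unit_right[of q m f 1] by (simp add: word_fun_def)

text \<open>
  The braided commutator of the letter \<open>0\<close> with the word \<open>0\<^sup>k1\<close> is a multiple of \<open>0\<^bsup>k+1\<^esup>1\<close>, because the shuffles in which
  \<open>0\<close> comes last cancel. The factor vanishes only if \<open>q\<^bsup>k+1\<^esup> = 1\<close> or \<open>q\<^bsup>k+2\<^esup> = 1\<close> (for \<open>q \<noteq> 1\<close>).
\<close>

lemma zeros_one_bracket:
  fixes q :: "'k::field"
  shows "(1 - q) * (qshuffle q 1 (word_fun [0]) (zeros_one k) w - q ^ Suc k * qshuffle q (Suc k) (zeros_one k) (word_fun [0]) w)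
    = (1 - q ^ Suc k) * (1 - q ^ Suc (Suc k)) * zeros_one (Suc k) w"
proof (induction k arbitrary: w)
  case 0
  show ?case
  proof (cases w)
    case (Cons c v)
    have z: "zeros_one (Suc 0) w = (if c = 0 then zeros_one 0 v else 0 :: 'k)"
      using Cons by (auto simp: zeros_one_def word_fun_def)
    consider "c = 0" | "c = 1" | "c > 1" by linarith
    then show ?thesis
      unfolding z using Cons
      by cases (auto simp: left_quotient_0_zeros_one left_quotient_pos_zeros_one left_quotient_word_fun algebra_simps)
  qed (simp add: zeros_one_def word_fun_def)
next
  case (Suc k)
  show ?case
  proof (cases w)
    case (Cons c v)
    show ?thesis
    proof (cases "c = 0")
      case True
      have "(1 - q) * (qshuffle q 1 (word_fun [0]) (zeros_one (Suc k)) w - q ^ Suc (Suc k) * qshuffle q (Suc (Suc k)) (zeros_one (Suc k)) (word_fun [0]) w)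
        = q * ((1 - q) * (qshuffle q 1 (word_fun [0]) (zeros_one k) v - q ^ Suc k * qshuffle q (Suc k) (zeros_one k) (word_fun [0]) v))
          + (1 - q) * (1 - q ^ Suc (Suc k) * q ^ Suc (Suc k)) * zeros_one (Suc k) v"
        using Cons True by (simp add: left_quotient_0_zeros_one left_quotient_word_fun algebra_simps)
      also have "\<dots> = (1 - q ^ Suc (Suc k)) * (1 - q ^ Suc (Suc (Suc k))) * zeros_one (Suc k) v"
        unfolding Suc by (simp add: algebra_simps)
      also have "zeros_one (Suc k) v = zeros_one (Suc (Suc k)) w"
        using Cons True by (auto simp: zeros_one_def word_fun_def)
      finally show ?thesis .
    next
      case False
      have "zeros_one (Suc (Suc k)) w = (0 :: 'k)" using Cons False by (auto simp: zeros_one_def word_fun_def)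
      moreover have "qshuffle q 1 (word_fun [0]) (zeros_one (Suc k)) w = 0" "qshuffle q (Suc (Suc k)) (zeros_one (Suc k)) (word_fun [0]) w = 0"
        using Cons False by (simp_all add: left_quotient_pos_zeros_one left_quotient_word_fun)
      ultimately show ?thesis by simp
    qed
  qed (simp add: zeros_one_def word_fun_def)
qed

lemma letter_algebra_zeros_one:
  fixes q :: "'k::field"
  assumes "2 \<le> d" "\<And>n. 0 < n \<Longrightarrow> n < N \<Longrightarrow> q ^ n \<noteq> 1" "Suc k < N"
  shows "letter_algebra q d (Suc k) (zeros_one k)"
  using assms(3)
proof (induction k)
  case 0
  show ?case using letter_algebra_letter[of 1 d q] assms(1) by (simp add: zeros_one_def)
next
  case (Suc k)
  let ?c = "(1 - q ^ Suc k) * (1 - q ^ Suc (Suc k))"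
  let ?f = "\<lambda>w. qshuffle q 1 (word_fun [0]) (zeros_one k) w - q ^ Suc k * qshuffle q (Suc k) (zeros_one k) (word_fun [0]) w"
  have z: "letter_algebra q d (Suc k) (zeros_one k)" using Suc by simp
  have l: "letter_algebra q d 1 (word_fun [0])" using letter_algebra_letter[of 0 d q] assms(1) by simp
  have "?c \<noteq> 0" using assms(2)[of "Suc k"] assms(2)[of "Suc (Suc k)"] Suc.prems by auto
  then have "zeros_one (Suc k) = (\<lambda>w. ((1 - q) / ?c) * ?f w)"
    using zeros_one_bracket[of q k] by (simp add: fun_eq_iff nonzero_eq_divide_eq mult.commute)
  moreover have "letter_algebra q d (Suc (Suc k)) ?f"
    using letter_algebra_diff[OF letter_algebra_qshuffle[OF l z]] letter_algebra_qshuffle[OF z l] by simp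
  ultimately show ?case by (simp only: letter_algebra.scale)
qed

text \<open>
  The coefficient of \<open>0\<^sup>r10\<^sup>s1\<close>, where \<open>r + s = i + j\<close>, in the product of \<open>0\<^sup>i1\<close> and \<open>0\<^sup>j1\<close>; see
  \<open>qshuffle_zeros_one_zeros_one\<close>.
\<close>

fun zcoeff :: "'k::field \<Rightarrow> nat \<Rightarrow> nat \<Rightarrow> nat \<Rightarrow> 'k" where
  "zcoeff q 0 i j = (if i = 0 then 1 else 0) + (if j = 0 then q ^ Suc i else 0)"
| "zcoeff q (Suc r) i j =
     (if i = 0 then 0 else zcoeff q r (i - 1) j) + (if j = 0 then 0 else q ^ Suc i * zcoeff q r i (j - 1))"

lemma qshuffle_zeros_one_zeros_one:
  "qshuffle q (Suc i) (zeros_one i) (zeros_one j) (replicate r 0 @ 1 # w) = zcoeff q r i j * zeros_one (i + j - r) w"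
proof (induction r arbitrary: i j)
  case 0
  show ?case by (auto simp: left_quotient_pos_zeros_one algebra_simps)
next
  case (Suc r)
  show ?case
    using Suc[of "i - 1" j] Suc[of i "j - 1"]
    by (cases i; cases j) (auto simp: left_quotient_0_zeros_one algebra_simps)
qed

lemma zcoeff_low: "r < i \<Longrightarrow> r < j \<Longrightarrow> zcoeff q r i j = 0"
  by (induction r arbitrary: i j) auto

lemma zcoeff_left: "i < j \<Longrightarrow> zcoeff q i i j = 1"
proof (induction i arbitrary: j)
  case (Suc i) then show ?case using zcoeff_low[of i "Suc i" "j - 1" q] by auto
qed simp

lemma zcoeff_right: "j < i \<Longrightarrow> zcoeff q j i j = q ^ (Suc i * Suc j)"
proof (induction j arbitrary: i)
  case (Suc j) then show ?case using zcoeff_low[of j "i - 1" "Suc j" q] by (auto simp: power_add)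
qed simp

lemma zcoeff_diag: "zcoeff q i i i = 1 + q ^ (Suc i * Suc i)"
proof (cases i)
  case (Suc k) then show ?thesis using zcoeff_left[of k i q] zcoeff_right[of k i q] by (auto simp: power_add)
qed simp

definition qnum :: "'k::field \<Rightarrow> nat \<Rightarrow> 'k" where
  "qnum q n = (\<Sum>k<n. q ^ k)"

lemma qnum_0 [simp]: "qnum q 0 = 0" and qnum_Suc: "qnum q (Suc n) = qnum q n + q ^ n"
  by (simp_all add: qnum_def)

lemma qnum_Suc': "qnum q (Suc n) = 1 + q * qnum q n"
proof (induction n)
  case (Suc n)
  have "qnum q (Suc (Suc n)) = 1 + q * qnum q n + q ^ Suc n" by (simp only: qnum_Suc[of q "Suc n"] Suc)
  also have "\<dots> = 1 + q * qnum q (Suc n)" by (simp add: qnum_Suc[of q n] distrib_left)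
  finally show ?case .
qed (simp add: qnum_Suc)

lemma qnum_geometric: "(1 - q) * qnum q n = 1 - q ^ n"
  by (induction n) (simp_all add: qnum_Suc distrib_left, simp add: algebra_simps)

lemma zcoeff_Suc_left: "Suc i < j \<Longrightarrow> zcoeff q (Suc i) i j = q * qnum q (Suc i)"
proof (induction i arbitrary: j)
  case 0 then show ?case by (auto simp: qnum_Suc)
next
  case (Suc i) then show ?case
    using zcoeff_left[of "Suc i" "j - 1" q] by (auto simp: qnum_Suc[of q "Suc i"] distrib_left)
qed

lemma zcoeff_Suc_right: "Suc j < i \<Longrightarrow> zcoeff q (Suc j) i j = q ^ (Suc j * i) * qnum q (Suc j)"
proof (induction j arbitrary: i)
  case 0 then show ?case by (cases i) (auto simp: qnum_Suc)
next
  case (Suc j)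
  then obtain k where k: "i = Suc k" "Suc j < k" by (cases i) auto
  then show ?case
    using zcoeff_right[of "Suc j" k q] Suc.IH[of i]
    by (simp add: qnum_Suc'[of q "Suc j"] distrib_left power_add[symmetric] mult.assoc[symmetric])
      (simp add: algebra_simps power_add)
qed

lemma zcoeff_Suc_up: "zcoeff q (Suc i) i (Suc i) = q * qnum q (Suc i) + q ^ (Suc i * Suc (Suc i))"
proof (induction i)
  case 0 then show ?case by (auto simp: qnum_Suc power2_eq_square algebra_simps)
next
  case (Suc i) then show ?case
    using zcoeff_Suc_left[of i "Suc (Suc i)" q] zcoeff_diag[of q "Suc i"]
    by (simp add: qnum_Suc[of q "Suc i"] algebra_simps power_add)
qed

lemma zcoeff_Suc_down: "zcoeff q (Suc i) (Suc i) i = 1 + q ^ (Suc i * Suc i) * qnum q (Suc i)"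
proof (induction i)
  case 0 then show ?case by (auto simp: qnum_Suc algebra_simps)
next
  case (Suc i) then show ?case
    using zcoeff_Suc_right[of i "Suc (Suc i)" q] zcoeff_diag[of q "Suc i"]
    by (simp add: qnum_Suc'[of q "Suc i"] algebra_simps power_add)
qed

lemma zcoeff_Suc_diag: "0 < i \<Longrightarrow> zcoeff q (Suc i) i i = qnum q (Suc i) * (q + q ^ (i * Suc i))"
proof (cases i)
  case (Suc k)
  have "zcoeff q (Suc i) i i = zcoeff q (Suc k) k (Suc k) + q ^ Suc (Suc k) * zcoeff q (Suc k) (Suc k) k"
    using Suc by simp
  also have "\<dots> = q * (qnum q (Suc k) + q ^ Suc k) + q ^ (Suc k * Suc (Suc k)) * (1 + q * qnum q (Suc k))"
    unfolding zcoeff_Suc_up zcoeff_Suc_down by (simp add: algebra_simps power_add)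
  also have "\<dots> = qnum q (Suc i) * (q + q ^ (i * Suc i))"
    unfolding qnum_Suc[of q "Suc k", symmetric] qnum_Suc'[of q "Suc k", symmetric] using Suc by (simp add: algebra_simps)
  finally show ?thesis .
qed simp

text \<open>
  Products of the words \<open>0\<^sup>k1\<close> involve only the letters \<open>0\<close> and \<open>1\<close>, so words with a greater letter do not
  compete for being the greatest.
\<close>

definition letters_below :: "nat \<Rightarrow> (nat list \<Rightarrow> 'k::zero) \<Rightarrow> bool" where
  "letters_below d f \<longleftrightarrow> (\<forall>w. f w \<noteq> 0 \<longrightarrow> set w \<subseteq> {..<d})"

lemma letters_below_left_quotient: "letters_below d f \<Longrightarrow> letters_below d (left_quotient c f)"
  by (force simp: letters_below_def left_quotient_def)

lemma letters_below_left_quotient_zero: "letters_below d f \<Longrightarrow> d \<le> c \<Longrightarrow> left_quotient c f = (\<lambda>_. 0)"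
  by (force simp: letters_below_def left_quotient_def)

lemma letters_below_qshuffle:
  assumes "letters_below d f" "letters_below d g"
  shows "letters_below d (qshuffle q m f g)"
proof -
  have "set w \<subseteq> {..<d}" if "qshuffle q m f g w \<noteq> 0" for w
    using assms that
  proof (induction w arbitrary: m f g)
    case (Cons c w)
    then have "c < d" by (force simp: not_less dest: letters_below_left_quotient_zero)
    moreover have "qshuffle q (m - 1) (left_quotient c f) g w \<noteq> 0 \<or> qshuffle q m f (left_quotient c g) w \<noteq> 0"
      using Cons.prems(3) by auto
    then have "set w \<subseteq> {..<d}" using Cons.IH Cons.prems(1,2) letters_below_left_quotient by blast
    ultimately show ?case by simp
  qed simp
  then show ?thesis by (simp add: letters_below_def)
qed

lemma letters_below_zeros_one: "letters_below 2 (zeros_one k)"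
  by (auto simp: letters_below_def zeros_one_def word_fun_def)

lemma top_coeff_initial_zeros:
  assumes "homog (r + Suc (length s)) f" "letters_below 2 f"
    and "\<And>r' w. r' < r \<Longrightarrow> f (replicate r' 0 @ 1 # w) = 0"
    and "top_coeff (\<lambda>w. f (replicate r 0 @ 1 # w)) s \<gamma>"
  shows "top_coeff f (replicate r 0 @ 1 # s) \<gamma>"
  using assms
proof (induction r arbitrary: f)
  case 0
  then show ?case by (auto simp: letters_below_left_quotient_zero left_quotient_def[of 1] left_quotient_def[of "Suc 0"])
next
  case (Suc r)
  have "top_coeff (left_quotient 0 f) (replicate r 0 @ 1 # s) \<gamma>"
    using Suc.prems(1) Suc.prems(3)[of "Suc _"] Suc.prems(2,4)
    by (intro Suc.IH homog_left_quotient letters_below_left_quotient) (auto simp: left_quotient_def)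
  moreover have "left_quotient d f = (\<lambda>_. 0)" if "d > 0" for d
    using Suc.prems(2) Suc.prems(3)[of 0] that
    by (cases "d = 1") (auto simp: letters_below_left_quotient_zero left_quotient_def[of "Suc 0"])
  ultimately show ?case using Suc.prems(1) by simp
qed

lemma top_coeff_zeros_one: "top_coeff (\<lambda>w. a * zeros_one k w) (replicate k 0 @ [1]) a"
  using top_coeff_scale[OF top_coeff_word_fun, of a "replicate k 0 @ [1]"] by (simp add: zeros_one_def)

lemma runs_below_zeros_one: "r < p \<Longrightarrow> runs_below p (replicate r 0 @ [1])"
  by (rule runs_below.run[OF runs_below.Nil]) auto

section \<open>Elements all of whose powers are nonzero\<close>

text \<open>
  With \<open>i = m - 1\<close>, both products of \<open>0\<^sup>m1\<close> and \<open>0\<^sup>i1\<close> have the greatest word \<open>0\<^sup>i10\<^sup>m1\<close>, which begins with the shorter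
  run. The commutator \<open>?f\<close> is chosen to cancel it, which leaves the greatest word \<open>0\<^sup>m10\<^sup>i1\<close> of length \<open>2m + 1\<close>.
  In terms of \<open>y = q\<^bsup>m\<^sup>2\<^esup>\<close>, for which \<open>q = y\<^sup>4\<close>, its coefficient times \<open>1 - q\<close> is \<open>(1 - q\<^sup>m)(1 + y)(1 - y\<^sup>3)\<close>.
  It vanishes neither by \<open>y = -1\<close>, where \<open>q\<close> would be \<open>1\<close>, nor by \<open>y\<^sup>3 = 1\<close>, where \<open>q\<^sup>3\<close> would be \<open>1\<close>.
\<close>

lemma letter_algebra_unbounded_odd:
  fixes q :: "'k::field_char_0"
  assumes d: "2 \<le> d" and m: "2 \<le> m"
    and q: "q ^ (2 * m + 1) = 1" "\<And>n. 0 < n \<Longrightarrow> n < 2 * m + 1 \<Longrightarrow> q ^ n \<noteq> 1"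
  shows "letter_algebra_unbounded q d"
proof -
  obtain i where i: "m = Suc i" "0 < i" using m by (cases m) auto
  define y u where "y = q ^ (m * m)" and "u = q ^ m"
  have q0: "q \<noteq> 0" using q(1) by auto
  have "y * y * u = q ^ (m * (2 * m + 1))" by (simp add: y_def u_def power_add[symmetric] algebra_simps mult_2_right)
  also have "\<dots> = 1" using q(1) by (metis mult.commute power_mult power_one)
  finally have yyu: "y * y * u = 1" .
  have "u * u * q = q ^ (m + m + 1)" unfolding u_def by (simp only: power_add power_one_right)
  then have uuq: "u * u * q = 1" using q(1) by (simp only: mult_2)
  have y0: "y \<noteq> 0" using yyu by auto
  have qy: "q = y ^ 4"
  proof -
    have "q = (y * y * u) * (y * y * u) * q" using yyu by simp
    also have "\<dots> = y ^ 4 * (u * u * q)" by (simp add: power4_eq_xxxx)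
    finally show ?thesis using uuq by simp
  qed
  have u1: "u \<noteq> 1" using q(2)[of m] m by (simp add: u_def)
  have y1: "y \<noteq> - 1"
  proof
    assume "y = - 1"
    then show False using qy q(2)[of 1] m by simp
  qed
  have y3: "y ^ 3 \<noteq> 1"
  proof
    assume "y ^ 3 = 1"
    then have "q ^ 3 = 1" using qy by (metis mult.commute power_mult power_one)
    then show False using q(2)[of 3] m by simp
  qed
  let ?f = "\<lambda>w. qshuffle q (Suc m) (zeros_one m) (zeros_one i) w - q ^ (Suc m * m) * qshuffle q (Suc i) (zeros_one i) (zeros_one m) w"
  let ?\<gamma> = "zcoeff q m m i - q ^ (Suc m * m) * zcoeff q m i m"
  let ?u = "replicate (Suc i) 0 @ 1 # replicate i 0 @ [1]"
  have f: "letter_algebra q d (length ?u) ?f"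
  proof -
    have "letter_algebra q d (Suc m) (zeros_one m)" "letter_algebra q d (Suc i) (zeros_one i)"
      using letter_algebra_zeros_one[OF d q(2)] i by auto
    from letter_algebra_diff[OF letter_algebra_qshuffle[OF this], of "qshuffle q (Suc i) (zeros_one i) (zeros_one m)"] letter_algebra_qshuffle[OF this(2,1)]
    show ?thesis using i by (simp add: add.commute)
  qed
  have eval: "?f (replicate r 0 @ 1 # w) = (zcoeff q r m i - q ^ (Suc m * m) * zcoeff q r i m) * zeros_one (m + i - r) w" for r w
    by (simp only: qshuffle_zeros_one_zeros_one) (simp add: algebra_simps)
  have low: "?f (replicate r 0 @ 1 # w) = 0" if "r < m" for r w
  proof -
    have "zcoeff q r m i - q ^ (Suc m * m) * zcoeff q r i m = 0"
      using that i zcoeff_low[of r i m q] zcoeff_low[of r m i q] zcoeff_left[of i m q] zcoeff_right[of i m q]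
      by (cases "r = i") auto
    then show ?thesis unfolding eval by simp
  qed
  have "top_coeff ?f (replicate m 0 @ 1 # replicate i 0 @ [1]) ?\<gamma>"
  proof (rule top_coeff_initial_zeros)
    show "homog (m + Suc (length (replicate i 0 @ [1]))) ?f"
      using homog_qshuffle[OF homog_zeros_one[of m] homog_zeros_one[of i], of q] homog_qshuffle[OF homog_zeros_one[of i] homog_zeros_one[of m], of q]
      by (auto simp: homog_def)
    show "letters_below 2 ?f"
      using letters_below_qshuffle[OF letters_below_zeros_one letters_below_zeros_one, of q "Suc m" m i]
        letters_below_qshuffle[OF letters_below_zeros_one letters_below_zeros_one, of q "Suc i" i m]
      unfolding letters_below_def by force
    show "top_coeff (\<lambda>w. ?f (replicate m 0 @ 1 # w)) (replicate i 0 @ [1]) ?\<gamma>"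
      unfolding eval using top_coeff_zeros_one[of ?\<gamma> i] by simp
  qed (rule low)
  then have top: "top_coeff ?f ?u ?\<gamma>" using i by simp
  have "(1 - q) * ?\<gamma> = (1 - q) * (1 - q ^ (Suc m * m) * q ^ (m * Suc m))
      + ((1 - q) * qnum q m) * (q ^ (m * m) - q * q ^ (Suc m * m))"
    using zcoeff_Suc_down[of q i] zcoeff_Suc_up[of q i] by (simp only: i) (simp only: algebra_simps)
  also have "\<dots> = (1 - q) * (1 - (y * u) * (y * u)) + (1 - u) * (y - q * (y * u))"
    unfolding qnum_geometric by (simp add: y_def u_def power_add mult.commute)
  also have "(y * u) * (y * u) = u" using yyu by (metis mult.assoc mult.commute mult_1)
  also have "q * (y * u) = y ^ 3"
  proof -
    have "y ^ 4 * (y * u) = y ^ 3 * (y * y * u)" by (simp add: power4_eq_xxxx power3_eq_cube)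
    then show ?thesis using qy yyu by simp
  qed
  also have "(1 - q) * (1 - u) + (1 - u) * (y - y ^ 3) = (1 - u) * ((1 + y) * (1 - y ^ 3))"
    unfolding qy by (simp add: algebra_simps power4_eq_xxxx power3_eq_cube)
  finally have "(1 - q) * ?\<gamma> \<noteq> 0" using u1 y1 y3 by (auto simp: add_eq_0_iff)
  then have \<gamma>: "?\<gamma> \<noteq> 0" by auto
  have "length ?u = 2 * m + 1" using i by simp
  then have "q ^ (length ?u * length ?u) = 1" using q(1) by (metis power_mult power_one)
  then show ?thesis
    by (rule letter_algebra_unbounded_if_top_coeff[OF refl zero_less_one runs_below_zeros_one[OF lessI] f top \<gamma>])
qed

text \<open>
  The square of \<open>0\<^bsup>m-1\<^esup>1\<close> would have the greatest word \<open>0\<^bsup>m-1\<^esup>10\<^bsup>m-1\<^esup>1\<close> with coefficient \<open>1 + q\<^bsup>m\<^sup>2\<^esup>\<close>, but \<open>q\<^sup>m = -1\<close> and \<open>m\<close> is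
  odd, so this is \<open>0\<close>. The next word \<open>0\<^sup>m10\<^bsup>m-2\<^esup>1\<close> has a nonzero coefficient and the required form.
\<close>

lemma letter_algebra_unbounded_even_odd:
  fixes q :: "'k::field_char_0"
  assumes d: "2 \<le> d" and m: "3 \<le> m" "odd m"
    and q: "q ^ (2 * m) = 1" "\<And>n. 0 < n \<Longrightarrow> n < 2 * m \<Longrightarrow> q ^ n \<noteq> 1"
  shows "letter_algebra_unbounded q d"
proof -
  obtain j where j: "m = Suc (Suc j)" "0 < j" using m by (cases m; cases "m - 1") auto
  let ?i = "Suc j"
  have qm: "q ^ m = - 1"
  proof -
    have "(q ^ m) ^ 2 = 1" using q(1) by (simp add: power_mult[symmetric] mult.commute)
    moreover have "q ^ m \<noteq> 1" using q(2)[of m] m by simp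
    ultimately show ?thesis by (simp add: power2_eq_1_iff)
  qed
  let ?f = "qshuffle q (Suc ?i) (zeros_one ?i) (zeros_one ?i)"
  let ?\<gamma> = "zcoeff q m ?i ?i"
  let ?u = "replicate (Suc ?i) 0 @ 1 # replicate j 0 @ [1]"
  have f: "letter_algebra q d (length ?u) ?f"
  proof -
    have "letter_algebra q d (Suc ?i) (zeros_one ?i)" by (rule letter_algebra_zeros_one[OF d, where N = "2 * m"]) (use q j in auto)
    from letter_algebra_qshuffle[OF this this] show ?thesis by (simp add: add.commute)
  qed
  have "q ^ (m * m) = - 1" using qm m(2) by (simp add: power_mult)
  then have diag: "zcoeff q ?i ?i ?i = 0" using j by (simp only: zcoeff_diag) simp
  have low: "?f (replicate r 0 @ 1 # w) = 0" if "r < m" for r w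
  proof -
    have "zcoeff q r ?i ?i = 0"
      using that j zcoeff_low[of r ?i ?i q] diag by (cases "r = ?i") auto
    then show ?thesis unfolding qshuffle_zeros_one_zeros_one by simp
  qed
  have top: "top_coeff ?f (replicate (Suc ?i) 0 @ 1 # replicate j 0 @ [1]) ?\<gamma>"
  proof (rule top_coeff_initial_zeros)
    show "homog (Suc ?i + Suc (length (replicate j 0 @ [1]))) ?f"
      using homog_qshuffle[OF homog_zeros_one[of ?i] homog_zeros_one[of ?i], of q] by (simp add: add.commute)
    show "letters_below 2 ?f"
      by (rule letters_below_qshuffle[OF letters_below_zeros_one letters_below_zeros_one])
    show "top_coeff (\<lambda>w. ?f (replicate (Suc ?i) 0 @ 1 # w)) (replicate j 0 @ [1]) ?\<gamma>"
      unfolding qshuffle_zeros_one_zeros_one using top_coeff_zeros_one[of ?\<gamma> j] j by simp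
  qed (use low j in simp)
  have "even ?i" using m j by simp
  then have "q ^ (?i * Suc ?i) = 1" using qm j by (metis mult.commute power_mult neg_one_even_power)
  then have "?\<gamma> = qnum q m * (q + 1)" using zcoeff_Suc_diag[of ?i q] j by simp
  moreover have "qnum q m \<noteq> 0" using qnum_geometric[of q m] q(2)[of m] m by auto
  moreover have "q + 1 \<noteq> 0"
  proof
    assume "q + 1 = 0"
    then have "q ^ 2 = 1" by (simp add: add_eq_0_iff2)
    then show False using q(2)[of 2] m by simp
  qed
  ultimately have \<gamma>: "?\<gamma> \<noteq> 0" by simp
  have "length ?u = 2 * m" using j by simp
  then have "q ^ (length ?u * length ?u) = 1" using q(1) by (metis power_mult power_one)
  then show ?thesis
    by (rule letter_algebra_unbounded_if_top_coeff[OF refl zero_less_one runs_below_zeros_one f top \<gamma>, rotated]) simp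
qed

text \<open>
  Here \<open>m\<^sup>2\<close> is a multiple of the order \<open>2m\<close> of \<open>q\<close>, so that the word \<open>0\<^bsup>m-1\<^esup>1\<close> of length \<open>m\<close> is already of the
  required kind.
\<close>

lemma letter_algebra_unbounded_mult_4:
  fixes q :: "'k::field_char_0"
  assumes d: "2 \<le> d" and m: "0 < m" "even m"
    and q: "q ^ (2 * m) = 1" "\<And>n. 0 < n \<Longrightarrow> n < 2 * m \<Longrightarrow> q ^ n \<noteq> 1"
  shows "letter_algebra_unbounded q d"
proof -
  obtain p where p: "m = Suc (Suc p)" using m by (cases m; cases "m - 1") auto
  obtain k where "m = 2 * k" using m by auto
  then have "m * m = 2 * m * k" by simp
  then have "q ^ (m * m) = 1" using q(1) by (simp only: power_mult power_one)
  moreover have "letter_algebra q d m (zeros_one (Suc p))"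
    unfolding p by (rule letter_algebra_zeros_one[OF d, where N = "2 * m"]) (use q p in auto)
  moreover have "top_coeff (zeros_one (Suc p) :: _ \<Rightarrow> 'k) (replicate (Suc p) 0 @ [1]) 1"
    using top_coeff_word_fun by (simp add: zeros_one_def del: replicate_Suc)
  ultimately show ?thesis
    using p by (intro letter_algebra_unbounded_if_top_coeff[where u = "replicate (Suc p) 0 @ [1]" and p = p and c = 1 and y = "[]" and \<alpha> = 1])
      (auto intro: runs_below.Nil)
qed

lemma left_quotient_diff: "left_quotient c (\<lambda>w. f w - a * g w) = (\<lambda>w. left_quotient c f w - a * left_quotient c g w)"
  by (simp add: left_quotient_def)

text \<open>
  The commutator \<open>?f\<close> equals \<open>(1 - q) 012 + (q - 1) 021\<close>, since the words \<open>201\<close> cancel.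
\<close>

lemma letter_algebra_unbounded_3:
  fixes q :: "'k::field_char_0"
  assumes d: "3 \<le> d" and q: "q ^ 3 = 1" "q \<noteq> 1" "q ^ 2 \<noteq> 1"
  shows "letter_algebra_unbounded q d"
proof -
  let ?z = "zeros_one 1 :: nat list \<Rightarrow> 'k" and ?c = "word_fun [2] :: nat list \<Rightarrow> 'k"
  let ?f = "\<lambda>w. qshuffle q 2 ?z ?c w - q ^ 2 * qshuffle q 1 ?c ?z w"
  have n: "n = 1 \<or> n = 2" if "0 < n" "n < 3" for n :: nat using that by auto
  have "q ^ n \<noteq> 1" if "0 < n" "n < 3" for n using n[OF that] q by auto
  then have "letter_algebra q d 2 ?z" using letter_algebra_zeros_one[of d 3 q 1] d by (auto simp: numeral_2_eq_2)
  moreover have "letter_algebra q d 1 ?c" using letter_algebra_letter[of 2 d q] d by simp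
  ultimately have "letter_algebra q d (2 + 1) (qshuffle q 2 ?z ?c)" "letter_algebra q d (1 + 2) (qshuffle q 1 ?c ?z)"
    by (blast intro: letter_algebra_qshuffle)+
  moreover have "2 + 1 = (3::nat)" "1 + 2 = (3::nat)" by simp_all
  ultimately have f: "letter_algebra q d 3 ?f" by (simp only: letter_algebra_diff)
  have hom: "homog 3 ?f"
    using homog_qshuffle[OF homog_zeros_one[of 1] homog_word_fun[of "[2]"], of q]
      homog_qshuffle[OF homog_word_fun[of "[2]"] homog_zeros_one[of 1], of q]
    by (auto simp: homog_def numeral_2_eq_2 numeral_3_eq_3)
  have l2: "left_quotient a ?c = (if a = 2 then word_fun [] else (\<lambda>_. 0))" for a by (simp add: left_quotient_word_fun)
  have f1: "left_quotient a ?f = (\<lambda>_. 0)" if "0 < a" for a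
    using that by (auto simp: left_quotient_diff left_quotient_qshuffle left_quotient_pos_zeros_one l2 fun_eq_iff)
  have f0: "left_quotient 0 ?f = (\<lambda>w. qshuffle q 1 (zeros_one 0) ?c w - q ^ 3 * qshuffle q 1 ?c (zeros_one 0) w)"
    by (auto simp: left_quotient_diff left_quotient_qshuffle left_quotient_0_zeros_one l2 fun_eq_iff power3_eq_cube power2_eq_square)
  have f2: "left_quotient a (left_quotient 0 ?f) = (\<lambda>_. 0)" if "2 < a" for a
    unfolding f0 using that by (auto simp: left_quotient_diff left_quotient_qshuffle left_quotient_pos_zeros_one l2 fun_eq_iff)
  have f3: "left_quotient 2 (left_quotient 0 ?f) = (\<lambda>w. (q - 1) * word_fun [1] w)"
    unfolding f0 unfolding left_quotient_diff left_quotient_qshuffle using q by (auto simp: left_quotient_pos_zeros_one l2 fun_eq_iff zeros_one_def left_quotient_word_fun algebra_simps)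
  have "top_coeff (left_quotient 2 (left_quotient 0 ?f)) [1] (q - 1)"
    unfolding f3 using top_coeff_scale[OF top_coeff_word_fun[of "[1]"], of "q - 1"] by simp
  then have top: "top_coeff ?f [0, 2, 1] (q - 1)"
    using hom f1 f2 homog_left_quotient[of 2 ?f 0] by (simp add: numeral_2_eq_2 numeral_3_eq_3)
  have "(q ^ 3) ^ 3 = 1" using q(1) by simp
  moreover have "length [0, 2, 1 :: nat] = 3" by simp
  ultimately have q9: "q ^ (length [0, 2, 1 :: nat] * length [0, 2, 1 :: nat]) = 1"
    by (simp only: power_mult)
  have u: "[0, 2, 1 :: nat] = replicate (Suc 0) 0 @ 2 # [1]" by simp
  have "runs_below (Suc 0) [1]" using runs_below_zeros_one[of 0 "Suc 0"] by simp
  moreover have "letter_algebra q d (length [0, 2, 1 :: nat]) ?f" using f by (simp add: numeral_3_eq_3)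
  moreover have "q - 1 \<noteq> 0" using q(2) by simp
  ultimately show ?thesis using letter_algebra_unbounded_if_top_coeff[OF u zero_less_numeral _ _ top _ q9] by blast
qed

section \<open>Permutations and inversions\<close>

fun list_inv :: "nat list \<Rightarrow> nat" where
  "list_inv [] = 0"
| "list_inv (x # xs) = card {y \<in> set xs. y < x} + list_inv xs"

text \<open>
  The length of a permutation is its number of inversions, so a reduced expression of \<open>x\<close> contributes the
  power \<open>q\<^bsup>inv(x)\<^esup>\<close>. The variant \<open>list_inv\<close> for lists suits the recursion over permutations written as lists.
\<close>

definition inversions :: "nat \<Rightarrow> (nat \<Rightarrow> nat) \<Rightarrow> (nat \<times> nat) set" where
  "inversions n x = {(i, j). i < j \<and> j < n \<and> x j < x i}"

lemma finite_inversions [simp]: "finite (inversions n x)"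
  by (rule finite_subset[of _ "{..<n} \<times> {..<n}"]) (auto simp: inversions_def)

lemma list_inv_eq_card:
  assumes "distinct xs"
  shows "list_inv xs = card {(i, j). i < j \<and> j < length xs \<and> xs ! j < xs ! i}"
  using assms
proof (induction xs)
  case (Cons a xs)
  let ?I = "\<lambda>xs. {(i, j). i < j \<and> j < length xs \<and> xs ! j < (xs ! i :: nat)}"
  let ?J = "{j. j < length xs \<and> xs ! j < a}"
  have fin: "finite (?I xs)" by (rule finite_subset[of _ "{..<length xs} \<times> {..<length xs}"]) auto
  have disj: "(\<lambda>j. (0::nat, Suc j)) ` ?J \<inter> (\<lambda>(i, j). (Suc i, Suc j)) ` ?I xs = {}" by auto
  have finJ: "finite ?J" by simp
  have "?I (a # xs) = (\<lambda>j. (0, Suc j)) ` ?J \<union> (\<lambda>(i, j). (Suc i, Suc j)) ` ?I xs"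
  proof (intro Set.set_eqI iffI)
    fix p assume "p \<in> ?I (a # xs)"
    then obtain i j where p: "p = (i, j)" "i < j" "j < length (a # xs)" "(a # xs) ! j < (a # xs) ! i" by blast
    then obtain j' where j: "j = Suc j'" by (cases j) auto
    show "p \<in> (\<lambda>j. (0, Suc j)) ` ?J \<union> (\<lambda>(i, j). (Suc i, Suc j)) ` ?I xs"
    proof (cases i)
      case 0
      then have "j' \<in> ?J" "p = (0, Suc j')" using p j by auto
      then show ?thesis by blast
    next
      case (Suc i')
      then have "(i', j') \<in> ?I xs" "p = (case (i', j') of (i, j) \<Rightarrow> (Suc i, Suc j))" using p j by auto
      then show ?thesis by blast
    qed
  qed auto
  then have "card (?I (a # xs)) = card ((\<lambda>j. (0::nat, Suc j)) ` ?J) + card ((\<lambda>(i, j). (Suc i, Suc j)) ` ?I xs)"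
    by (simp only: card_Un_disjoint[OF finite_imageI[OF finJ] finite_imageI[OF fin] disj])
  moreover have "card ((\<lambda>(i, j). (Suc i, Suc j)) ` ?I xs) = card (?I xs)"
    by (rule card_image) (auto simp: inj_on_def)
  moreover have "card ((\<lambda>j. (0::nat, Suc j)) ` ?J) = card ?J"
    by (rule card_image) (auto simp: inj_on_def)
  moreover have "card ?J = card ((!) xs ` ?J)"
    using Cons.prems by (intro card_image[symmetric] inj_on_nth) simp_all
  moreover have "(!) xs ` ?J = {y \<in> set xs. y < a}"
    by (force simp: set_conv_nth)
  moreover have "list_inv xs = card (?I xs)" using Cons by simp
  ultimately show ?case by (simp only: list_inv.simps)
qed simp

lemma list_inv_map_upt:
  assumes "inj_on x {..<n}"
  shows "list_inv (map x [0..<n]) = card (inversions n x)"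
proof -
  have "distinct (map x [0..<n])" using assms by (simp add: distinct_map atLeast_upt)
  moreover have "{(i, j). i < j \<and> j < length (map x [0..<n]) \<and> map x [0..<n] ! j < map x [0..<n] ! i} = inversions n x"
    by (auto simp: inversions_def)
  ultimately show ?thesis by (simp add: list_inv_eq_card)
qed

lemma word_perm_simps [simp]:
  "word_perm [] = id" "word_perm (i # is) = transpose i (Suc i) \<circ> word_perm is"
  by (simp_all add: word_perm_def)

lemma word_perm_permutes: "\<forall>i\<in>set is. Suc i < n \<Longrightarrow> word_perm is permutes {..<n}"
proof (induction "is")
  case Nil then show ?case by (simp only: word_perm_simps permutes_id)
next
  case (Cons i "is")
  have "transpose i (Suc i) permutes {..<n}" using Cons.prems by (intro permutes_swap_id) auto
  then show ?case unfolding word_perm_simps using Cons by (intro permutes_compose) auto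
qed

lemma transpose_Suc_less: "a \<noteq> b \<Longrightarrow> transpose i (Suc i) a < transpose i (Suc i) b \<longleftrightarrow>
    (if a = i \<and> b = Suc i then False else if a = Suc i \<and> b = i then True else a < (b :: nat))"
  by (auto simp: transpose_def)

lemma card_inversions_le_length:
  "\<forall>i\<in>set is. Suc i < n \<Longrightarrow> card (inversions n (word_perm is)) \<le> length is"
proof (induction "is")
  case Nil
  have "inversions n id = {}" by (auto simp: inversions_def)
  then show ?case by (simp only: word_perm_simps card.empty)
next
  case (Cons i "is")
  let ?x = "word_perm is"
  have inj: "inj ?x" using word_perm_permutes[of "is" n] Cons.prems by (simp add: permutes_inj)
  define z where "z = inv_into UNIV ?x"
  have zx: "z (?x a) = a" for a using inj by (simp add: z_def)
  have "inversions n (word_perm (i # is)) \<subseteq> insert (z i, z (Suc i)) (inversions n ?x)"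
  proof
    fix p assume "p \<in> inversions n (word_perm (i # is))"
    then obtain a b where p: "p = (a, b)" "a < b" "b < n" "transpose i (Suc i) (?x b) < transpose i (Suc i) (?x a)"
      by (auto simp: inversions_def)
    then have "?x a \<noteq> ?x b" by auto
    then have "?x b < ?x a \<or> ?x a = i \<and> ?x b = Suc i"
      using p(4) by (auto simp: transpose_Suc_less split: if_splits)
    then show "p \<in> insert (z i, z (Suc i)) (inversions n ?x)"
      using p zx[of a] zx[of b] by (auto simp: inversions_def)
  qed
  then have "card (inversions n (word_perm (i # is))) \<le> card (insert (z i, z (Suc i)) (inversions n ?x))"
    by (intro card_mono) auto
  also have "\<dots> \<le> Suc (card (inversions n ?x))" by (simp add: card_insert_if)
  finally show ?case using Cons.IH Cons.prems by (metis Suc_le_mono length_Cons list.set_intros(2) order_trans)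
qed

text \<open>
  Bubble sort: unless \<open>x\<close> is the identity, some values \<open>i + 1\<close> and \<open>i\<close> occur in the wrong order, and exchanging
  them removes exactly this inversion.
\<close>

lemma exists_short_expression:
  assumes "x permutes {..<n}"
  shows "\<exists>es. (\<forall>i\<in>set es. Suc i < n) \<and> word_perm es = x \<and> length es \<le> card (inversions n x)"
  using assms
proof (induction "card (inversions n x)" arbitrary: x rule: less_induct)
  case less
  show ?case
  proof (cases "x = id")
    case True then show ?thesis by (intro exI[of _ "[]"]) simp
  next
    case False
    define z where "z = inv_into UNIV x"
    have inv: "z permutes {..<n}" unfolding z_def using less.prems by (rule permutes_inv)
    have xi: "x (z i) = i" and zx: "z (x i) = i" for i unfolding z_def using less.prems by (simp_all add: permutes_inverses)
    have "\<exists>i. Suc i < n \<and> z (Suc i) < z i"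
    proof (rule ccontr)
      assume "\<nexists>i. Suc i < n \<and> z (Suc i) < z i"
      then have mono: "z i < z (Suc i)" if "Suc i < n" for i
        using that permutes_inj[OF inv] by (metis injD linorder_neqE_nat n_not_Suc_n)
      have "i \<le> z i" if "i < n" for i using that
        by (induction i) (use mono in \<open>force intro: less_le_trans Suc_leI le_less_trans\<close>)+
      then have "z = id" using permutes_natset_ge[OF inv] by auto
      then show False using False xi by (auto simp: fun_eq_iff)
    qed
    then obtain i where i: "Suc i < n" "z (Suc i) < z i" by blast
    let ?y = "transpose i (Suc i) \<circ> x"
    have y: "?y permutes {..<n}" using i(1) less.prems by (intro permutes_compose permutes_swap_id) auto
    let ?p = "(z (Suc i), z i)"
    have "z i < n" using permutes_in_image[OF inv, of i] i(1) by simp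
    then have p: "?p \<in> inversions n x" using i by (simp add: inversions_def xi)
    have "inversions n ?y \<subseteq> inversions n x - {?p}"
    proof
      fix r assume "r \<in> inversions n ?y"
      then obtain a b where r: "r = (a, b)" "a < b" "b < n" "transpose i (Suc i) (x b) < transpose i (Suc i) (x a)"
        by (auto simp: inversions_def)
      then have "x a \<noteq> x b" by auto
      then have ab: "x b < x a \<and> \<not> (x b = i \<and> x a = Suc i) \<or> x a = i \<and> x b = Suc i"
        using r(4) by (auto simp: transpose_Suc_less split: if_splits)
      have "\<not> (x a = i \<and> x b = Suc i)"
        using i r(2) zx by (metis less_asym)
      with ab r show "r \<in> inversions n x - {?p}" by (auto simp: inversions_def xi)
    qed
    then have "card (inversions n ?y) \<le> card (inversions n x - {?p})" by (intro card_mono) auto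
    also have "\<dots> < card (inversions n x)" using p by (intro psubset_card_mono) auto
    finally have c: "card (inversions n ?y) < card (inversions n x)" .
    from less.hyps[OF this y] obtain es where
      "\<forall>i\<in>set es. Suc i < n" "word_perm es = ?y" "length es \<le> card (inversions n ?y)" by blast
    moreover have "transpose i (Suc i) \<circ> ?y = x" by (simp add: fun_eq_iff)
    ultimately show ?thesis using i(1) c by (intro exI[of _ "i # es"]) auto
  qed
qed

lemma reduced_expression_some:
  assumes "x permutes {..<n}"
  shows "reduced_expression n x (SOME es. reduced_expression n x es)"
    "length (SOME es. reduced_expression n x es) = card (inversions n x)"
proof -
  obtain es where es: "\<forall>i\<in>set es. Suc i < n" "word_perm es = x" "length es \<le> card (inversions n x)"
    using exists_short_expression[OF assms] by blast
  have le: "card (inversions n x) \<le> length js" if "\<forall>j\<in>set js. Suc j < n" "word_perm js = x" for js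
    using card_inversions_le_length[OF that(1)] that(2) by simp
  have "reduced_expression n x es"
    unfolding reduced_expression_def using es le order_trans[OF es(3)] by blast
  then show 1: "reduced_expression n x (SOME es. reduced_expression n x es)" by (rule someI)
  then have "card (inversions n x) \<le> length (SOME es. reduced_expression n x es)"
    "length (SOME es. reduced_expression n x es) \<le> length es"
    using es(1,2) le unfolding reduced_expression_def by blast+
  with es(3) show "length (SOME es. reduced_expression n x es) = card (inversions n x)" by linarith
qed

section \<open>The quantum symmetrizer as a sum of quantum shuffles\<close>

lemma qshuffle_letter:
  "qshuffle q 1 (word_fun [c]) g w = (\<Sum>j | j < length w \<and> w ! j = c. q ^ j * g (take j w @ drop (Suc j) w))"
proof (induction w arbitrary: g)
  case (Cons d w)
  have eq: "{j. j < length (d # w) \<and> (d # w) ! j = c}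
     = (if d = c then {0} else {}) \<union> Suc ` {j. j < length w \<and> w ! j = c}"
    by (auto simp: image_iff less_Suc_eq_0_disj nth_Cons')
  have "(\<Sum>j | j < length (d # w) \<and> (d # w) ! j = c. q ^ j * g (take j (d # w) @ drop (Suc j) (d # w)))
    = (if d = c then g w else 0) + (\<Sum>j | j < length w \<and> w ! j = c. q ^ Suc j * left_quotient d g (take j w @ drop (Suc j) w))"
    unfolding eq by (subst sum.union_disjoint) (auto simp: sum.reindex left_quotient_def)
  then show ?case
    using Cons[of "left_quotient d g"] by (simp add: left_quotient_word_fun sum_distrib_left mult.assoc)
qed (simp add: word_fun_def)

text \<open>
  Summing over the first entry of the permutation is the recursion \<open>qshuffle_letter\<close>: the entry \<open>js ! j\<close> is
  preceded by \<open>j\<close> smaller indices, each of which forms an inversion with it.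
\<close>

lemma sum_permutations_list:
  "sorted_wrt (<) js \<Longrightarrow>
    (\<Sum>xs\<in>permutations_of_set (set js). q ^ list_inv xs * (if map v xs = u then 1 else 0)) = letter_product q u (map v js)"
proof (induction u arbitrary: js)
  case Nil
  show ?case
  proof (cases "js = []")
    case False
    then have "set js \<noteq> {}" by simp
    then have "[] \<notin> permutations_of_set (set js)" by (auto simp: permutations_of_set_def)
    then show ?thesis using False by (auto simp: word_fun_def intro!: sum.neutral)
  qed (simp add: word_fun_def)
next
  case (Cons c u)
  show ?case
  proof (cases "js = []")
    case False
    let ?A = "set js"
    have d: "distinct js" using Cons.prems strict_sorted_iff by blast
    have "(\<Sum>xs\<in>permutations_of_set ?A. q ^ list_inv xs * (if map v xs = c # u then 1 else 0))
      = (\<Sum>x\<in>?A. \<Sum>xs\<in>(#) x ` permutations_of_set (?A - {x}). q ^ list_inv xs * (if map v xs = c # u then 1 else 0))"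
      using False by (subst permutations_of_set_nonempty, simp, intro sum.UNION_disjoint) auto
    also have "\<dots> = (\<Sum>x\<in>?A. if v x = c then q ^ card {y \<in> ?A - {x}. y < x} *
        (\<Sum>xs\<in>permutations_of_set (?A - {x}). q ^ list_inv xs * (if map v xs = u then 1 else 0)) else 0)"
    proof (intro sum.cong refl)
      fix x assume "x \<in> ?A"
      have "(\<Sum>xs\<in>(#) x ` permutations_of_set (?A - {x}). q ^ list_inv xs * (if map v xs = c # u then 1 else 0))
        = (\<Sum>xs\<in>permutations_of_set (?A - {x}). q ^ list_inv (x # xs) * (if map v (x # xs) = c # u then 1 else 0))"
        by (subst sum.reindex) auto
      also have "\<dots> = (\<Sum>xs\<in>permutations_of_set (?A - {x}). q ^ card {y \<in> ?A - {x}. y < x} * (q ^ list_inv xs * (if map v (x # xs) = c # u then 1 else 0)))"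
        by (intro sum.cong refl) (simp add: permutations_of_setD power_add mult.assoc)
      finally show "(\<Sum>xs\<in>(#) x ` permutations_of_set (?A - {x}). q ^ list_inv xs * (if map v xs = c # u then 1 else 0)) =
        (if v x = c then q ^ card {y \<in> ?A - {x}. y < x} *
          (\<Sum>xs\<in>permutations_of_set (?A - {x}). q ^ list_inv xs * (if map v xs = u then 1 else 0)) else 0)"
        by (simp add: sum_distrib_left)
    qed
    also have "\<dots> = (\<Sum>j<length js. if v (js ! j) = c then q ^ j * letter_product q u (take j (map v js) @ drop (Suc j) (map v js)) else 0)"
    proof (rule sum.reindex_bij_betw[OF bij_betw_nth[OF d refl refl], symmetric, THEN trans], intro sum.cong refl)
      fix j assume "j \<in> {..<length js}"
      then have j: "j < length js" by simp
      let ?js = "take j js @ drop (Suc j) js"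
      have js: "js = take j js @ js ! j # drop (Suc j) js" using j by (rule id_take_nth_drop)
      have s: "sorted_wrt (<) (take j js @ js ! j # drop (Suc j) js)" using js Cons.prems by simp
      then have s': "sorted_wrt (<) ?js" by (auto simp: sorted_wrt_append)
      have set: "set js - {js ! j} = set ?js" 
        using s by (subst js) (auto simp: sorted_wrt_append)
      have "{y \<in> set js - {js ! j}. y < js ! j} = set (take j js)"
        unfolding set using s by (auto simp: sorted_wrt_append)
      moreover have "card (set (take j js)) = j" using d j by (simp add: distinct_card)
      ultimately show "(if v (js ! j) = c then q ^ card {y \<in> set js - {js ! j}. y < js ! j} *
          (\<Sum>xs\<in>permutations_of_set (set js - {js ! j}). q ^ list_inv xs * (if map v xs = u then 1 else 0)) else 0)
        = (if v (js ! j) = c then q ^ j * letter_product q u (take j (map v js) @ drop (Suc j) (map v js)) else 0)"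
        using Cons.IH[OF s'] by (simp add: set take_map drop_map)
    qed
    also have "\<dots> = letter_product q (c # u) (map v js)"
      unfolding letter_product.simps qshuffle_letter
      by (subst sum.inter_filter[symmetric]) (auto intro!: sum.cong simp: sum.inter_filter)
    finally show ?thesis .
  qed (simp add: word_fun_def)
qed

text \<open>
  On a space where the braiding is \<open>q\<close> times the flip, the left side is the coefficient of \<open>w\<close> in the quantum
  symmetrizer of the word \<open>u\<close>.
\<close>

lemma sum_permutes:
  assumes "length w = n"
  shows "(\<Sum>x | x permutes {..<n}. q ^ card (inversions n x) * (if map (\<lambda>j. w ! x j) [0..<n] = u then 1 else 0)) = letter_product q u w"
proof -
  have bij: "bij_betw (\<lambda>x. map x [0..<n]) {x. x permutes {..<n}} (permutations_of_set {..<n})"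
    unfolding bij_betw_def
  proof (intro conjI inj_onI equalityI subsetI)
    fix x y :: "nat \<Rightarrow> nat" assume xy: "x \<in> {x. x permutes {..<n}}" "y \<in> {x. x permutes {..<n}}" "map x [0..<n] = map y [0..<n]"
    then have "x i = y i" if "i < n" for i using that by simp
    moreover have "x i = y i" if "\<not> i < n" for i using xy(1,2) that by (simp add: permutes_not_in)
    ultimately show "x = y" by blast
  next
    fix xs assume "xs \<in> (\<lambda>x. map x [0..<n]) ` {x. x permutes {..<n}}"
    then obtain x where x: "x permutes {..<n}" "xs = map x [0..<n]" by blast
    have "set xs = {..<n}" using permutes_image[OF x(1)] by (simp add: x(2) lessThan_atLeast0)
    moreover have "distinct xs" using permutes_inj_on[OF x(1)] by (simp add: x(2) distinct_map)
    ultimately show "xs \<in> permutations_of_set {..<n}" by (simp add: permutations_of_set_def)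
  next
    fix xs assume "xs \<in> permutations_of_set {..<n}"
    then have xs: "set xs = {..<n}" "distinct xs" by (auto simp: permutations_of_set_def)
    then have l: "length xs = n" using distinct_card by fastforce
    let ?x = "\<lambda>i. if i < n then xs ! i else i"
    have "bij_betw ((!) xs) {..<n} {..<n}" using xs l by (intro bij_betw_nth) auto
    then have "bij_betw ?x {..<n} {..<n}" by (subst bij_betw_cong[of _ _ "(!) xs"]) auto
    then have "?x permutes {..<n}" by (rule bij_imp_permutes) auto
    moreover have "map ?x [0..<n] = xs" using l by (intro nth_equalityI) auto
    ultimately show "xs \<in> (\<lambda>x. map x [0..<n]) ` {x. x permutes {..<n}}" by (intro image_eqI[where x = ?x]) simp_all
  qed
  have "(\<Sum>x | x permutes {..<n}. q ^ card (inversions n x) * (if map (\<lambda>j. w ! x j) [0..<n] = u then 1 else 0))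
    = (\<Sum>x | x permutes {..<n}. q ^ list_inv (map x [0..<n]) * (if map ((!) w) (map x [0..<n]) = u then 1 else 0))"
    by (intro sum.cong refl) (auto simp: list_inv_map_upt permutes_inj_on comp_def)
  also have "\<dots> = (\<Sum>xs\<in>permutations_of_set (set [0..<n]). q ^ list_inv xs * (if map ((!) w) xs = u then 1 else 0))"
    using sum.reindex_bij_betw[OF bij, of "\<lambda>xs. q ^ list_inv xs * (if map ((!) w) xs = u then 1 else 0)"]
    by (simp add: lessThan_atLeast0)
  also have "\<dots> = letter_product q u (map ((!) w) [0..<n])"
    by (rule sum_permutations_list) (simp add: strict_sorted_iff)
  finally show ?thesis using assms map_nth[of w] by simp
qed

section \<open>The braid action respects multilinearity\<close>

lemma vector_space_times: "vector_space ((*) :: 'k::field \<Rightarrow> 'k \<Rightarrow> 'k)"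
  by unfold_locales (auto simp: algebra_simps)

interpretation pm: vector_space "pm_scale (*) :: 'k::field \<Rightarrow> ('a \<Rightarrow>\<^sub>0 'k) \<Rightarrow> 'a \<Rightarrow>\<^sub>0 'k"
  by (rule vector_space_pm_scale[OF vector_space_times])

lemma lookup_pm_times [simp]:
  fixes f :: "'a \<Rightarrow>\<^sub>0 'k::field"
  shows "Poly_Mapping.lookup (pm_scale (*) a f) x = a * Poly_Mapping.lookup f x"
  by (rule lookup_pm_scale) simp

lemma pm_times_single:
  fixes a b :: "'k::field"
  shows "pm_scale (*) a (Poly_Mapping.single x b) = Poly_Mapping.single x (a * b)"
  by (rule pm_scale_single) simp

definition lin_eval :: "('x \<Rightarrow> 'k::field) \<Rightarrow> ('x \<Rightarrow>\<^sub>0 'k) \<Rightarrow> 'k" where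
  "lin_eval h f = (\<Sum>x\<in>Poly_Mapping.keys f. Poly_Mapping.lookup f x * h x)"

lemma lin_eval_single: "lin_eval h (Poly_Mapping.single x a) = a * h x"
  by (cases "a = 0") (simp_all add: lin_eval_def)

lemma lin_eval_add: "lin_eval h (f + f') = lin_eval h f + lin_eval h f'"
  unfolding lin_eval_def by (rule setsum_keys_plus_distrib) (simp_all add: algebra_simps)

lemma lin_eval_zero [simp]: "lin_eval h 0 = 0"
  by (simp add: lin_eval_def)

lemma lin_eval_diff: "lin_eval h (f - f') = lin_eval h f - lin_eval h f'"
  using lin_eval_add[of h "f - f'" f'] by simp

lemma lin_eval_sum: "lin_eval h (\<Sum>i\<in>I. f i) = (\<Sum>i\<in>I. lin_eval h (f i))"
  by (induction I rule: infinite_finite_induct) (simp_all add: lin_eval_add)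

lemma lin_eval_scale: "lin_eval h (pm_scale (*) a f) = a * lin_eval h f"
  by (rule poly_mapping_hom_eqI[where f = f])
    (simp_all add: lin_eval_add pm.scale_right_distrib pm_times_single lin_eval_single algebra_simps)

lemma lin_eval_span_zero:
  assumes "f \<in> pm_span (*) S" "\<And>s. s \<in> S \<Longrightarrow> lin_eval h s = 0"
  shows "lin_eval h f = 0"
  using assms(1) unfolding pm_span_def
  by (induction rule: pm.span_induct_alt) (simp_all add: lin_eval_add lin_eval_scale assms(2))

lemma lin_ext_single: "lin_ext \<phi> (Poly_Mapping.single x a) = pm_scale (*) a (\<phi> x)"
  by (cases "a = 0") (simp_all add: lin_ext_def)

lemma lin_ext_add: "lin_ext \<phi> (f + f') = lin_ext \<phi> f + lin_ext \<phi> f'"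
  unfolding lin_ext_def by (rule setsum_keys_plus_distrib) (simp_all add: pm.scale_left_distrib)

lemma lin_ext_scale: "lin_ext \<phi> (pm_scale (*) a f) = pm_scale (*) a (lin_ext \<phi> f)"
  by (rule poly_mapping_hom_eqI[where f = f])
    (simp_all add: lin_ext_add pm.scale_right_distrib pm_times_single lin_ext_single)

lemma lin_ext_zero [simp]: "lin_ext \<phi> 0 = 0"
  by (simp add: lin_ext_def)

lemma lin_ext_sum: "lin_ext \<phi> (\<Sum>i\<in>I. f i) = (\<Sum>i\<in>I. lin_ext \<phi> (f i))"
  by (induction I rule: infinite_finite_induct) (simp_all add: lin_ext_add)

lemma lin_eval_lin_ext: "lin_eval h (lin_ext \<phi> f) = (\<Sum>x\<in>Poly_Mapping.keys f. Poly_Mapping.lookup f x * lin_eval h (\<phi> x))"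
  by (simp add: lin_ext_def lin_eval_sum lin_eval_scale)

lemma keys_lin_ext: "Poly_Mapping.keys (lin_ext \<phi> f) \<subseteq> (\<Union>x\<in>Poly_Mapping.keys f. Poly_Mapping.keys (\<phi> x))"
proof -
  have "Poly_Mapping.keys (lin_ext \<phi> f) \<subseteq> (\<Union>x\<in>Poly_Mapping.keys f. Poly_Mapping.keys (pm_scale (*) (Poly_Mapping.lookup f x) (\<phi> x)))"
    unfolding lin_ext_def by (rule keys_sum)
  also have "\<dots> \<subseteq> (\<Union>x\<in>Poly_Mapping.keys f. Poly_Mapping.keys (\<phi> x))"
    by (intro UN_mono order_refl) (auto simp: in_keys_iff)
  finally show ?thesis .
qed

definition linear_op :: "('k, 'v, 'z) module_scheme \<Rightarrow> ('v \<Rightarrow> 'v) \<Rightarrow> bool" where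
  "linear_op V A \<longleftrightarrow> (\<forall>u\<in>carrier V. A u \<in> carrier V)
     \<and> (\<forall>u\<in>carrier V. \<forall>v\<in>carrier V. A (u \<oplus>\<^bsub>V\<^esub> v) = A u \<oplus>\<^bsub>V\<^esub> A v)
     \<and> (\<forall>a. \<forall>u\<in>carrier V. A (a \<odot>\<^bsub>V\<^esub> u) = a \<odot>\<^bsub>V\<^esub> A u)"

text \<open>
  One summand of the action of \<open>\<sigma>\<^sub>i\<close> on a word: the component of the \<open>i\<close>-th letter in degree \<open>h\<close> is moved behind the
  next letter, on which \<open>h\<close> acts.
\<close>

definition crossing :: "('k, 'v, 'g, 'z) yd_module_scheme \<Rightarrow> 'g \<Rightarrow> nat \<Rightarrow> 'v list \<Rightarrow> 'v list" where
  "crossing V h i l = take i l @ [act V h (l ! Suc i), coact V (l ! i) h] @ drop (i + 2) l"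

lemma length_crossing: "Suc i < length l \<Longrightarrow> length (crossing V h i l) = length l"
  by (simp add: crossing_def)

lemma sigma_yd_braiding:
  "sigma (yd_braiding \<Gamma> V) i = lin_ext (\<lambda>l. \<Sum>h\<in>carrier \<Gamma>. Poly_Mapping.single (crossing V h i l) 1)"
  unfolding sigma_def yd_braiding_def crossing_def by (simp add: lin_ext_sum lin_ext_single)

text \<open>
  The generators of the multilinear relations have to be sorted by length, because \<open>\<sigma>\<^sub>i\<close> makes sense only on
  words with more than \<open>i + 1\<close> letters.
\<close>

definition rel_gens :: "('k, 'v, 'z) module_scheme \<Rightarrow> nat \<Rightarrow> ('v list \<Rightarrow>\<^sub>0 'k::field) set" where
  "rel_gens V n =
     ({Poly_Mapping.single (xs @ [u \<oplus>\<^bsub>V\<^esub> v] @ ys) 1 - Poly_Mapping.single (xs @ [u] @ ys) 1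
         - Poly_Mapping.single (xs @ [v] @ ys) 1 | xs ys u v.
         xs \<in> lists (carrier V) \<and> ys \<in> lists (carrier V) \<and> u \<in> carrier V \<and> v \<in> carrier V
         \<and> length xs + Suc (length ys) = n} \<union>
      {Poly_Mapping.single (xs @ [a \<odot>\<^bsub>V\<^esub> u] @ ys) 1 - Poly_Mapping.single (xs @ [u] @ ys) a | xs ys a u.
         xs \<in> lists (carrier V) \<and> ys \<in> lists (carrier V) \<and> u \<in> carrier V
         \<and> length xs + Suc (length ys) = n})"

lemma pm_span_mono: "S \<subseteq> S' \<Longrightarrow> pm_span (*) S \<subseteq> pm_span (*) S'"
  unfolding pm_span_def by (rule pm.span_mono)

lemma rel_gens_add: 
  assumes "xs \<in> lists (carrier V)" "ys \<in> lists (carrier V)" "u \<in> carrier V" "v \<in> carrier V"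
    "length xs + Suc (length ys) = n"
  shows "Poly_Mapping.single (xs @ [u \<oplus>\<^bsub>V\<^esub> v] @ ys) 1 - Poly_Mapping.single (xs @ [u] @ ys) 1
         - Poly_Mapping.single (xs @ [v] @ ys) 1 \<in> rel_gens V n"
  using assms unfolding rel_gens_def by blast

lemma rel_gens_smult:
  assumes "xs \<in> lists (carrier V)" "ys \<in> lists (carrier V)" "u \<in> carrier V"
    "length xs + Suc (length ys) = n"
  shows "Poly_Mapping.single (xs @ [a \<odot>\<^bsub>V\<^esub> u] @ ys) 1 - Poly_Mapping.single (xs @ [u] @ ys) a \<in> rel_gens V n"
  using assms unfolding rel_gens_def by blast

lemma multilinear_rels_eq: "multilinear_rels V = pm_span (*) (\<Union>n. rel_gens V n)"
  unfolding multilinear_rels_def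
proof (intro arg_cong[where f = "pm_span (*)"] equalityI subsetI, goal_cases)
  case (1 s)
  then show ?case
  proof (elim UnE CollectE exE conjE, goal_cases)
    case (1 xs ys u v)
    then show ?case using rel_gens_add[OF _ _ _ _ refl, of xs V ys u v] by blast
  next
    case (2 xs ys a u)
    then show ?case using rel_gens_smult[OF _ _ _ refl, of xs V ys u a] by blast
  qed
next
  case (2 s)
  then obtain n where "s \<in> rel_gens V n" by blast
  then show ?case unfolding rel_gens_def by blast
qed

locale linear_yd =
  fixes \<Gamma> :: "('g, 'a) monoid_scheme" and V :: "('k::field, 'v, 'g, 'z) yd_module_scheme"
  assumes act_linear: "h \<in> carrier \<Gamma> \<Longrightarrow> linear_op V (act V h)"
    and coact_linear: "h \<in> carrier \<Gamma> \<Longrightarrow> linear_op V (\<lambda>v. coact V v h)"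
begin

abbreviation "braiding \<equiv> yd_braiding \<Gamma> V"

lemma crossing_lists:
  assumes "h \<in> carrier \<Gamma>" "l \<in> lists (carrier V)" "Suc i < length l"
  shows "crossing V h i l \<in> lists (carrier V)"
proof -
  have "l ! i \<in> carrier V" "l ! Suc i \<in> carrier V" using assms by (auto simp: lists_eq_set)
  moreover have "set (take i l) \<subseteq> carrier V" "set (drop (i + 2) l) \<subseteq> carrier V"
    using assms(2) set_take_subset[of i l] set_drop_subset[of "i + 2" l] by (auto simp: lists_eq_set)
  ultimately show ?thesis
    using act_linear[OF assms(1)] coact_linear[OF assms(1)]
    by (auto simp: crossing_def linear_op_def lists_eq_set)
qed

text \<open>
  As a function of one letter, \<open>crossing\<close> is a linear map placed in one slot of a fixed word. Hence it maps
  generators of the multilinear relations to generators.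
\<close>

lemma crossing_slot:
  assumes h: "h \<in> carrier \<Gamma>" and xs: "xs \<in> lists (carrier V)" and ys: "ys \<in> lists (carrier V)"
    and i: "Suc i < length xs + Suc (length ys)"
  obtains A xs' ys' where "linear_op V A" "xs' \<in> lists (carrier V)" "ys' \<in> lists (carrier V)"
    "length xs' + Suc (length ys') = length xs + Suc (length ys)"
    "\<And>u. crossing V h i (xs @ [u] @ ys) = xs' @ [A u] @ ys'"
proof -
  have id: "linear_op V (\<lambda>u. u)" by (simp add: linear_op_def)
  consider "length xs < i" | "length xs = i" | "length xs = Suc i" | "length xs > Suc i" by linarith
  then show thesis
  proof cases
    case 1
    then obtain k where k: "i = Suc (length xs + k)" by (metis less_iff_Suc_add)
    then have "Suc k < length ys" using i by simp
    then show thesis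
      using k by (intro that[OF id xs crossing_lists[OF h ys, of k]]) (auto simp: length_crossing crossing_def nth_append numeral_2_eq_2 numeral_3_eq_3)
  next
    case 2
    then obtain y ys' where y: "ys = y # ys'" using i by (cases ys) auto
    then have "xs @ [act V h y] \<in> lists (carrier V)" "ys' \<in> lists (carrier V)"
      using xs ys act_linear[OF h] by (auto simp: linear_op_def)
    then show thesis
      using 2 y by (intro that[OF coact_linear[OF h], of "xs @ [act V h y]" ys']) (auto simp: crossing_def nth_append)
  next
    case 3
    then obtain xs' x where x: "xs = xs' @ [x]" by (cases xs rule: rev_cases) auto
    then have "coact V x h # ys \<in> lists (carrier V)" "xs' \<in> lists (carrier V)"
      using xs ys coact_linear[OF h] by (auto simp: linear_op_def)
    then show thesis
      using 3 x by (intro that[OF act_linear[OF h]]) (auto simp: crossing_def nth_append)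
  next
    case 4
    then show thesis
      by (intro that[OF id crossing_lists[OF h xs] ys]) (auto simp: length_crossing crossing_def nth_append)
  qed
qed

lemma sigma_add: "sigma braiding i (f + f') = sigma braiding i f + sigma braiding i f'"
  unfolding sigma_yd_braiding by (rule lin_ext_add)

lemma sigma_scale: "sigma braiding i (pm_scale (*) a f) = pm_scale (*) a (sigma braiding i f)"
  unfolding sigma_yd_braiding by (rule lin_ext_scale)

lemma sigma_single: "sigma braiding i (Poly_Mapping.single l a) = (\<Sum>h\<in>carrier \<Gamma>. Poly_Mapping.single (crossing V h i l) a)"
  unfolding sigma_yd_braiding by (simp add: lin_ext_single pm.scale_sum_right pm_times_single)

lemma sigma_rel_gens:
  assumes i: "Suc i < n" and s: "s \<in> rel_gens V n"
  shows "sigma braiding i s \<in> pm_span (*) (rel_gens V n)"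
proof -
  interpret L: additive "sigma braiding i" by unfold_locales (rule sigma_add)
  consider (add) xs ys u v where
      "s = Poly_Mapping.single (xs @ [u \<oplus>\<^bsub>V\<^esub> v] @ ys) 1 - Poly_Mapping.single (xs @ [u] @ ys) 1 - Poly_Mapping.single (xs @ [v] @ ys) 1"
      "xs \<in> lists (carrier V)" "ys \<in> lists (carrier V)" "u \<in> carrier V" "v \<in> carrier V" "length xs + Suc (length ys) = n"
    | (smult) xs ys a u where
      "s = Poly_Mapping.single (xs @ [a \<odot>\<^bsub>V\<^esub> u] @ ys) 1 - Poly_Mapping.single (xs @ [u] @ ys) a"
      "xs \<in> lists (carrier V)" "ys \<in> lists (carrier V)" "u \<in> carrier V" "length xs + Suc (length ys) = n"
    using s unfolding rel_gens_def by blast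
  then show ?thesis
  proof cases
    case add
    have "Poly_Mapping.single (crossing V h i (xs @ [u \<oplus>\<^bsub>V\<^esub> v] @ ys)) 1 - Poly_Mapping.single (crossing V h i (xs @ [u] @ ys)) 1
        - Poly_Mapping.single (crossing V h i (xs @ [v] @ ys)) 1 \<in> rel_gens V n" if h: "h \<in> carrier \<Gamma>" for h
    proof -
      obtain A xs' ys' where A: "linear_op V A" "xs' \<in> lists (carrier V)" "ys' \<in> lists (carrier V)"
        "length xs' + Suc (length ys') = n" "\<And>u. crossing V h i (xs @ [u] @ ys) = xs' @ [A u] @ ys'"
        using crossing_slot[OF h add(2,3)] i add(6) by metis
      then show ?thesis
        unfolding A(5) using rel_gens_add[OF A(2,3) _ _ A(4), of "A u" "A v"] add(4,5) by (simp add: linear_op_def)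
    qed
    then have "(\<Sum>h\<in>carrier \<Gamma>. Poly_Mapping.single (crossing V h i (xs @ [u \<oplus>\<^bsub>V\<^esub> v] @ ys)) 1 - Poly_Mapping.single (crossing V h i (xs @ [u] @ ys)) 1
        - Poly_Mapping.single (crossing V h i (xs @ [v] @ ys)) 1) \<in> pm_span (*) (rel_gens V n)"
      unfolding pm_span_def by (intro pm.span_sum pm.span_base)
    then show ?thesis by (simp add: add(1) L.diff sigma_single sum_subtractf)
  next
    case smult
    have "Poly_Mapping.single (crossing V h i (xs @ [a \<odot>\<^bsub>V\<^esub> u] @ ys)) 1 - Poly_Mapping.single (crossing V h i (xs @ [u] @ ys)) a
        \<in> rel_gens V n" if h: "h \<in> carrier \<Gamma>" for h
    proof -
      obtain A xs' ys' where A: "linear_op V A" "xs' \<in> lists (carrier V)" "ys' \<in> lists (carrier V)"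
        "length xs' + Suc (length ys') = n" "\<And>u. crossing V h i (xs @ [u] @ ys) = xs' @ [A u] @ ys'"
        using crossing_slot[OF h smult(2,3)] i smult(5) by metis
      then show ?thesis
        unfolding A(5) using rel_gens_smult[OF A(2,3) _ A(4), of "A u" a] smult(4) by (simp add: linear_op_def)
    qed
    then have "(\<Sum>h\<in>carrier \<Gamma>. Poly_Mapping.single (crossing V h i (xs @ [a \<odot>\<^bsub>V\<^esub> u] @ ys)) 1 - Poly_Mapping.single (crossing V h i (xs @ [u] @ ys)) a)
        \<in> pm_span (*) (rel_gens V n)"
      unfolding pm_span_def by (intro pm.span_sum pm.span_base)
    then show ?thesis by (simp add: smult(1) L.diff sigma_single sum_subtractf)
  qed
qed

lemma sigma_rels: "Suc i < n \<Longrightarrow> r \<in> pm_span (*) (rel_gens V n) \<Longrightarrow> sigma braiding i r \<in> pm_span (*) (rel_gens V n)"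
  by (rule pm_span_map_closed[OF vector_space_times]) (auto simp: sigma_rel_gens sigma_add sigma_scale)

abbreviation "braid_word es \<equiv> foldr (\<lambda>i \<phi>. sigma braiding i \<circ> \<phi>) es id"

lemma braid_word_linear:
  "braid_word es (f + f') = braid_word es f + braid_word es f'"
  "braid_word es (pm_scale (*) a f) = pm_scale (*) a (braid_word es f)"
  by (induction es) (simp_all add: sigma_add sigma_scale)

lemma braid_word_rels:
  "\<forall>i\<in>set es. Suc i < n \<Longrightarrow> r \<in> pm_span (*) (rel_gens V n) \<Longrightarrow> braid_word es r \<in> pm_span (*) (rel_gens V n)"
  by (induction es) (simp_all add: sigma_rels)

lemma quantum_sym_linear:
  "quantum_sym braiding n (f + f') = quantum_sym braiding n f + quantum_sym braiding n f'"
  "quantum_sym braiding n (pm_scale (*) a f) = pm_scale (*) a (quantum_sym braiding n f)"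
  unfolding quantum_sym_def braid_section_def
  by (simp_all add: braid_word_linear sum.distrib pm.scale_sum_right)

lemma total_quantum_sym_single:
  "total_quantum_sym braiding (Poly_Mapping.single l a) = quantum_sym braiding (length l) (Poly_Mapping.single l a)"
  unfolding total_quantum_sym_def lin_ext_single quantum_sym_linear(2)[symmetric] by (simp add: pm_times_single)

lemma total_quantum_sym_linear:
  "total_quantum_sym braiding (f + f') = total_quantum_sym braiding f + total_quantum_sym braiding f'"
  "total_quantum_sym braiding (pm_scale (*) a f) = pm_scale (*) a (total_quantum_sym braiding f)"
  unfolding total_quantum_sym_def by (rule lin_ext_add lin_ext_scale)+

end

context linear_yd
begin

lemma quantum_sym_diff: "quantum_sym braiding n (f - f') = quantum_sym braiding n f - quantum_sym braiding n f'"
  using quantum_sym_linear(1)[of n "f - f'" f'] by simp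

lemma quantum_sym_rels:
  assumes "r \<in> pm_span (*) (rel_gens V n)"
  shows "quantum_sym braiding n r \<in> pm_span (*) (rel_gens V n)"
  unfolding quantum_sym_def braid_section_def pm_span_def
proof (intro pm.span_sum)
  fix x assume "x \<in> {x. x permutes {..<n}}"
  then have "reduced_expression n x (SOME es. reduced_expression n x es)"
    using reduced_expression_some(1) by blast
  then show "braid_word (SOME es. reduced_expression n x es) r \<in> pm.span (rel_gens V n)"
    using braid_word_rels[of _ n r] assms unfolding reduced_expression_def pm_span_def by blast
qed

lemma total_quantum_sym_rels:
  assumes "r \<in> multilinear_rels V"
  shows "total_quantum_sym braiding r \<in> multilinear_rels V"
  using assms unfolding multilinear_rels_eq
proof (rule pm_span_map_closed[OF vector_space_times])
  interpret L: additive "total_quantum_sym braiding" by unfold_locales (rule total_quantum_sym_linear)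
  fix s assume "s \<in> (\<Union>n. rel_gens V n)"
  then obtain n where s: "s \<in> rel_gens V n" by blast
  have "total_quantum_sym braiding s = quantum_sym braiding n s"
    using s unfolding rel_gens_def by (auto simp: L.diff quantum_sym_diff total_quantum_sym_single)
  also have "\<dots> \<in> pm_span (*) (rel_gens V n)"
    using s by (intro quantum_sym_rels) (simp add: pm_span_def pm.span_base)
  also have "\<dots> \<subseteq> pm_span (*) (\<Union>n. rel_gens V n)" by (rule pm_span_mono) blast
  finally show "total_quantum_sym braiding s \<in> pm_span (*) (\<Union>n. rel_gens V n)" .
qed (rule total_quantum_sym_linear)+

end

section \<open>Coordinates on a subspace with scalar braiding\<close>

text \<open>
  The tensor product of the linear forms \<open>\<phi> a\<close>, where \<open>a\<close> runs through the letters of \<open>w\<close>.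
\<close>

fun word_coord :: "(nat \<Rightarrow> 'v \<Rightarrow> 'k::field) \<Rightarrow> nat list \<Rightarrow> 'v list \<Rightarrow> 'k" where
  "word_coord \<phi> [] [] = 1"
| "word_coord \<phi> (a # w) (v # l) = \<phi> a v * word_coord \<phi> w l"
| "word_coord \<phi> _ _ = 0"

lemma word_coord_length: "length w \<noteq> length l \<Longrightarrow> word_coord \<phi> w l = 0"
  by (induction \<phi> w l rule: word_coord.induct) auto

lemma word_coord_eq_prod: "length w = length l \<Longrightarrow> word_coord \<phi> w l = (\<Prod>j<length l. \<phi> (w ! j) (l ! j))"
proof (induction \<phi> w l rule: word_coord.induct)
  case (2 \<phi> a w v l)
  then show ?case by (simp only: length_Cons prod.lessThan_Suc_shift) simp
qed auto

lemma word_coord_slot: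
  assumes "length w = length xs + Suc (length ys)"
  shows "word_coord \<phi> w (xs @ [u] @ ys) = word_coord \<phi> (take (length xs) w) xs * \<phi> (w ! length xs) u * word_coord \<phi> (drop (Suc (length xs)) w) ys"
  using assms
proof (induction xs arbitrary: w)
  case Nil
  then show ?case by (cases w) auto
next
  case (Cons x xs)
  then show ?case by (cases w) auto
qed

definition linear_form :: "('k::field, 'v, 'z) module_scheme \<Rightarrow> ('v \<Rightarrow> 'k) \<Rightarrow> bool" where
  "linear_form V \<phi> \<longleftrightarrow> (\<forall>u\<in>carrier V. \<forall>v\<in>carrier V. \<phi> (u \<oplus>\<^bsub>V\<^esub> v) = \<phi> u + \<phi> v)
     \<and> (\<forall>a. \<forall>u\<in>carrier V. \<phi> (a \<odot>\<^bsub>V\<^esub> u) = a * \<phi> u)"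

lemma word_coord_rels:
  assumes "\<And>a. linear_form V (\<phi> a)" "r \<in> multilinear_rels V"
  shows "lin_eval (word_coord \<phi> w) r = 0"
  using assms(2) unfolding multilinear_rels_eq
proof (rule lin_eval_span_zero)
  fix s :: "'a list \<Rightarrow>\<^sub>0 'b" assume "s \<in> (\<Union>n. rel_gens V n)"
  then obtain n where s: "s \<in> rel_gens V n" by blast
  show "lin_eval (word_coord \<phi> w) s = 0"
  proof (cases "length w = n")
    case True
    show ?thesis
      using s unfolding rel_gens_def
    proof (elim UnE CollectE exE conjE, goal_cases)
      case (1 xs ys u v)
      then show ?case
        using assms(1) True
        by (simp only: lin_eval_diff lin_eval_single word_coord_slot linear_form_def) (simp add: algebra_simps)
    next
      case (2 xs ys a u)
      then show ?case
        using assms(1) True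
        by (simp only: lin_eval_diff lin_eval_single word_coord_slot linear_form_def) (simp add: algebra_simps)
    qed
  next
    case False
    then show ?thesis
      using s unfolding rel_gens_def by (auto simp: lin_eval_diff lin_eval_single word_coord_length)
  qed
qed

abbreviation perm_word :: "nat list \<Rightarrow> (nat \<Rightarrow> nat) \<Rightarrow> nat list" where
  "perm_word w x \<equiv> map (\<lambda>j. w ! x j) [0..<length w]"

text \<open>
  The set \<open>U\<close> is the copy of \<open>W\<close> in \<open>M(g, \<rho>)\<close>: it is homogeneous of degree \<open>g\<close>, and \<open>g\<close>
  multiplies its coordinates by \<open>q\<close>. The vectors \<open>e b\<close> stand for the letters, and \<open>z\<close> is the zero vector.
\<close>

locale scalar_braided_subspace = linear_yd \<Gamma> V for \<Gamma> :: "('g, 'a) monoid_scheme" and V :: "('k::field, 'v, 'g, 'z) yd_module_scheme" +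
  fixes g :: 'g and q :: 'k and U :: "'v set" and z :: 'v and e :: "nat \<Rightarrow> 'v"
    and d :: nat and \<phi> :: "nat \<Rightarrow> 'v \<Rightarrow> 'k"
  assumes fin: "finite (carrier \<Gamma>)" and g: "g \<in> carrier \<Gamma>"
    and U: "U \<subseteq> carrier V"
    and act_g: "u \<in> U \<Longrightarrow> act V g u \<in> U" "u \<in> U \<Longrightarrow> \<phi> a (act V g u) = q * \<phi> a u"
    and coact_g: "u \<in> U \<Longrightarrow> coact V u g = u" "u \<in> U \<Longrightarrow> h \<in> carrier \<Gamma> \<Longrightarrow> h \<noteq> g \<Longrightarrow> coact V u h = z"
    and zero: "h \<in> carrier \<Gamma> \<Longrightarrow> act V h z = z" "h \<in> carrier \<Gamma> \<Longrightarrow> coact V z h = z" "\<phi> a z = 0"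
    and form: "linear_form V (\<phi> a)"
    and e: "b < d \<Longrightarrow> e b \<in> U" "b < d \<Longrightarrow> \<phi> a (e b) = (if a = b then 1 else 0)"
begin

text \<open>
  The summands of the braiding that belong to \<open>h \<noteq> g\<close> have the zero vector in one factor, while the other factor may
  leave \<open>U\<close>. Such words are zero as tensors but not as formal words; they are kept and
  killed only by the coordinates.
\<close>

definition good :: "nat \<Rightarrow> 'v list set" where
  "good n = {l. length l = n \<and> (set l \<subseteq> U \<or> z \<in> set l)}"

lemma word_coord_zero: "z \<in> set l \<Longrightarrow> word_coord \<phi> w l = 0"
proof (induction w arbitrary: l)
  case Nil then show ?case by (cases l) auto
next
  case (Cons a w) then show ?case by (cases l) (auto simp: zero)
qed

lemma crossing_zero:
  assumes "h \<in> carrier \<Gamma>" "z \<in> set l" "Suc i < length l"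
  shows "z \<in> set (crossing V h i l)"
proof -
  have d: "drop i l = l ! i # l ! Suc i # drop (i + 2) l"
    using assms(3) Cons_nth_drop_Suc[of i l] Cons_nth_drop_Suc[of "Suc i" l] by simp
  have "set l = set (take i l) \<union> set (drop i l)"
    unfolding set_append[symmetric] append_take_drop_id ..
  then have "z \<in> set (take i l) \<or> z = l ! i \<or> z = l ! Suc i \<or> z \<in> set (drop (i + 2) l)"
    using assms(2) d by auto
  then show ?thesis using zero assms(1) by (auto simp: crossing_def)
qed

lemma crossing_g:
  assumes "set l \<subseteq> U" "Suc i < length l"
  shows "set (crossing V g i l) \<subseteq> U"
proof -
  have "l ! i \<in> U" "l ! Suc i \<in> U" using assms by auto
  then show ?thesis
    using assms set_take_subset[of i l] set_drop_subset[of "i + 2" l] by (auto simp: crossing_def act_g coact_g)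
qed

lemma crossing_not_g:
  assumes "set l \<subseteq> U" "Suc i < length l" "h \<in> carrier \<Gamma>" "h \<noteq> g"
  shows "z \<in> set (crossing V h i l)"
proof -
  have "l ! i \<in> U" using assms by auto
  then show ?thesis using assms by (auto simp: crossing_def coact_g)
qed

lemma crossing_good:
  assumes "l \<in> good n" "Suc i < n" "h \<in> carrier \<Gamma>"
  shows "crossing V h i l \<in> good n"
  using assms crossing_zero[of h l i] crossing_g[of l i] crossing_not_g[of l i h]
  by (cases "h = g") (auto simp: good_def length_crossing)

text \<open>
  On \<open>U\<close> the generator \<open>\<sigma>\<^sub>i\<close> acts as \<open>q\<close> times the exchange of two letters.
\<close>

lemma sum_word_coord_crossing:
  assumes l: "l \<in> good n" and i: "Suc i < n" and w: "length w = n"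
  shows "(\<Sum>h\<in>carrier \<Gamma>. word_coord \<phi> w (crossing V h i l)) = q * word_coord \<phi> (perm_word w (transpose i (Suc i))) l"
proof (cases "z \<in> set l")
  case True
  then have "word_coord \<phi> w (crossing V h i l) = 0" if "h \<in> carrier \<Gamma>" for h
    using crossing_zero[OF that True] l i by (intro word_coord_zero) (simp add: good_def)
  then show ?thesis using True by (simp add: word_coord_zero)
next
  case False
  then have l: "set l \<subseteq> U" "length l = n" using l by (auto simp: good_def)
  have "(\<Sum>h\<in>carrier \<Gamma>. word_coord \<phi> w (crossing V h i l)) = (\<Sum>h\<in>carrier \<Gamma>. if h = g then word_coord \<phi> w (crossing V g i l) else 0)"
    using l i by (intro sum.cong refl) (auto intro!: word_coord_zero crossing_not_g)
  also have "\<dots> = word_coord \<phi> w (crossing V g i l)" using fin g by simp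
  also have "\<dots> = (\<Prod>j<n. (if j = i then q else 1) * \<phi> (w ! j) (l ! transpose i (Suc i) j))"
  proof -
    have "\<phi> (w ! j) (crossing V g i l ! j) = (if j = i then q else 1) * \<phi> (w ! j) (l ! transpose i (Suc i) j)" if "j < n" for j
    proof -
      have U: "l ! i \<in> U" "l ! Suc i \<in> U" using l i by auto
      consider "j < i" | "j = i" | "j = Suc i" | "j > Suc i" by linarith
      then show ?thesis
      proof cases
        case 4
        then obtain k where "j = Suc (Suc (i + k))" by (metis add_Suc less_iff_Suc_add)
        then show ?thesis using l i that by (simp add: crossing_def nth_append transpose_def)
      qed (use l i U in \<open>auto simp: crossing_def nth_append act_g coact_g transpose_def\<close>)
    qed
    then show ?thesis using l i w by (subst word_coord_eq_prod) (auto simp: length_crossing)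
  qed
  also have "\<dots> = q * (\<Prod>j<n. \<phi> (w ! j) (l ! transpose i (Suc i) j))"
    using i by (simp add: prod.distrib)
  also have "(\<Prod>j<n. \<phi> (w ! j) (l ! transpose i (Suc i) j)) = (\<Prod>j<n. \<phi> (w ! transpose i (Suc i) j) (l ! j))"
    by (rule prod.reindex_bij_witness[where i = "transpose i (Suc i)" and j = "transpose i (Suc i)"])
      (use i in \<open>auto simp: transpose_def\<close>)
  also have "\<dots> = word_coord \<phi> (perm_word w (transpose i (Suc i))) l"
    using w l by (subst word_coord_eq_prod) auto
  finally show ?thesis .
qed

lemma braid_word_Cons: "braid_word (i # es) f = sigma braiding i (braid_word es f)"
  by simp

lemma braid_word_good:
  assumes "\<forall>i\<in>set es. Suc i < n" "Poly_Mapping.keys f \<subseteq> good n"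
  shows "Poly_Mapping.keys (braid_word es f) \<subseteq> good n"
  using assms(1)
proof (induction es)
  case (Cons i es)
  have IH: "Poly_Mapping.keys (braid_word es f) \<subseteq> good n" using Cons.IH Cons.prems list.set_intros(2) by metis
  have i: "Suc i < n" using Cons.prems by simp
  have "Poly_Mapping.keys (\<Sum>h\<in>carrier \<Gamma>. Poly_Mapping.single (crossing V h i l) (1::'k)) \<subseteq> good n"
    if "l \<in> good n" for l
    using that i crossing_good by (intro order_trans[OF keys_sum]) (auto split: if_splits)
  then show ?case
    using IH keys_lin_ext[of "\<lambda>l. \<Sum>h\<in>carrier \<Gamma>. Poly_Mapping.single (crossing V h i l) (1::'k)" "braid_word es f"]
    unfolding braid_word_Cons sigma_yd_braiding[symmetric] by blast
qed (use assms(2) in simp)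

lemma lin_eval_sigma:
  assumes "Poly_Mapping.keys f \<subseteq> good n" "Suc i < n" "length w = n"
  shows "lin_eval (word_coord \<phi> w) (sigma braiding i f) = q * lin_eval (word_coord \<phi> (perm_word w (transpose i (Suc i)))) f"
proof -
  have "lin_eval (word_coord \<phi> w) (sigma braiding i f)
      = (\<Sum>l\<in>Poly_Mapping.keys f. Poly_Mapping.lookup f l * (\<Sum>h\<in>carrier \<Gamma>. word_coord \<phi> w (crossing V h i l)))"
    by (simp add: sigma_yd_braiding lin_eval_lin_ext lin_eval_sum lin_eval_single)
  also have "\<dots> = (\<Sum>l\<in>Poly_Mapping.keys f. Poly_Mapping.lookup f l * (q * word_coord \<phi> (perm_word w (transpose i (Suc i))) l))"
    by (intro sum.cong refl arg_cong2[where f = "(*)"] sum_word_coord_crossing[OF _ assms(2,3)]) (use assms(1) in auto)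
  finally show ?thesis by (simp add: lin_eval_def sum_distrib_left mult.left_commute)
qed

lemma lin_eval_braid_word:
  assumes "\<forall>i\<in>set es. Suc i < n" "Poly_Mapping.keys f \<subseteq> good n" "length w = n"
  shows "lin_eval (word_coord \<phi> w) (braid_word es f) = q ^ length es * lin_eval (word_coord \<phi> (perm_word w (word_perm es))) f"
  using assms(1,3)
proof (induction es arbitrary: w)
  case Nil
  then show ?case using map_nth[of w] by simp
next
  case (Cons i es)
  have es: "\<forall>i\<in>set es. Suc i < n" and i: "Suc i < n" using Cons.prems(1) by auto
  have "lin_eval (word_coord \<phi> w) (braid_word (i # es) f) = q * lin_eval (word_coord \<phi> (perm_word w (transpose i (Suc i)))) (braid_word es f)"
    unfolding braid_word_Cons by (rule lin_eval_sigma[OF braid_word_good[OF es assms(2)] i Cons.prems(2)])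
  also have "\<dots> = q * (q ^ length es * lin_eval (word_coord \<phi> (perm_word (perm_word w (transpose i (Suc i))) (word_perm es))) f)"
    by (subst Cons.IH[OF es]) (simp_all only: length_map length_upt minus_nat.diff_0 Cons.prems(2))
  also have "perm_word (perm_word w (transpose i (Suc i))) (word_perm es) = perm_word w (word_perm (i # es))"
    using Cons.prems(2) permutes_in_image[OF word_perm_permutes[OF es]] by auto
  finally show ?case by (simp only: length_Cons power_Suc mult.assoc)
qed

lemma word_coord_letters: "set u \<subseteq> {..<d} \<Longrightarrow> length w = length u \<Longrightarrow> word_coord \<phi> w (map e u) = (if w = u then 1 else 0)"
proof (induction u arbitrary: w)
  case (Cons b u)
  then show ?case by (cases w) (auto simp: e)
qed simp

lemma lin_eval_quantum_sym:
  assumes u: "set u \<subseteq> {..<d}" and w: "length w = length u"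
  shows "lin_eval (word_coord \<phi> w) (total_quantum_sym braiding (Poly_Mapping.single (map e u) 1)) = letter_product q u w"
proof -
  let ?n = "length u" and ?f = "Poly_Mapping.single (map e u) (1::'k)"
  have good: "Poly_Mapping.keys ?f \<subseteq> good ?n" using u e(1) by (auto simp: good_def)
  have "lin_eval (word_coord \<phi> w) (total_quantum_sym braiding ?f) = (\<Sum>x | x permutes {..<?n}. lin_eval (word_coord \<phi> w) (braid_section braiding ?n x ?f))"
    by (simp add: total_quantum_sym_single quantum_sym_def lin_eval_sum)
  also have "\<dots> = (\<Sum>x | x permutes {..<?n}. q ^ card (inversions ?n x) * (if map (\<lambda>j. w ! x j) [0..<?n] = u then 1 else 0))"
  proof (intro sum.cong refl)
    fix x assume "x \<in> {x. x permutes {..<?n}}"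
    then have x: "x permutes {..<?n}" by simp
    define es where "es = (SOME es. reduced_expression ?n x es)"
    have "reduced_expression ?n x es" and len: "length es = card (inversions ?n x)"
      using reduced_expression_some[OF x] by (simp_all only: es_def)
    then have es: "\<forall>i\<in>set es. Suc i < ?n" "word_perm es = x"
      unfolding reduced_expression_def by blast+
    show "lin_eval (word_coord \<phi> w) (braid_section braiding ?n x ?f) = q ^ card (inversions ?n x) * (if map (\<lambda>j. w ! x j) [0..<?n] = u then 1 else 0)"
      unfolding braid_section_def es_def[symmetric] lin_eval_braid_word[OF es(1) good w] es(2) len lin_eval_single
      using word_coord_letters[OF u, of "perm_word w x"] w by simp
  qed
  also have "\<dots> = letter_product q u w" by (rule sum_permutes[OF w])
  finally show ?thesis .
qed

lemma letter_algebra_realized: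
  assumes "letter_algebra q d n F"
  shows "\<exists>f\<in>words V. \<forall>w. length w = n \<longrightarrow> lin_eval (word_coord \<phi> w) (total_quantum_sym braiding f) = F w"
  using assms
proof induction
  case (word u)
  then have "map e u \<in> lists (carrier V)" using e(1) U by (auto simp: lists_eq_set)
  then have "Poly_Mapping.single (map e u) 1 \<in> words V" by (simp add: words_def)
  then show ?case using lin_eval_quantum_sym[OF word] by blast
next
  case (add n F G)
  then obtain f f' where f: "f \<in> words V" "f' \<in> words V" 
    "\<forall>w. length w = n \<longrightarrow> lin_eval (word_coord \<phi> w) (total_quantum_sym braiding f) = F w"
    "\<forall>w. length w = n \<longrightarrow> lin_eval (word_coord \<phi> w) (total_quantum_sym braiding f') = G w" by blast
  then have "f + f' \<in> words V" using keys_add[of f f'] unfolding words_def by blast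
  then show ?case using f(3,4) by (intro bexI[of _ "f + f'"]) (simp_all add: total_quantum_sym_linear lin_eval_add)
next
  case (scale n F a)
  then obtain f where f: "f \<in> words V"
    "\<forall>w. length w = n \<longrightarrow> lin_eval (word_coord \<phi> w) (total_quantum_sym braiding f) = F w" by blast
  then have "pm_scale (*) a f \<in> words V" unfolding words_def by (auto simp: in_keys_iff)
  then show ?case using f(2) by (intro bexI[of _ "pm_scale (*) a f"]) (simp_all add: total_quantum_sym_linear lin_eval_scale)
qed

end

section \<open>Unbounded degrees exclude finite dimension\<close>

lemma coset_plus:
  assumes "0 \<in> R" "\<And>x y. x \<in> R \<Longrightarrow> y \<in> R \<Longrightarrow> x + y \<in> R"
  shows "(f +o R) + (f' +o R) = (f + f') +o (R :: 'a::ab_group_add set)"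
proof -
  have "R + R = R" using assms by (force simp: set_plus_def)
  then show ?thesis by (simp add: set_plus_rearrange)
qed

lemma coset_eqI:
  assumes "0 \<in> R" "\<And>x y. x \<in> R \<Longrightarrow> y \<in> R \<Longrightarrow> x + y \<in> R" "f - f' \<in> R" "f' - f \<in> R"
  shows "f +o R = f' +o (R :: 'a::ab_group_add set)"
proof -
  have "f + r = f' + ((f - f') + r)" "f' + r = f + ((f' - f) + r)" for r by simp_all
  then show ?thesis using assms(2-4) unfolding elt_set_plus_def by (metis (lifting))
qed

text \<open>
  An additive map vanishing on \<open>R\<close> may be evaluated at any representative of a coset.
\<close>

lemma some_coset:
  fixes R :: "'a::ab_group_add set"
  assumes "0 \<in> R" "\<And>r. r \<in> R \<Longrightarrow> \<psi> r = 0" "\<And>x y. \<psi> (x + y) = \<psi> x + \<psi> y"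
  shows "\<psi> (SOME f'. f' \<in> f +o R) = (\<psi> f :: 'b::ab_group_add)"
proof -
  have "f \<in> f +o R" unfolding elt_set_plus_def using assms(1) by (intro CollectI bexI[of _ 0]) simp_all
  then have "(SOME f'. f' \<in> f +o R) \<in> f +o R" by (rule someI)
  then obtain r where "r \<in> R" "(SOME f'. f' \<in> f +o R) = f + r" by (auto simp: elt_set_plus_def)
  then show ?thesis using assms(2,3) by simp
qed

lemma multilinear_rels_subspace: "pm.subspace (multilinear_rels V)"
  unfolding multilinear_rels_def pm_span_def by (rule pm.subspace_span)

context scalar_braided_subspace
begin

abbreviation "R \<equiv> multilinear_rels V"
abbreviation "M \<equiv> nichols_algebra V braiding"
abbreviation "S \<equiv> total_quantum_sym braiding"

lemmas R = pm.subspace_0[OF multilinear_rels_subspace[of V]] pm.subspace_add[OF multilinear_rels_subspace[of V]]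

lemma nichols_simps:
  "carrier M = (\<lambda>f. S f +o R) ` words V" "C \<oplus>\<^bsub>M\<^esub> D = C + D" "\<zero>\<^bsub>M\<^esub> = R"
  "a \<odot>\<^bsub>M\<^esub> C = quot_map R (pm_scale (*) a) C"
proof -
  have "quot_map R S (f +o R) = S f +o R" for f
    by (rule quot_map_coset) (auto simp: R total_quantum_sym_rels total_quantum_sym_linear)
  then show "carrier M = (\<lambda>f. S f +o R) ` words V"
    by (simp add: nichols_algebra_def tensor_algebra_def quot_space_def image_image)
qed (simp_all add: nichols_algebra_def tensor_algebra_def quot_space_def)

lemma nichols_smult: "a \<odot>\<^bsub>M\<^esub> (f +o R) = pm_scale (*) a f +o R"
  unfolding nichols_simps
  by (rule quot_map_coset) (auto simp: R pm.scale_right_distrib pm.subspace_scale[OF multilinear_rels_subspace])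

lemma words_closed:
  "0 \<in> words V" "f \<in> words V \<Longrightarrow> f' \<in> words V \<Longrightarrow> f + f' \<in> words V" "f \<in> words V \<Longrightarrow> pm_scale (*) a f \<in> words V"
  using keys_add[of f f'] unfolding words_def by (auto simp: in_keys_iff)

lemma nichols_smult_closed: "C \<in> carrier M \<Longrightarrow> a \<odot>\<^bsub>M\<^esub> C \<in> carrier M"
  unfolding nichols_simps(1) using words_closed(3)
  by (auto simp: nichols_smult image_iff simp flip: total_quantum_sym_linear(2))

lemma nichols_abelian_monoid: "abelian_monoid M"
proof (rule abelian_monoidI)
  have S0: "S 0 = 0" using total_quantum_sym_linear(2)[of 0 0] by simp
  show "\<zero>\<^bsub>M\<^esub> \<in> carrier M"
    unfolding nichols_simps using words_closed(1) S0 by (auto intro!: image_eqI[of _ _ 0])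
  show "C \<oplus>\<^bsub>M\<^esub> D \<in> carrier M" if CD: "C \<in> carrier M" "D \<in> carrier M" for C D
  proof -
    obtain f f' where "f \<in> words V" "f' \<in> words V" "C = S f +o R" "D = S f' +o R"
      using CD unfolding nichols_simps by blast
    then show ?thesis
      unfolding nichols_simps using words_closed(2)[of f f']
      by (auto simp: coset_plus[OF R] total_quantum_sym_linear intro!: image_eqI[of _ _ "f + f'"])
  qed
  show "\<zero>\<^bsub>M\<^esub> \<oplus>\<^bsub>M\<^esub> C = C" if C: "C \<in> carrier M" for C
  proof -
    obtain f where "C = S f +o R" using C unfolding nichols_simps by blast
    then show ?thesis unfolding nichols_simps using coset_plus[OF R, of 0 "S f"] by simp
  qed
qed (simp_all add: nichols_simps ac_simps)

definition val :: "nat list \<Rightarrow> ('v list \<Rightarrow>\<^sub>0 'k) set \<Rightarrow> 'k" where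
  "val w C = lin_eval (word_coord \<phi> w) (SOME f. f \<in> C)"

lemma val_coset: "val w (f +o R) = lin_eval (word_coord \<phi> w) f"
  unfolding val_def by (rule some_coset) (auto simp: R lin_eval_add word_coord_rels[OF form])

lemma val_finsum_zero:
  assumes "finite B" "B \<subseteq> carrier M" "\<And>b. b \<in> B \<Longrightarrow> val w b = 0"
  shows "val w (\<Oplus>\<^bsub>M\<^esub>b\<in>B. a b \<odot>\<^bsub>M\<^esub> b) = 0"
proof -
  interpret M: abelian_monoid M by (rule nichols_abelian_monoid)
  have cl: "a b \<odot>\<^bsub>M\<^esub> b \<in> carrier M" if "b \<in> B" for b using that assms(2) nichols_smult_closed by blast
  show ?thesis using assms(1) order_refl[of B]
  proof (induction rule: finite_subset_induct')
    case empty
    show ?case using val_coset[of w 0] by (simp add: nichols_simps)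
  next
    case (insert b B')
    then have "(\<lambda>b. a b \<odot>\<^bsub>M\<^esub> b) \<in> B' \<rightarrow> carrier M" "a b \<odot>\<^bsub>M\<^esub> b \<in> carrier M" using cl by auto
    then have eq: "(\<Oplus>\<^bsub>M\<^esub>b\<in>insert b B'. a b \<odot>\<^bsub>M\<^esub> b) = (a b \<odot>\<^bsub>M\<^esub> b) + (\<Oplus>\<^bsub>M\<^esub>b\<in>B'. a b \<odot>\<^bsub>M\<^esub> b)"
      and "(\<Oplus>\<^bsub>M\<^esub>b\<in>B'. a b \<odot>\<^bsub>M\<^esub> b) \<in> carrier M"
      using insert.hyps by (simp_all add: M.finsum_insert M.finsum_closed nichols_simps(2))
    then obtain f f' where f: "b = S f +o R" "(\<Oplus>\<^bsub>M\<^esub>b\<in>B'. a b \<odot>\<^bsub>M\<^esub> b) = S f' +o R"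
      using insert.hyps assms(2) unfolding nichols_simps(1) by blast
    have "val w b = 0" using insert.hyps assms(3) by blast
    then have "lin_eval (word_coord \<phi> w) (S f) = 0" unfolding f(1) val_coset .
    moreover have "lin_eval (word_coord \<phi> w) (S f') = 0" using insert.IH unfolding f(2) val_coset .
    moreover have "a b \<odot>\<^bsub>M\<^esub> b = pm_scale (*) (a b) (S f) +o R"
      using nichols_smult[of "a b" "S f"] f(1) by simp
    ultimately show ?case
      unfolding eq f(2) by (simp only: coset_plus[OF R] val_coset lin_eval_add lin_eval_scale) simp
  qed
qed

text \<open>
  A finite spanning set involves only words of bounded length, so the coordinates of long words vanish on
  its span. The elements \<open>S f\<close> realize all of \<open>letter_algebra q d\<close> and violate this.
\<close>

theorem nichols_not_finite_dimensional:
  assumes "letter_algebra_unbounded q d"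
  shows "\<not> finite_dimensional M"
proof
  assume "finite_dimensional M"
  then obtain B where "finite B \<and> B \<subseteq> carrier M \<and> (\<forall>v\<in>carrier M. \<exists>a. v = (\<Oplus>\<^bsub>M\<^esub>b\<in>B. a b \<odot>\<^bsub>M\<^esub> b))"
    unfolding finite_dimensional_def by (rule exE)
  then have B: "finite B" "B \<subseteq> carrier M" "\<forall>v\<in>carrier M. \<exists>a. v = (\<Oplus>\<^bsub>M\<^esub>b\<in>B. a b \<odot>\<^bsub>M\<^esub> b)"
    by simp_all
  have "\<exists>K. \<forall>w. length w > K \<longrightarrow> val w b = 0" if b: "b \<in> B" for b
  proof (intro exI allI impI)
    obtain f where f: "b = f +o R" using b B(2) unfolding nichols_simps by blast
    fix w :: "nat list" assume w: "length w > Max (length ` Poly_Mapping.keys (SOME f. b = f +o R))"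
    define f' where "f' = (SOME f. b = f +o R)"
    have f': "b = f' +o R" unfolding f'_def using f by (rule someI)
    have "word_coord \<phi> w l = 0" if "l \<in> Poly_Mapping.keys f'" for l
    proof (rule word_coord_length)
      have "length l \<le> Max (length ` Poly_Mapping.keys f')" using that by (intro Max_ge) auto
      then show "length w \<noteq> length l" using w[folded f'_def] by linarith
    qed
    then show "val w b = 0" by (simp add: f' val_coset lin_eval_def)
  qed
  then obtain K where K: "\<And>b w. b \<in> B \<Longrightarrow> length w > K b \<Longrightarrow> val w b = 0"
    using bchoice[of B "\<lambda>b K. \<forall>w. length w > K \<longrightarrow> val w b = 0"] by blast
  define K' where "K' = Suc (sum K B)"
  obtain n F w where n: "n \<ge> K'" "letter_algebra q d n F" "length w = n" "F w \<noteq> 0"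
    using assms unfolding letter_algebra_unbounded_def by blast
  obtain f where f: "f \<in> words V" "lin_eval (word_coord \<phi> w) (S f) = F w"
    using letter_algebra_realized[OF n(2)] n(3) by blast
  have "S f +o R \<in> carrier M" using f(1) unfolding nichols_simps by blast
  from bspec[OF B(3) this] obtain a where a: "S f +o R = (\<Oplus>\<^bsub>M\<^esub>b\<in>B. a b \<odot>\<^bsub>M\<^esub> b)" by (rule exE)
  have "val w b = 0" if "b \<in> B" for b
    using K[OF that] member_le_sum[OF that, of K] B(1) n(1,3) by (simp add: K'_def)
  from val_finsum_zero[OF B(1,2) this] have "val w (S f +o R) = 0" unfolding a .
  then show False using f(2) n(4) by (simp add: val_coset)
qed

end

section \<open>The module induced from the centralizer\<close>

locale induced_module =
  fixes \<Gamma> :: "('g, 'a) monoid_scheme" and scale :: "'k::field \<Rightarrow> 'w::ab_group_add \<Rightarrow> 'w"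
    and g :: 'g and \<rho> :: "'g \<Rightarrow> 'w \<Rightarrow> 'w"
  assumes grp: "group \<Gamma>" and g: "g \<in> carrier \<Gamma>"
    and rep: "representation \<Gamma> (centralizer \<Gamma> g) scale \<rho>"
begin

interpretation group \<Gamma> by (rule grp)

lemma vs: "vector_space scale"
  using rep by (simp add: representation_def)

interpretation W: vector_space scale by (rule vs)
interpretation F: vector_space "pm_scale scale :: 'k \<Rightarrow> ('g \<Rightarrow>\<^sub>0 'w) \<Rightarrow> _" by (rule vector_space_pm_scale[OF vs])

abbreviation "C \<equiv> centralizer \<Gamma> g"
abbreviation "V \<equiv> yd_M \<Gamma> scale g \<rho>"
abbreviation "R \<equiv> balancing_rels \<Gamma> scale g \<rho>"
abbreviation "pure t x \<equiv> Poly_Mapping.single t x +o R"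

lemma rho_linear: "h \<in> C \<Longrightarrow> Vector_Spaces.linear scale scale (\<rho> h)"
  and rho_one: "\<rho> \<one>\<^bsub>\<Gamma>\<^esub> = id"
  and rho_mult: "h \<in> C \<Longrightarrow> h' \<in> C \<Longrightarrow> \<rho> (h \<otimes>\<^bsub>\<Gamma>\<^esub> h') = \<rho> h \<circ> \<rho> h'"
  using rep by (auto simp: representation_def)

lemma C_mult: "h \<in> C \<Longrightarrow> h' \<in> C \<Longrightarrow> h \<otimes>\<^bsub>\<Gamma>\<^esub> h' \<in> C"
  using g by (auto simp: centralizer_def) (metis m_assoc)

lemma C_mult_iff: "t \<in> carrier \<Gamma> \<Longrightarrow> h \<in> C \<Longrightarrow> t \<otimes>\<^bsub>\<Gamma>\<^esub> h \<in> C \<longleftrightarrow> t \<in> C"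
proof
  assume a: "t \<in> carrier \<Gamma>" "h \<in> C" "t \<otimes>\<^bsub>\<Gamma>\<^esub> h \<in> C"
  then have h: "h \<in> carrier \<Gamma>" "h \<otimes>\<^bsub>\<Gamma>\<^esub> g = g \<otimes>\<^bsub>\<Gamma>\<^esub> h" and th: "t \<otimes>\<^bsub>\<Gamma>\<^esub> h \<otimes>\<^bsub>\<Gamma>\<^esub> g = g \<otimes>\<^bsub>\<Gamma>\<^esub> (t \<otimes>\<^bsub>\<Gamma>\<^esub> h)"
    by (auto simp: centralizer_def)
  have "t \<otimes>\<^bsub>\<Gamma>\<^esub> g \<otimes>\<^bsub>\<Gamma>\<^esub> h = t \<otimes>\<^bsub>\<Gamma>\<^esub> h \<otimes>\<^bsub>\<Gamma>\<^esub> g"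
    using a(1) g h by (simp add: m_assoc)
  also have "\<dots> = g \<otimes>\<^bsub>\<Gamma>\<^esub> t \<otimes>\<^bsub>\<Gamma>\<^esub> h" using a(1) g h th by (simp add: m_assoc)
  finally have "t \<otimes>\<^bsub>\<Gamma>\<^esub> g = g \<otimes>\<^bsub>\<Gamma>\<^esub> t" using a(1) g h(1) by simp
  then show "t \<in> C" using a(1) by (simp add: centralizer_def)
qed (rule C_mult)

lemma g_C: "g \<in> C" and one_C: "\<one>\<^bsub>\<Gamma>\<^esub> \<in> C"
  using g by (simp_all add: centralizer_def)

lemma R_subspace: "F.subspace R"
  unfolding balancing_rels_def pm_span_def by (rule F.subspace_span)

lemmas R_closed = F.subspace_0[OF R_subspace] F.subspace_add[OF R_subspace]

lemma yd_M_simps: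
  "carrier V = (\<lambda>f. f +o R) ` group_alg_tensor \<Gamma>" "A \<oplus>\<^bsub>V\<^esub> B = A + B" "\<zero>\<^bsub>V\<^esub> = R"
  "a \<odot>\<^bsub>V\<^esub> A = quot_map R (pm_scale scale a) A"
  "act V h = quot_map R (left_translate \<Gamma> h)" "coact V A h = quot_map R (conj_component \<Gamma> g h) A"
  by (simp_all add: yd_M_def Let_def module.extend_def quot_space_def)

lemma yd_M_smult: "a \<odot>\<^bsub>V\<^esub> (f +o R) = pm_scale scale a f +o R"
  unfolding yd_M_simps by (rule quot_map_coset) (auto simp: R_closed F.scale_right_distrib F.subspace_scale[OF R_subspace])

lemma linear_op_quot_map:
  assumes "\<And>r. r \<in> R \<Longrightarrow> \<psi> r \<in> R" "\<And>x y. \<psi> (x + y) = \<psi> x + \<psi> y"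
    "\<And>a x. \<psi> (pm_scale scale a x) = pm_scale scale a (\<psi> x)"
    "\<And>f. f \<in> group_alg_tensor \<Gamma> \<Longrightarrow> \<psi> f \<in> group_alg_tensor \<Gamma>"
  shows "linear_op V (quot_map R \<psi>)"
proof -
  have [simp]: "quot_map R \<psi> (f +o R) = \<psi> f +o R" for f
    by (rule quot_map_coset) (auto simp: assms R_closed)
  show ?thesis
    unfolding linear_op_def
    by (auto simp: yd_M_simps(1,2) yd_M_smult assms coset_plus[OF R_closed])
qed

lemma group_alg_tensor_sum:
  "(\<And>i. i \<in> I \<Longrightarrow> f i \<in> group_alg_tensor \<Gamma>) \<Longrightarrow> (\<Sum>i\<in>I. f i :: 'g \<Rightarrow>\<^sub>0 'w) \<in> group_alg_tensor \<Gamma>"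
  using keys_sum[of f I] unfolding group_alg_tensor_def by blast

lemma linear_yd_yd_M: "linear_yd \<Gamma> V"
proof
  fix h assume h: "h \<in> carrier \<Gamma>"
  have "left_translate \<Gamma> h (pm_scale scale a x) = pm_scale scale a (left_translate \<Gamma> h x)" for a and x :: "'g \<Rightarrow>\<^sub>0 'w"
    by (rule poly_mapping_hom_eqI[where f = x])
      (simp_all add: F.scale_right_distrib left_translate_add left_translate_single pm_scale_single)
  moreover have "left_translate \<Gamma> h f \<in> group_alg_tensor \<Gamma>" if "f \<in> group_alg_tensor \<Gamma>" for f :: "'g \<Rightarrow>\<^sub>0 'w"
    unfolding left_translate_def using that h
    by (intro group_alg_tensor_sum) (auto simp: group_alg_tensor_def split: if_splits)
  ultimately show "linear_op V (act V h)"
    unfolding yd_M_simps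
    by (intro linear_op_quot_map left_translate_rels[OF refl grp g vs h] left_translate_add)
  have "conj_component \<Gamma> g h (pm_scale scale a x) = pm_scale scale a (conj_component \<Gamma> g h x)" for a and x :: "'g \<Rightarrow>\<^sub>0 'w"
    by (rule poly_mapping_hom_eqI[where f = x])
      (simp_all add: F.scale_right_distrib conj_component_add conj_component_single pm_scale_single)
  moreover have "conj_component \<Gamma> g h f \<in> group_alg_tensor \<Gamma>" if "f \<in> group_alg_tensor \<Gamma>" for f :: "'g \<Rightarrow>\<^sub>0 'w"
    unfolding conj_component_def using that h
    by (intro group_alg_tensor_sum) (auto simp: group_alg_tensor_def split: if_splits)
  ultimately show "linear_op V (\<lambda>v. coact V v h)"
    unfolding yd_M_simps
    by (intro linear_op_quot_map conj_component_rels[OF refl grp g vs] conj_component_add)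
qed

text \<open>
  The projection \<open>M(g, \<rho>) \<rightarrow> W\<close> onto the summand \<open>1 \<otimes> W\<close>, written on \<open>k\<Gamma> \<otimes> W\<close>.
\<close>

definition eval_unit :: "('g \<Rightarrow>\<^sub>0 'w) \<Rightarrow> 'w" where
  "eval_unit f = (\<Sum>t\<in>Poly_Mapping.keys f. if t \<in> C then \<rho> t (Poly_Mapping.lookup f t) else 0)"

lemma rho_add: "h \<in> C \<Longrightarrow> \<rho> h (x + y) = \<rho> h x + \<rho> h y"
  and rho_scale: "h \<in> C \<Longrightarrow> \<rho> h (scale a x) = scale a (\<rho> h x)"
proof -
  assume "h \<in> C"
  then interpret Vector_Spaces.linear scale scale "\<rho> h" by (rule rho_linear)
  show "\<rho> h (x + y) = \<rho> h x + \<rho> h y" "\<rho> h (scale a x) = scale a (\<rho> h x)" by (rule add, rule scale)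
qed

lemma rho_zero: "h \<in> C \<Longrightarrow> \<rho> h 0 = 0"
  using rho_scale[of h 0 0] by simp

lemma eval_unit_add: "eval_unit (f + f') = eval_unit f + eval_unit f'"
  unfolding eval_unit_def by (rule setsum_keys_plus_distrib) (simp_all add: rho_add rho_zero)

lemma eval_unit_single: "eval_unit (Poly_Mapping.single t x) = (if t \<in> C then \<rho> t x else 0)"
  by (cases "x = 0") (simp_all add: eval_unit_def rho_zero)

lemma eval_unit_scale: "eval_unit (pm_scale scale a f) = scale a (eval_unit f)"
  by (rule poly_mapping_hom_eqI[where f = f])
    (simp_all add: F.scale_right_distrib W.scale_right_distrib eval_unit_add eval_unit_single pm_scale_single rho_scale)

lemma eval_unit_rels: "r \<in> R \<Longrightarrow> eval_unit r = 0"
  unfolding balancing_rels_def pm_span_def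
proof (induction rule: F.span_induct_alt)
  case base
  show ?case by (simp add: eval_unit_def)
next
  case (step a s y)
  interpret E: additive eval_unit by unfold_locales (rule eval_unit_add)
  obtain t h x where s: "t \<in> carrier \<Gamma>" "h \<in> C" "s = Poly_Mapping.single (t \<otimes>\<^bsub>\<Gamma>\<^esub> h) x - Poly_Mapping.single t (\<rho> h x)"
    using step(1) by blast
  then have "eval_unit s = 0" by (simp add: E.diff eval_unit_single C_mult_iff rho_mult)
  then show ?case using step by (simp add: eval_unit_add eval_unit_scale)
qed

lemma pure_balance:
  assumes "h \<in> C" "t \<in> carrier \<Gamma>"
  shows "pure (t \<otimes>\<^bsub>\<Gamma>\<^esub> h) x = pure t (\<rho> h x)"
proof (rule coset_eqI[OF R_closed])
  show r: "Poly_Mapping.single (t \<otimes>\<^bsub>\<Gamma>\<^esub> h) x - Poly_Mapping.single t (\<rho> h x) \<in> R"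
    unfolding balancing_rels_def pm_span_def using assms by (intro F.span_base) blast
  show "Poly_Mapping.single t (\<rho> h x) - Poly_Mapping.single (t \<otimes>\<^bsub>\<Gamma>\<^esub> h) x \<in> R"
    using F.subspace_neg[OF R_subspace r] by simp
qed

definition unit_coord :: "('w \<Rightarrow> 'k) \<Rightarrow> ('g \<Rightarrow>\<^sub>0 'w) set \<Rightarrow> 'k" where
  "unit_coord c A = c (eval_unit (SOME f. f \<in> A))"

lemma unit_coord_coset: "unit_coord c (f +o R) = c (eval_unit f)"
  unfolding unit_coord_def by (subst some_coset[OF R_closed(1)]) (auto simp: eval_unit_rels eval_unit_add)

lemma unit_coord_pure: "unit_coord c (pure \<one>\<^bsub>\<Gamma>\<^esub> x) = c x"
  by (simp add: unit_coord_coset eval_unit_single one_C rho_one)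

lemma linear_form_unit_coord:
  assumes "\<And>x y. c (x + y) = c x + c y" "\<And>a x. c (scale a x) = a * c x"
  shows "linear_form V (unit_coord c)"
  unfolding linear_form_def
  by (auto simp: yd_M_simps(1,2) yd_M_smult coset_plus[OF R_closed] unit_coord_coset eval_unit_add eval_unit_scale assms)

text \<open>
  Only \<open>d\<close> elements of a basis are used as letters; the forms belonging to the numbers from \<open>d\<close> on are set to \<open>0\<close>.
\<close>

lemma exists_coordinates:
  assumes "0 < d" "d \<le> rep_degree scale"
  obtains e :: "nat \<Rightarrow> 'w" and c :: "nat \<Rightarrow> 'w \<Rightarrow> 'k" where
    "\<And>a x y. c a (x + y) = c a x + c a y" "\<And>a r x. c a (scale r x) = r * c a x"
    "\<And>a b. b < d \<Longrightarrow> c a (e b) = (if a = b then 1 else 0)"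
proof -
  obtain B where B: "W.independent B" "UNIV \<subseteq> W.span B" "card B = W.dim UNIV"
    using W.basis_exists[of UNIV] by blast
  then have card: "d \<le> card B" using assms(2) by (simp add: rep_degree_def)
  then have "finite B" using assms(1) card.infinite by fastforce
  then obtain e where e: "bij_betw e {0..<card B} B" using ex_bij_betw_nat_finite by blast
  define c where "c = (\<lambda>a x. if a < d then W.representation B x (e a) else 0)"
  have span: "x \<in> W.span B" for x using B(2) by blast
  show thesis
  proof (rule that[of c e])
    show "c a (x + y) = c a x + c a y" for a x y
      by (simp add: c_def W.representation_add[OF B(1) span span])
    show "c a (scale r x) = r * c a x" for a r x
      by (simp add: c_def W.representation_scale[OF B(1) span])
    show "c a (e b) = (if a = b then 1 else 0)" if "b < d" for a b
    proof -
      have "e b \<in> B" using e that card by (auto simp: bij_betw_def)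
      moreover have "e a = e b \<longleftrightarrow> a = b" if "a < d"
        using e that \<open>b < d\<close> card by (auto simp: bij_betw_def inj_on_def)
      ultimately show ?thesis using that by (auto simp: c_def W.representation_basis[OF B(1)])
    qed
  qed
qed

text \<open>
  The pure tensors \<open>1 \<otimes> x\<close> form a subspace with scalar braiding: their degree is \<open>g\<close>, and moving \<open>g\<close> from the
  left factor to \<open>x\<close> by the balancing relation turns the action of \<open>g\<close> into that of \<open>\<rho> g\<close>.
\<close>

theorem not_finite_nichols_rank:
  assumes fin: "finite (carrier \<Gamma>)" and q: "\<rho> g = scale q" and d: "0 < d" "d \<le> rep_degree scale"
    and unb: "letter_algebra_unbounded q d"
  shows "\<not> finite_nichols_rank \<Gamma> V"
proof -
  obtain e c where c: "\<And>a x y. c a (x + y) = c a x + c a y" "\<And>a r x. c a (scale r x) = r * c a x"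
    "\<And>a b. b < d \<Longrightarrow> c a (e b :: 'w) = (if a = b then 1 else 0)"
    using exists_coordinates[OF d] by metis
  interpret L: linear_yd \<Gamma> V by (rule linear_yd_yd_M)
  let ?U = "range (pure \<one>\<^bsub>\<Gamma>\<^esub>)"
  have pure_zero: "pure t 0 = R" for t by (simp add: elt_set_plus_def)
  have act: "act V h (pure t x) = pure (h \<otimes>\<^bsub>\<Gamma>\<^esub> t) x" if "h \<in> carrier \<Gamma>" for h t x
    by (rule act_pure_tensor[OF refl grp g vs that])
  have coact: "coact V (pure t x) h = (if t \<otimes>\<^bsub>\<Gamma>\<^esub> g \<otimes>\<^bsub>\<Gamma>\<^esub> inv\<^bsub>\<Gamma>\<^esub> t = h then pure t x else R)" for h t x
    using coact_pure_tensor[OF refl grp g vs] by (simp add: yd_M_simps)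
  have act_g: "act V g (pure \<one>\<^bsub>\<Gamma>\<^esub> x) = pure \<one>\<^bsub>\<Gamma>\<^esub> (scale q x)" for x
    using pure_balance[OF g_C one_closed, of x] g by (simp add: act q)
  interpret N: scalar_braided_subspace \<Gamma> V g q ?U R "\<lambda>b. pure \<one>\<^bsub>\<Gamma>\<^esub> (e b)" d "\<lambda>a. unit_coord (c a)"
  proof unfold_locales
    show "?U \<subseteq> carrier V" by (auto simp: yd_M_simps group_alg_tensor_def)
    show "linear_form V (unit_coord (c a))" for a by (rule linear_form_unit_coord) (rule c)+
    show "act V h R = R" if "h \<in> carrier \<Gamma>" for h using act[OF that, of "\<one>\<^bsub>\<Gamma>\<^esub>" 0] by (simp add: pure_zero)
    show "coact V R h = R" for h using coact[of "\<one>\<^bsub>\<Gamma>\<^esub>" 0 h] by (simp add: pure_zero)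
    show "unit_coord (c a) R = 0" for a
      using unit_coord_pure[of "c a" 0] c(2)[of a 0 0] by (simp add: pure_zero)
  qed (use fin g in \<open>auto simp: act_g coact unit_coord_pure c\<close>)
  show ?thesis unfolding finite_nichols_rank_def by (rule N.nichols_not_finite_dimensional[OF unb])
qed

end

section \<open>The scalar by which g acts\<close>

text \<open>
  If \<open>p(T) x = 0\<close> for some \<open>p \<noteq> 0\<close>, split off a root \<open>r\<close> as \<open>p = (X - r) p'\<close>: either \<open>p'(T) x\<close> is an eigenvector for \<open>r\<close>,
  or it is \<open>0\<close> and \<open>p'\<close> takes the place of \<open>p\<close>. The bound \<open>n\<close> is there only to make the number
  of summands independent of the polynomial.
\<close>

lemma eigenvector_exists:
  fixes scale :: "'k::alg_closed_field \<Rightarrow> 'w::ab_group_add \<Rightarrow> 'w" and p :: "'k poly"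
  assumes T: "Vector_Spaces.linear scale scale T"
    and "p \<noteq> 0" "degree p < n" "x \<noteq> 0" "(\<Sum>i<n. scale (coeff p i) ((T ^^ i) x)) = 0"
  shows "\<exists>r y. y \<noteq> 0 \<and> T y = scale r y"
  using assms(2-5)
proof (induction n arbitrary: p)
  case (Suc n)
  interpret vector_space scale by (rule Vector_Spaces.linear.axioms(1)[OF T])
  interpret T: Vector_Spaces.linear scale scale T by (rule T)
  show ?case
  proof (cases "degree p = 0")
    case True
    then obtain c where p: "p = [:c:]" by (rule degree_eq_zeroE)
    have "(\<Sum>i<Suc n. scale (coeff p i) ((T ^^ i) x)) = scale c x"
      by (simp only: sum.lessThan_Suc_shift) (simp add: p coeff_pCons)
    then show ?thesis using Suc.prems p by simp
  next
    case False
    then obtain r where "poly p r = 0" using alg_closed_imp_poly_has_root by blast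
    then obtain p' where p': "p = [:- r, 1:] * p'" by (metis poly_eq_0_iff_dvd dvdE)
    then have "p' \<noteq> 0" using Suc.prems by auto
    then have "degree p = Suc (degree p')" unfolding p' by (subst degree_mult_eq) auto
    then have deg: "degree p' < n" using Suc.prems by simp
    define y where "y = (\<Sum>i<n. scale (coeff p' i) ((T ^^ i) x))"
    have co: "coeff p i = (case i of 0 \<Rightarrow> 0 | Suc j \<Rightarrow> coeff p' j) - r * coeff p' i" for i
      by (simp add: p' coeff_pCons split: nat.split)
    have "(\<Sum>i<Suc n. scale (coeff p i) ((T ^^ i) x))
      = (\<Sum>i<Suc n. scale (case i of 0 \<Rightarrow> 0 | Suc j \<Rightarrow> coeff p' j) ((T ^^ i) x)) - (\<Sum>i<Suc n. scale r (scale (coeff p' i) ((T ^^ i) x)))"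
      unfolding co by (simp only: scale_left_diff_distrib sum_subtractf scale_scale)
    also have "(\<Sum>i<Suc n. scale (case i of 0 \<Rightarrow> 0 | Suc j \<Rightarrow> coeff p' j) ((T ^^ i) x)) = T y"
      by (simp only: sum.lessThan_Suc_shift) (simp add: y_def T.sum T.scale)
    also have "(\<Sum>i<Suc n. scale r (scale (coeff p' i) ((T ^^ i) x))) = scale r y"
      using deg by (simp add: y_def scale_sum_right coeff_eq_0)
    finally have "T y = scale r y" using Suc.prems by simp
    then show ?thesis using Suc.IH[OF \<open>p' \<noteq> 0\<close> deg Suc.prems(3)] unfolding y_def by blast
  qed
qed simp

text \<open>
  The polynomial \<open>X\<^sup>n - 1\<close> annihilates \<open>T\<close>.
\<close>

lemma finite_order_eigenvector:
  fixes scale :: "'k::alg_closed_field \<Rightarrow> 'w::ab_group_add \<Rightarrow> 'w"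
  assumes T: "Vector_Spaces.linear scale scale T" and n: "0 < n" "T ^^ n = id" and x: "x \<noteq> (0 :: 'w)"
  obtains r y where "y \<noteq> 0" "T y = scale r y" "r ^ n = 1"
proof -
  interpret vector_space scale by (rule Vector_Spaces.linear.axioms(1)[OF T])
  interpret T: Vector_Spaces.linear scale scale T by (rule T)
  let ?p = "monom (1::'k) n - 1"
  have co: "coeff ?p i = (if i = n then 1 else 0) - (if i = 0 then 1 else 0)" for i by auto
  have "coeff ?p n = 1" using n(1) by simp
  then have "?p \<noteq> 0" by (metis coeff_0 zero_neq_one)
  moreover have "degree ?p < Suc n"
    using degree_diff_le[of "monom (1::'k) n" n 1] degree_monom_le[of "1::'k" n] by simp
  moreover have "(\<Sum>i<Suc n. scale (coeff ?p i) ((T ^^ i) x)) = 0"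
  proof -
    have "(\<Sum>i<Suc n. scale (coeff ?p i) ((T ^^ i) x)) = (\<Sum>i<Suc n. (if i = n then (T ^^ i) x else 0) - (if i = 0 then (T ^^ i) x else 0))"
      unfolding co by (intro sum.cong refl) (auto simp: scale_left_diff_distrib)
    also have "\<dots> = (T ^^ n) x - x" unfolding sum_subtractf by (subst (1 2) sum.delta) auto
    finally show ?thesis using n(2) by simp
  qed
  ultimately obtain r y where y: "y \<noteq> 0" "T y = scale r y"
    using eigenvector_exists[OF T _ _ x, of ?p "Suc n"] by blast
  have "(T ^^ k) y = scale (r ^ k) y" for k
    by (induction k) (simp_all add: y(2) T.scale mult.commute)
  then have "scale (r ^ n) y = scale 1 y" using n(2) by (metis id_apply scale_one)
  then have "r ^ n = 1" using y(1) by (simp add: scale_right_imp_eq)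
  with y show thesis by (rule that)
qed

text \<open>
  Schur's lemma for the central element \<open>g\<close>: an eigenspace of \<open>\<rho> g\<close> is invariant under the centralizer, hence
  everything. Finite order of \<open>g\<close> provides the eigenvalue, and makes it a root of unity.
\<close>

lemma central_scalar:
  fixes \<Gamma> :: "('g, 'a) monoid_scheme" and scale :: "'k::alg_closed_field \<Rightarrow> 'w::ab_group_add \<Rightarrow> 'w"
  assumes grp: "group \<Gamma>" and fin: "finite (carrier \<Gamma>)" and g: "g \<in> carrier \<Gamma>"
    and irr: "irreducible_rep \<Gamma> (centralizer \<Gamma> g) scale \<rho>"
  obtains q n where "0 < n" "q ^ n = 1" "\<rho> g = scale q"
proof -
  interpret group \<Gamma> by (rule grp)
  interpret I: induced_module \<Gamma> scale g \<rho>
    using grp g irr by (intro induced_module.intro) (simp_all add: irreducible_rep_def)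
  interpret vector_space scale by (rule I.vs)
  obtain n :: nat where n: "0 < n" and gn: "g [^]\<^bsub>\<Gamma>\<^esub> n = \<one>\<^bsub>\<Gamma>\<^esub>"
  proof -
    let ?f = "\<lambda>k :: nat. g [^]\<^bsub>\<Gamma>\<^esub> k"
    have "finite (range ?f)" by (rule finite_subset[OF _ fin]) (use g in auto)
    then have "\<not> inj ?f" using finite_imageD infinite_UNIV_nat by blast
    then obtain i j :: nat where ij: "?f i = ?f j" "i \<noteq> j" by (auto simp: inj_on_def)
    have "0 < max i j - min i j" "?f (max i j - min i j) = \<one>\<^bsub>\<Gamma>\<^esub>"
      using ij pow_eq_div2[OF g, of i j] pow_eq_div2[OF g, of j i] by (auto simp: max_def min_def)
    then show thesis by (rule that)
  qed
  have "g [^]\<^bsub>\<Gamma>\<^esub> k \<in> centralizer \<Gamma> g \<and> \<rho> (g [^]\<^bsub>\<Gamma>\<^esub> k) = \<rho> g ^^ k" for k :: nat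
  proof (induction k)
    case 0
    then show ?case using I.one_C I.rho_one by simp
  next
    case (Suc k)
    then have "\<rho> (g [^]\<^bsub>\<Gamma>\<^esub> k \<otimes>\<^bsub>\<Gamma>\<^esub> g) = \<rho> g ^^ Suc k" using I.rho_mult[of "g [^]\<^bsub>\<Gamma>\<^esub> k" g] I.g_C by (simp del: funpow.simps add: funpow_Suc_right)
    then show ?case using Suc I.C_mult[OF _ I.g_C] by simp
  qed
  then have "\<rho> g ^^ n = \<rho> (g [^]\<^bsub>\<Gamma>\<^esub> n)" by simp
  then have Tn: "\<rho> g ^^ n = id" using gn I.rho_one by simp
  obtain x :: 'w where "x \<noteq> 0" using irr unfolding irreducible_rep_def by blast
  from finite_order_eigenvector[OF I.rho_linear[OF I.g_C] n Tn this]
  obtain q y where q: "y \<noteq> 0" "\<rho> g y = scale q y" "q ^ n = 1" by metis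
  interpret T: Vector_Spaces.linear scale scale "\<rho> g" by (rule I.rho_linear[OF I.g_C])
  let ?U = "{y. \<rho> g y = scale q y}"
  have "subspace ?U" by (rule subspaceI) (simp_all add: T.add T.scale scale_right_distrib scale_left_commute)
  moreover have "\<rho> h ` ?U \<subseteq> ?U" if h: "h \<in> centralizer \<Gamma> g" for h
  proof -
    interpret H: Vector_Spaces.linear scale scale "\<rho> h" by (rule I.rho_linear[OF h])
    have "h \<otimes>\<^bsub>\<Gamma>\<^esub> g = g \<otimes>\<^bsub>\<Gamma>\<^esub> h" using h by (simp add: centralizer_def)
    then have "\<rho> g \<circ> \<rho> h = \<rho> h \<circ> \<rho> g" using I.rho_mult[OF h I.g_C] I.rho_mult[OF I.g_C h] by simp
    then have "\<rho> g (\<rho> h y) = \<rho> h (\<rho> g y)" for y by (metis comp_apply)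
    then show ?thesis by (auto simp: H.scale)
  qed
  ultimately have "?U = {0} \<or> ?U = UNIV" using irr unfolding irreducible_rep_def by blast
  then have "\<rho> g = scale q" using q by auto
  with n q(3) show thesis by (intro that)
qed

section \<open>The order of q\<close>

lemma letter_algebra_unbounded_order_ge_4:
  fixes q :: "'k::field_char_0"
  assumes d: "2 \<le> d" and N: "4 \<le> N" and q: "q ^ N = 1" "\<And>n. 0 < n \<Longrightarrow> n < N \<Longrightarrow> q ^ n \<noteq> 1"
  shows "letter_algebra_unbounded q d"
proof (cases "even N")
  case True
  then obtain m where m: "N = 2 * m" by blast
  show ?thesis
  proof (cases "even m")
    case True
    then show ?thesis using letter_algebra_unbounded_mult_4[OF d, of m q] q N m by simp
  next
    case False
    then have "m \<noteq> 2" by auto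
    then have "3 \<le> m" using N m by linarith
    then show ?thesis using letter_algebra_unbounded_even_odd[OF d _ False, of q] q m by simp
  qed
next
  case False
  then obtain m where "N = 2 * m + 1" by (rule oddE)
  then show ?thesis using letter_algebra_unbounded_odd[OF d, of m q] q N by simp
qed

theorem lemma3p1:
  fixes \<Gamma> :: "('g, 'a) monoid_scheme"
    and scale :: "'k::{alg_closed_field, field_char_0} \<Rightarrow> 'w::ab_group_add \<Rightarrow> 'w"
    and g :: 'g
    and \<rho> :: "'g \<Rightarrow> 'w \<Rightarrow> 'w"
  assumes "group \<Gamma>"
    and "finite (carrier \<Gamma>)"
    and "g \<in> carrier \<Gamma>"
    and "irreducible_rep \<Gamma> (centralizer \<Gamma> g) scale \<rho>"
    and "finite_nichols_rank \<Gamma> (yd_M \<Gamma> scale g \<rho>)"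
  shows "\<exists>q. q \<noteq> 0 \<and> \<rho> g = scale q \<and>
           (rep_degree scale \<ge> 3 \<longrightarrow> N_order q = 2) \<and>
           (rep_degree scale = 2 \<longrightarrow> 2 \<le> N_order q \<and> N_order q \<le> 3)"
proof -
  obtain q n where n: "0 < n" "q ^ n = 1" and q: "\<rho> g = scale q"
    using central_scalar[OF assms(1-4)] by metis
  interpret I: induced_module \<Gamma> scale g \<rho>
    using assms(1,3,4) by (intro induced_module.intro) (simp_all add: irreducible_rep_def)
  have bounded: "\<not> letter_algebra_unbounded q d" if "0 < d" "d \<le> rep_degree scale" for d
    using I.not_finite_nichols_rank[OF assms(2) q that] assms(5) by blast
  define N where "N = (LEAST n. 0 < n \<and> q ^ n = 1)"
  have N: "0 < N" "q ^ N = 1"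
    using LeastI[of "\<lambda>n. 0 < n \<and> q ^ n = 1" n] n by (simp_all add: N_def)
  have min: "q ^ k \<noteq> 1" if "0 < k" "k < N" for k
    using not_less_Least[of k "\<lambda>n. 0 < n \<and> q ^ n = 1"] that by (auto simp: N_def)
  have q0: "q \<noteq> 0" using n by (auto simp: power_0_left)
  have main: "N_order q = enat N \<and> 2 \<le> N \<and> N \<le> 3 \<and> (rep_degree scale \<ge> 3 \<longrightarrow> N = 2)" if deg: "2 \<le> rep_degree scale"
  proof -
    have q1: "q \<noteq> 1" using bounded[of 2] deg letter_algebra_unbounded_one[of 2] by auto
    then have "N \<noteq> 1" using N(2) by auto
    then have "2 \<le> N" using N(1) by linarith
    moreover have "N \<le> 3"
    proof (rule ccontr)
      assume "\<not> N \<le> 3"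
      then have "letter_algebra_unbounded q 2" using min by (intro letter_algebra_unbounded_order_ge_4[OF order_refl _ N(2)]) auto
      then show False using bounded[OF _ deg] by simp
    qed
    moreover have "N = 2" if "rep_degree scale \<ge> 3"
    proof (rule ccontr)
      assume "N \<noteq> 2"
      then have "N = 3" using \<open>2 \<le> N\<close> \<open>N \<le> 3\<close> by simp
      then show False
        using bounded[of 3] that letter_algebra_unbounded_3[of 3 q] N(2) q1 min[of 2] by simp
    qed
    moreover have "N_order q = enat N" using q1 n by (auto simp: N_order_def N_def)
    ultimately show ?thesis by blast
  qed
  show ?thesis
    using q0 q main by (intro exI[of _ q]) (auto simp: numeral_eq_enat)
qed

end
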